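(* Assume the small data condition $$\eta^{-2}M\left(2(Ri\,C_P^2\kappa^{-1}\|\gamma\|_{-1}+\|f\|_{-1})+\kappa^{-2}M\|\gamma\|_{-1}^2\right)<1,\qquad \eta^{-1}Ri\,C_P^2<1,$$ and assume $C_G<1$, where $C_G=\nu^{-1/2}\eta^{-1/2}M\sqrt{2K_1^2+3K_2^2}$. Let $m\ge 1$, let $(u_0,\theta_0)\in V_h\times W_h$, and let $(u_k,\theta_k)$ and the residuals $(w_k,z_k)$ be generated by the Anderson accelerated Boussinesq iteration of depth $m$ with damping factors $0<\beta_k\le 1$ described in the context. For $c_s>0$ there is a constant $C>0$, depending on $c_s$ (and on $m$ and $C_G$) but not on $k$ or on the iterates, such that the following holds. Let $k\ge 2$, and suppose $(w_j,z_j)\neq 0$ for $1\le j\le k$, that $(w_{j+1},z_{j+1})-(w_j,z_j)\ne 0$ for $1\le j\le k-1$, and that for each $1\le j\le k-1$ the direction sine (with respect to the inner product inducing $\|\cdot\|_B$) between $(w_{j+1},z_{j+1})-(w_j,z_j)$ and $\mathrm{span}\{(w_{n+1},z_{n+1})-(w_n,z_n)\}_{n=\max\{1,\,j-m_k+1\}}^{j-1}$ is at least $c_s$. Then $$\|(w_{k+1},z_{k+1})\|_B\le \|(w_k,z_k)\|_B\Bigg(\xi_k(1-\beta_k+C_G\beta_k)+\frac{C\hat C_G\sqrt{1-\xi_k^2}}{2}\bigg(\|(w_k,z_k)\|_B\,h(\xi_k)+2\sum_{j=k-m_k+1}^{k-1}(k-j)\|(w_j,z_j)\|_B\,h(\xi_j)+m_k\|(w_{k-m_k},z_{k-m_k})\|_B\,h(\xi_{k-m_k})\bigg)\Bigg),$$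 where $m_k=\min\{k-1,m\}$, $\xi_j:=\|(w_j^\alpha,z_j^\alpha)\|_B/\|(w_j,z_j)\|_B$ for $j\ge2$, $\xi_1:=1$, $\beta_1:=1$, $\hat C_G=2\nu^{-1}\eta^{-3/2}M^2(2K_1^2+9K_2^2)^{1/2}$, and the quantities $h(\xi_j)$ satisfy $h(\xi_j)\le C\sqrt{1-\xi_j^2}+\beta_j\xi_j$.
   Context: Setting. $\Omega\subset\mathbb{R}^d$ ($d=2$ or $3$) is a bounded simply connected domain that is either a convex polytope or has smooth boundary. $(\cdot,\cdot)$ and $\|\cdot\|$ are the $L^2(\Omega)$ inner product (also used for duality pairings) and norm. $X=H_0^1(\Omega)^d$, $Q=L_0^2(\Omega)$ (mean-zero $L^2$ functions), $W=H_0^1(\Omega)$. $\|\cdot\|_{-1}$ is the norm dual to $v\mapsto\|\nabla v\|$. $C_P>0$ is a Poincaré constant: $\|v\|\le C_P\|\nabla v\|$ for $v\in X$ or $v\in W$. Define $b(u,v,w)=\frac12((u\cdot\nabla v,w)-(u\cdot\nabla w,v))$ on $X\times X\times X$ and $b^*(v,\phi,\psi)=\frac12((v\cdot\nabla\phi,\psi)-(v\cdot\nabla\psi,\phi))$ on $X\times W\times W$. $M>0$ is a constant depending only on $\Omega$ with $b(u,v,w)\le M\|\nabla u\|\|\nabla v\|\|\nabla w\|$ and $b^*(v,\phi,\psi)\le M\|\nabla v\|\|\nabla\phi\|\|\nabla\psi\|$. $X_h\subset X$, $Q_h\subset Q$, $W_h\subset W$ are finite-dimensional (finite element) subspaces with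 $(X_h,Q_h)$ satisfying the discrete inf-sup condition, and $V_h=\{v\in X_h:(\nabla\cdot v,q)=0\ \forall q\in Q_h\}$. The parameters $\nu,\kappa,Ri$ are positive, $\eta=\min\{\nu,\kappa\}$, $f\in H^{-1}(\Omega)^d$, $\gamma\in H^{-1}(\Omega)$. $\langle 0,\theta\rangle^T$ is the vector field whose last component is $\theta$ and whose other components are zero. Constants: $K_1=Ri\,C_P^2\nu^{-1}\kappa^{-1}\|\gamma\|_{-1}+\nu^{-1}\|f\|_{-1}$, $K_2=\kappa^{-1}\|\gamma\|_{-1}$. Norm: $\|(v,w)\|_B=\sqrt{\nu\|\nabla v\|^2+\kappa\|\nabla w\|^2}$ on $V_h\times W_h$. Direction sine: for a nonzero vector $a$ and subspace $S$ of an inner product space, the direction sine between $a$ and $S$ is $\mathrm{dist}(a,S)/\|a\|$ (equal to $1$ if $S=\{0\}$). Anderson accelerated Boussinesq iteration. For $k\ge1$, given $(u_{k-1},\theta_{k-1})$, let $(\tilde u_k,\tilde\theta_k)\in V_h\times W_h$ be the solution of $$b^*(u_{k-1},\tilde\theta_k,\chi)+\kappa(\nabla\tilde\theta_k,\nabla\chi)=(\gamma,\chi)\quad\forall\chi\in W_h,$$ $$b(u_{k-1},\tilde u_k,v)+\nu(\nabla\tilde u_k,\nabla v)=Ri(\langle 0,\tilde\theta_k\rangle^T,v)+(f,v)\quad\forall v\in V_h,$$ and set $w_k=\tilde u_k-u_{k-1}$, $z_k=\tilde\theta_k-\theta_{k-1}$. For $k=1$ set $(u_1,\theta_1)=(\tilde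 u_1,\tilde\theta_1)$. For $k\ge2$ set $m_k=\min\{k-1,m\}$, choose real numbers $\{\alpha_j^k\}_{j=k-m_k}^{k-1}$ minimizing $\|(w_k^\alpha,z_k^\alpha)\|_B$, where $$(w_k^\alpha,z_k^\alpha)=\Big(1-\sum_{j=k-m_k}^{k-1}\alpha_j^k\Big)(w_k,z_k)+\sum_{j=k-m_k}^{k-1}\alpha_j^k(w_j,z_j),$$ and set $$(u_k,\theta_k)=\Big(1-\sum_{j=k-m_k}^{k-1}\alpha_j^k\Big)(u_{k-1},\theta_{k-1})+\sum_{j=k-m_k}^{k-1}\alpha_j^k(u_{j-1},\theta_{j-1})+\beta_k(w_k^\alpha,z_k^\alpha).$$ *)

theory Defs
  imports "HOL-Analysis.Analysis" "HOL-Library.Function_Algebras"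
begin

text \<open>
  Elements of Lebesgue and Sobolev spaces are represented by functions on the whole of
  \<open>real^'d\<close>, of which only the values almost everywhere in the domain \<open>\<Omega>\<close> matter.  Functions
  form a real vector space pointwise, so that linear combinations and \<^const>\<open>span\<close> are
  available for functions and, by the product instance, for velocity-temperature pairs.
\<close>

instantiation "fun" :: (type, real_vector) real_vector
begin

definition scaleR_fun :: "real \<Rightarrow> ('a \<Rightarrow> 'b) \<Rightarrow> 'a \<Rightarrow> 'b"
  where "scaleR_fun c f = (\<lambda>x. c *\<^sub>R f x)"

instance
  by standard (simp_all add: scaleR_fun_def fun_eq_iff scaleR_add_right scaleR_add_left)

end

section \<open>Domains\<close>

primrec Ck_on :: "nat \<Rightarrow> ('a::euclidean_space \<Rightarrow> 'b::real_normed_vector) \<Rightarrow> 'a set \<Rightarrow> bool" where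
  "Ck_on 0 f S \<longleftrightarrow> continuous_on S f"
| "Ck_on (Suc n) f S \<longleftrightarrow> f differentiable_on S \<and>
     (\<forall>e\<in>Basis. Ck_on n (\<lambda>x. frechet_derivative f (at x) e) S)"

text \<open>Only used for open sets \<open>S\<close>.\<close>

definition smooth_on :: "('a::euclidean_space \<Rightarrow> 'b::real_normed_vector) \<Rightarrow> 'a set \<Rightarrow> bool"
  where "smooth_on f S \<longleftrightarrow> (\<forall>n. Ck_on n f S)"

text \<open>Near each boundary point the domain is a sublevel set of a smooth function without
  critical points.\<close>

definition smooth_boundary :: "'a::euclidean_space set \<Rightarrow> bool"
  where "smooth_boundary \<Omega> \<longleftrightarrow>
    (\<forall>p\<in>frontier \<Omega>. \<exists>U (\<rho> :: 'a \<Rightarrow> real). open U \<and> p \<in> U \<and> smooth_on \<rho> U \<and>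
       (\<forall>x\<in>U. \<exists>v. frechet_derivative \<rho> (at x) v \<noteq> 0) \<and>
       \<Omega> \<inter> U = {x\<in>U. \<rho> x < 0})"

definition admissible_domain :: "'a::euclidean_space set \<Rightarrow> bool"
  where "admissible_domain \<Omega> \<longleftrightarrow>
    open \<Omega> \<and> connected \<Omega> \<and> \<Omega> \<noteq> {} \<and> bounded \<Omega> \<and> simply_connected \<Omega> \<and>
    ((\<exists>P. polytope P \<and> \<Omega> = interior P) \<or> smooth_boundary \<Omega>)"

section \<open>Function spaces\<close>

definition L2 :: "'a::euclidean_space set \<Rightarrow> ('a \<Rightarrow> 'b::euclidean_space) set"
  where "L2 \<Omega> = {u. u \<in> borel_measurable (lebesgue_on \<Omega>) \<and>
                    integrable (lebesgue_on \<Omega>) (\<lambda>x. (norm (u x))\<^sup>2)}"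

definition l2inner :: "'a::euclidean_space set \<Rightarrow> ('a \<Rightarrow> 'b::euclidean_space) \<Rightarrow> ('a \<Rightarrow> 'b) \<Rightarrow> real"
  where "l2inner \<Omega> u v = (\<integral>x. u x \<bullet> v x \<partial>lebesgue_on \<Omega>)"

definition l2norm :: "'a::euclidean_space set \<Rightarrow> ('a \<Rightarrow> 'b::euclidean_space) \<Rightarrow> real"
  where "l2norm \<Omega> u = sqrt (\<integral>x. (norm (u x))\<^sup>2 \<partial>lebesgue_on \<Omega>)"

definition L20 :: "'a::euclidean_space set \<Rightarrow> ('a \<Rightarrow> real) set"
  where "L20 \<Omega> = {q \<in> L2 \<Omega>. (\<integral>x. q x \<partial>lebesgue_on \<Omega>) = 0}"

definition test_fun :: "'a::euclidean_space set \<Rightarrow> ('a \<Rightarrow> 'b::euclidean_space) \<Rightarrow> bool"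
  where "test_fun \<Omega> \<phi> \<longleftrightarrow> smooth_on \<phi> UNIV \<and>
    (\<exists>K. compact K \<and> K \<subseteq> \<Omega> \<and> (\<forall>x. x \<notin> K \<longrightarrow> \<phi> x = 0))"

text \<open>Component \<open>i\<close> of a gradient is the \<open>i\<close>-th partial derivative, for scalar fields
  (\<open>'b = real\<close>) as well as for vector fields (\<open>'b = real^'d\<close>); in the latter case the norm
  and the inner product on \<open>'b^'d\<close> are the Frobenius ones.\<close>

definition classical_grad :: "(real^'d \<Rightarrow> 'b::euclidean_space) \<Rightarrow> real^'d \<Rightarrow> 'b^'d"
  where "classical_grad \<phi> x = (\<chi> i. frechet_derivative \<phi> (at x) (axis i 1))"

text \<open>\<open>H\<^sub>0\<^sup>1(\<Omega>)\<close> is the closure of the test functions in the \<open>H\<^sup>1\<close> norm.  The limit \<open>g\<close> of the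
  gradients is the weak gradient of \<open>u\<close>; it is determined by \<open>u\<close> almost everywhere, hence the
  choice in \<open>grad\<close>.\<close>

definition has_grad0 ::
    "(real^'d) set \<Rightarrow> (real^'d \<Rightarrow> 'b::euclidean_space) \<Rightarrow> (real^'d \<Rightarrow> 'b^'d) \<Rightarrow> bool"
  where "has_grad0 \<Omega> u g \<longleftrightarrow> u \<in> L2 \<Omega> \<and> g \<in> L2 \<Omega> \<and>
    (\<exists>\<phi>. (\<forall>n::nat. test_fun \<Omega> (\<phi> n)) \<and>
         (\<lambda>n. l2norm \<Omega> (\<phi> n - u)) \<longlonglongrightarrow> 0 \<and>
         (\<lambda>n. l2norm \<Omega> (classical_grad (\<phi> n) - g)) \<longlonglongrightarrow> 0)"

definition H10 :: "(real^'d) set \<Rightarrow> (real^'d \<Rightarrow> 'b::euclidean_space) set"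
  where "H10 \<Omega> = {u. \<exists>g. has_grad0 \<Omega> u g}"

definition grad :: "(real^'d) set \<Rightarrow> (real^'d \<Rightarrow> 'b::euclidean_space) \<Rightarrow> real^'d \<Rightarrow> 'b^'d"
  where "grad \<Omega> u = (SOME g. has_grad0 \<Omega> u g)"

definition grad_norm :: "(real^'d) set \<Rightarrow> (real^'d \<Rightarrow> 'b::euclidean_space) \<Rightarrow> real"
  where "grad_norm \<Omega> u = l2norm \<Omega> (grad \<Omega> u)"

definition divergence :: "(real^'d) set \<Rightarrow> (real^'d \<Rightarrow> real^'d) \<Rightarrow> real^'d \<Rightarrow> real"
  where "divergence \<Omega> v x = (\<Sum>i\<in>UNIV. grad \<Omega> v x $ i $ i)"

text \<open>The dual space of \<open>H\<^sub>0\<^sup>1\<close>; the pairing \<open>(F, v)\<close> is the application \<open>F v\<close>.  In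
  \<open>dual_norm\<close>, elements with vanishing gradient contribute \<open>0\<close> to the supremum.\<close>

definition Hm1 :: "(real^'d) set \<Rightarrow> ((real^'d \<Rightarrow> 'b::euclidean_space) \<Rightarrow> real) set"
  where "Hm1 \<Omega> = {F.
    (\<forall>u\<in>H10 \<Omega>. \<forall>v\<in>H10 \<Omega>. F (u + v) = F u + F v) \<and>
    (\<forall>c. \<forall>u\<in>H10 \<Omega>. F (c *\<^sub>R u) = c * F u) \<and>
    (\<exists>B. \<forall>v\<in>H10 \<Omega>. \<bar>F v\<bar> \<le> B * grad_norm \<Omega> v)}"

definition dual_norm :: "(real^'d) set \<Rightarrow> ((real^'d \<Rightarrow> 'b::euclidean_space) \<Rightarrow> real) \<Rightarrow> real"
  where "dual_norm \<Omega> F = (SUP v\<in>H10 \<Omega>. \<bar>F v\<bar> / grad_norm \<Omega> v)"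

text \<open>\<open>convect \<Omega> u v = u \<cdot> \<nabla>v\<close>.  The form \<open>skew_conv\<close> is \<open>b\<close> on vector fields \<open>v, w\<close> and \<open>b\<^sup>*\<close>
  on scalar fields \<open>v, w\<close>.\<close>

definition convect ::
    "(real^'d) set \<Rightarrow> (real^'d \<Rightarrow> real^'d) \<Rightarrow> (real^'d \<Rightarrow> 'b::euclidean_space) \<Rightarrow> real^'d \<Rightarrow> 'b"
  where "convect \<Omega> u v x = (\<Sum>i\<in>UNIV. (u x $ i) *\<^sub>R (grad \<Omega> v x $ i))"

definition skew_conv ::
    "(real^'d) set \<Rightarrow> (real^'d \<Rightarrow> real^'d) \<Rightarrow> (real^'d \<Rightarrow> 'b::euclidean_space) \<Rightarrow>
     (real^'d \<Rightarrow> 'b) \<Rightarrow> real"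
  where "skew_conv \<Omega> u v w =
    (l2inner \<Omega> (convect \<Omega> u v) w - l2inner \<Omega> (convect \<Omega> u w) v) / 2"

section \<open>The discrete Boussinesq problem\<close>

type_synonym 'd vfield = "(real, 'd) vec \<Rightarrow> (real, 'd) vec"
type_synonym 'd sfield = "(real, 'd) vec \<Rightarrow> real"

record ('d::"{finite,linorder}") boussinesq =
  Dom :: "(real, 'd) vec set"
  Xh :: "'d vfield set"
  Qh :: "'d sfield set"
  Wh :: "'d sfield set"
  nu :: real
  kappa :: real
  Ri :: real
  CP :: real
  bM :: real
  force :: "'d vfield \<Rightarrow> real"
  heat :: "'d sfield \<Rightarrow> real"

definition fin_dim :: "'v::real_vector set \<Rightarrow> bool"
  where "fin_dim S \<longleftrightarrow> (\<exists>B. finite B \<and> S = span B)"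

definition inf_sup :: "(real^'d) set \<Rightarrow> 'd vfield set \<Rightarrow> 'd sfield set \<Rightarrow> bool"
  where "inf_sup \<Omega> X Q \<longleftrightarrow> (\<exists>\<beta>>0. \<forall>q\<in>Q.
    \<beta> * l2norm \<Omega> q \<le> (SUP v\<in>X. l2inner \<Omega> (divergence \<Omega> v) q / grad_norm \<Omega> v))"

definition Vh :: "('d::{finite,linorder}) boussinesq \<Rightarrow> 'd vfield set"
  where "Vh P = {v \<in> Xh P. \<forall>q\<in>Qh P. l2inner (Dom P) (divergence (Dom P) v) q = 0}"

definition boussinesq_setting :: "('d::{finite,linorder}) boussinesq \<Rightarrow> bool"
  where "boussinesq_setting P \<longleftrightarrow>
    admissible_domain (Dom P) \<and>
    Xh P \<subseteq> H10 (Dom P) \<and> fin_dim (Xh P) \<and>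
    Qh P \<subseteq> L20 (Dom P) \<and> fin_dim (Qh P) \<and>
    Wh P \<subseteq> H10 (Dom P) \<and> fin_dim (Wh P) \<and>
    inf_sup (Dom P) (Xh P) (Qh P) \<and>
    nu P > 0 \<and> kappa P > 0 \<and> Ri P > 0 \<and>
    force P \<in> Hm1 (Dom P) \<and> heat P \<in> Hm1 (Dom P) \<and>
    CP P > 0 \<and>
    (\<forall>v :: 'd vfield \<in> H10 (Dom P). l2norm (Dom P) v \<le> CP P * grad_norm (Dom P) v) \<and>
    (\<forall>w :: 'd sfield \<in> H10 (Dom P). l2norm (Dom P) w \<le> CP P * grad_norm (Dom P) w) \<and>
    bM P > 0 \<and>
    (\<forall>u\<in>H10 (Dom P). \<forall>v :: 'd vfield \<in> H10 (Dom P). \<forall>w\<in>H10 (Dom P).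
       skew_conv (Dom P) u v w
         \<le> bM P * grad_norm (Dom P) u * grad_norm (Dom P) v * grad_norm (Dom P) w) \<and>
    (\<forall>v\<in>H10 (Dom P). \<forall>\<phi> :: 'd sfield \<in> H10 (Dom P). \<forall>\<psi>\<in>H10 (Dom P).
       skew_conv (Dom P) v \<phi> \<psi>
         \<le> bM P * grad_norm (Dom P) v * grad_norm (Dom P) \<phi> * grad_norm (Dom P) \<psi>)"

definition eta :: "('d::{finite,linorder}) boussinesq \<Rightarrow> real"
  where "eta P = min (nu P) (kappa P)"

definition force_norm :: "('d::{finite,linorder}) boussinesq \<Rightarrow> real"
  where "force_norm P = dual_norm (Dom P) (force P)"

definition heat_norm :: "('d::{finite,linorder}) boussinesq \<Rightarrow> real"
  where "heat_norm P = dual_norm (Dom P) (heat P)"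

definition K1 :: "('d::{finite,linorder}) boussinesq \<Rightarrow> real"
  where "K1 P = Ri P * (CP P)\<^sup>2 / (nu P * kappa P) * heat_norm P + force_norm P / nu P"

definition K2 :: "('d::{finite,linorder}) boussinesq \<Rightarrow> real"
  where "K2 P = heat_norm P / kappa P"

definition CG :: "('d::{finite,linorder}) boussinesq \<Rightarrow> real"
  where "CG P = nu P powr (- 1/2) * eta P powr (- 1/2) * bM P
                  * sqrt (2 * (K1 P)\<^sup>2 + 3 * (K2 P)\<^sup>2)"

definition CG_hat :: "('d::{finite,linorder}) boussinesq \<Rightarrow> real"
  where "CG_hat P = 2 * inverse (nu P) * eta P powr (- 3/2) * (bM P)\<^sup>2
                      * sqrt (2 * (K1 P)\<^sup>2 + 9 * (K2 P)\<^sup>2)"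

text \<open>Velocity-temperature pairs; as elements of the function spaces they vanish iff they vanish
  almost everywhere in the domain.\<close>

type_synonym 'd state = "'d vfield \<times> 'd sfield"

definition normB :: "('d::{finite,linorder}) boussinesq \<Rightarrow> 'd state \<Rightarrow> real"
  where "normB P s = sqrt (nu P * (grad_norm (Dom P) (fst s))\<^sup>2
                         + kappa P * (grad_norm (Dom P) (snd s))\<^sup>2)"

definition is_null :: "('d::{finite,linorder}) boussinesq \<Rightarrow> 'd state \<Rightarrow> bool"
  where "is_null P s \<longleftrightarrow> (AE x in lebesgue_on (Dom P). fst s x = 0 \<and> snd s x = 0)"

definition direction_sine :: "('d::{finite,linorder}) boussinesq \<Rightarrow> 'd state \<Rightarrow> 'd state set \<Rightarrow> real"
  where "direction_sine P a S = (INF s\<in>S. normB P (a - s)) / normB P a"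

section \<open>The Anderson accelerated iteration\<close>

text \<open>\<open>boussinesq_step P (u, \<theta>) (u', \<theta>')\<close>: the pair \<open>(u', \<theta>')\<close> solves the linearised problem at
  \<open>(u, \<theta>)\<close>.  The last coordinate direction is \<open>Max UNIV\<close>.\<close>

definition boussinesq_step :: "('d::{finite,linorder}) boussinesq \<Rightarrow> 'd state \<Rightarrow> 'd state \<Rightarrow> bool"
  where "boussinesq_step P s s' \<longleftrightarrow>
    (case s of (u, \<theta>) \<Rightarrow> case s' of (u', \<theta>') \<Rightarrow>
      u' \<in> Vh P \<and> \<theta>' \<in> Wh P \<and>
      (\<forall>\<psi>\<in>Wh P.
         skew_conv (Dom P) u \<theta>' \<psi> + kappa P * l2inner (Dom P) (grad (Dom P) \<theta>') (grad (Dom P) \<psi>)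
           = heat P \<psi>) \<and>
      (\<forall>v\<in>Vh P.
         skew_conv (Dom P) u u' v + nu P * l2inner (Dom P) (grad (Dom P) u') (grad (Dom P) v)
           = Ri P * l2inner (Dom P) (\<lambda>x. axis (Max UNIV) (\<theta>' x)) v + force P v))"

definition depth :: "nat \<Rightarrow> nat \<Rightarrow> nat"
  where "depth m k = min (k - 1) m"

definition aa_comb :: "nat \<Rightarrow> nat \<Rightarrow> (nat \<Rightarrow> real) \<Rightarrow> (nat \<Rightarrow> 'v::real_vector) \<Rightarrow> 'v"
  where "aa_comb m k a x =
    (1 - (\<Sum>j = k - depth m k..k - 1. a j)) *\<^sub>R x k + (\<Sum>j = k - depth m k..k - 1. a j *\<^sub>R x j)"

text \<open>In the following, \<open>y k\<close> is \<open>(u\<^sub>k, \<theta>\<^sub>k)\<close>, \<open>t k\<close> is the solution computed from \<open>y (k - 1)\<close>,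
  and \<open>residual y t k\<close> is \<open>(w\<^sub>k, z\<^sub>k)\<close>.\<close>

definition residual :: "(nat \<Rightarrow> 'v::real_vector) \<Rightarrow> (nat \<Rightarrow> 'v) \<Rightarrow> nat \<Rightarrow> 'v"
  where "residual y t k = t k - y (k - 1)"

definition anderson_boussinesq ::
    "('d::{finite,linorder}) boussinesq \<Rightarrow> nat \<Rightarrow> (nat \<Rightarrow> real) \<Rightarrow> (nat \<Rightarrow> nat \<Rightarrow> real) \<Rightarrow>
     (nat \<Rightarrow> 'd state) \<Rightarrow> (nat \<Rightarrow> 'd state) \<Rightarrow> bool"
  where "anderson_boussinesq P m \<beta> \<alpha> y t \<longleftrightarrow>
    y 0 \<in> Vh P \<times> Wh P \<and>
    (\<forall>k\<ge>1. boussinesq_step P (y (k - 1)) (t k)) \<and>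
    y 1 = t 1 \<and>
    (\<forall>k\<ge>2. (\<forall>a. normB P (aa_comb m k (\<alpha> k) (residual y t))
                  \<le> normB P (aa_comb m k a (residual y t))) \<and>
            y k = aa_comb m k (\<alpha> k) (\<lambda>j. y (j - 1))
                    + \<beta> k *\<^sub>R aa_comb m k (\<alpha> k) (residual y t))"

definition opt_gain ::
    "('d::{finite,linorder}) boussinesq \<Rightarrow> nat \<Rightarrow> (nat \<Rightarrow> nat \<Rightarrow> real) \<Rightarrow> (nat \<Rightarrow> 'd state) \<Rightarrow> nat \<Rightarrow> real"
  where "opt_gain P m \<alpha> r j =
    (if j = 1 then 1 else normB P (aa_comb m j (\<alpha> j) r) / normB P (r j))"

end

theory Submission
  imports Defs
begin

text \<open>
  Write \<open>G\<close> for the solution map of the linearised problem, \<open>e\<^sub>n = y\<^sub>n - y\<^sub>n\<^sub>-\<^sub>1\<close>, and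
  express the accelerated combinations by increments, with coefficients \<open>\<gamma>\<^sub>n\<close>.  Then
  \<open>r\<^sub>k\<^sub>+\<^sub>1 = (1 - \<beta>\<^sub>k) w\<^sup>\<alpha> + R\<close>, where \<open>R\<close> is the sum of \<open>G y\<^sub>k - G y\<^sub>k\<^sub>-\<^sub>1\<close> and of the
  \<open>\<gamma>\<^sub>n (G y\<^sub>n - G y\<^sub>n\<^sub>-\<^sub>1)\<close>.  No derivative of \<open>G\<close> is needed: \<open>R\<close> itself solves the problem
  linearised at \<open>y\<^sub>k\<close>, the right-hand side being convection by \<open>\<beta>\<^sub>k w\<^sup>\<alpha>\<close> plus, for each \<open>n\<close>, products of
  \<open>e\<^sub>n\<close> with differences of iterates.  Skew symmetry and the energy estimate give the constants \<open>C\<^sub>G\<close>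
  for the first part and half of the hatted constant for the second.

  The least-squares correction is an orthogonal projection of norm \<open>sqrt (1 - \<xi>\<^sup>2)\<close> times that of the
  residual; its coefficients are peeled off one at a time, at the cost of a factor \<open>1 + 1/c\<^sub>s\<close> each, and
  \<open>(1 - C\<^sub>G) \<parallel>e\<^sub>n\<parallel> \<le> \<parallel>r\<^sub>n\<^sub>+\<^sub>1 - r\<^sub>n\<parallel>\<close> converts them into bounds on \<open>\<gamma>\<^sub>n e\<^sub>n\<close>.

  The convection form is trilinear only because its integrand is integrable, which rests on the
  embedding of \<open>H\<^sub>0\<^sup>1\<close> into \<open>L\<^sup>4\<close> in dimensions two and three; linearity of the weak gradient rests on the
  closability of the gradient on test functions.
\<close>

section \<open>Semi-inner products and least squares\<close>

text \<open>Fields are pointwise representatives, so a norm may vanish on a non-zero element and the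
  weak gradient is linear only almost everywhere. The Hilbert space arguments therefore use
  semi-inner products on a carrier set, and lower bounds are kept multiplied out, as in
  \<open>c * nrm (d n) \<le> nrm (d n - s)\<close>. The constant has to be fixed before the problem,
  the iterates and \<open>k\<close>. For this reason the acceleration argument is separated from the
  equations: it sees a Lipschitz constant \<open>q\<close>, a second-order constant
  \<open>L\<close>, and the window bound \<open>m\<close>. One correction term costs
  \<open>(1 + 1 / c_s) ^ m / c_s / (1 - q)\<close>; \<open>C\<close> is \<open>m\<close> times this,
  \<open>m\<close> bounding the number of terms. The identity for \<open>R\<close> is exact because
  convection is quadratic: what is not linear in the damped residual is a sum of products of two
  differences. A step is triangular, temperature first and velocity second, so the only coupling is
  a source term, paid for by diffusion through \<open>Ri P * (CP P)\<^sup>2 \<le> eta P\<close>. The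
  past residuals arise with weights one and two, which the weights in the statement
  dominate.\<close>

locale semi_inner =
  fixes V :: "'v::real_vector set" and ip :: "'v \<Rightarrow> 'v \<Rightarrow> real"
  assumes subspace_V: "subspace V"
    and ip_add_left: "\<lbrakk>x \<in> V; y \<in> V; z \<in> V\<rbrakk> \<Longrightarrow> ip (x + y) z = ip x z + ip y z"
    and ip_scale_left: "\<lbrakk>x \<in> V; y \<in> V\<rbrakk> \<Longrightarrow> ip (c *\<^sub>R x) y = c * ip x y"
    and ip_sym: "\<lbrakk>x \<in> V; y \<in> V\<rbrakk> \<Longrightarrow> ip x y = ip y x"
    and ip_nonneg: "x \<in> V \<Longrightarrow> ip x x \<ge> 0"
begin

definition nrm :: "'v \<Rightarrow> real" where "nrm x = sqrt (ip x x)"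

lemma add_V [intro, simp]: "\<lbrakk>x \<in> V; y \<in> V\<rbrakk> \<Longrightarrow> x + y \<in> V"
  and scale_V [intro, simp]: "x \<in> V \<Longrightarrow> c *\<^sub>R x \<in> V"
  and diff_V [intro, simp]: "\<lbrakk>x \<in> V; y \<in> V\<rbrakk> \<Longrightarrow> x - y \<in> V"
  and zero_V [intro, simp]: "0 \<in> V"
  and sum_V [intro]: "(\<And>i. i \<in> I \<Longrightarrow> f i \<in> V) \<Longrightarrow> (\<Sum>i\<in>I. f i) \<in> V"
  using subspace_V
  by (auto intro: subspace_add subspace_scale subspace_diff subspace_0 subspace_sum)

lemma ip_add_right: "\<lbrakk>x \<in> V; y \<in> V; z \<in> V\<rbrakk> \<Longrightarrow> ip z (x + y) = ip z x + ip z y"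
  using ip_add_left ip_sym by (metis add_V)

lemma ip_scale_right: "\<lbrakk>x \<in> V; y \<in> V\<rbrakk> \<Longrightarrow> ip x (c *\<^sub>R y) = c * ip x y"
  using ip_scale_left ip_sym by (metis scale_V)

lemma ip_diff_left: "\<lbrakk>x \<in> V; y \<in> V; z \<in> V\<rbrakk> \<Longrightarrow> ip (x - y) z = ip x z - ip y z"
  using ip_add_left[of "x - y" y z] by (simp add: diff_V)

lemma ip_diff_right: "\<lbrakk>x \<in> V; y \<in> V; z \<in> V\<rbrakk> \<Longrightarrow> ip z (x - y) = ip z x - ip z y"
  using ip_diff_left ip_sym by (metis diff_V)

lemma ip_zero_left: "x \<in> V \<Longrightarrow> ip 0 x = 0"
  using ip_scale_left[of x x 0] by simp

lemma ip_sum_left: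
  assumes "finite I" "\<And>i. i \<in> I \<Longrightarrow> f i \<in> V" "z \<in> V"
  shows "ip (\<Sum>i\<in>I. f i) z = (\<Sum>i\<in>I. ip (f i) z)"
  using assms
proof (induction I rule: finite_induct)
  case empty then show ?case by (simp add: ip_zero_left)
next
  case (insert i I)
  then show ?case by (simp add: ip_add_left sum_V)
qed

lemma nrm_nonneg: "x \<in> V \<Longrightarrow> nrm x \<ge> 0"
  by (simp add: nrm_def ip_nonneg)

lemma nrm_sq: "x \<in> V \<Longrightarrow> (nrm x)\<^sup>2 = ip x x"
  by (simp add: nrm_def ip_nonneg)

lemma ip_diff_scale:
  assumes "x \<in> V" "y \<in> V"
  shows "ip (x - s *\<^sub>R y) (x - s *\<^sub>R y) = ip x x - 2 * s * ip x y + s\<^sup>2 * ip y y"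
  using assms ip_sym[of y x]
  by (simp add: ip_diff_left ip_diff_right ip_scale_left ip_scale_right power2_eq_square algebra_simps)

lemma cauchy_schwarz:
  assumes "x \<in> V" "y \<in> V"
  shows "\<bar>ip x y\<bar> \<le> nrm x * nrm y"
proof -
  have pos: "0 \<le> ip x x - 2 * s * ip x y + s\<^sup>2 * ip y y" for s
    using ip_nonneg[of "x - s *\<^sub>R y"] ip_diff_scale[OF assms, of s] assms by simp
  have "(ip x y)\<^sup>2 \<le> ip x x * ip y y"
  proof (cases "ip y y = 0")
    case True
    have "ip x y = 0"
    proof (rule ccontr)
      assume "ip x y \<noteq> 0"
      \<comment> \<open>With \<open>ip y y = 0\<close> the quadratic is affine in \<open>s\<close>,
        and at this \<open>s\<close> it takes the value -1.\<close>
      with pos[of "(ip x x + 1) / (2 * ip x y)"] True show False by simp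
    qed
    then show ?thesis using True by simp
  next
    case False
    then have y: "ip y y > 0" using ip_nonneg[OF assms(2)] by simp
    have "0 \<le> ip x x - (ip x y)\<^sup>2 / ip y y"
      using pos[of "ip x y / ip y y"] False by (simp add: power2_eq_square field_simps)
    then show ?thesis using y by (simp add: field_simps)
  qed
  then have "sqrt ((ip x y)\<^sup>2) \<le> sqrt (ip x x * ip y y)" by (rule real_sqrt_le_mono)
  then show ?thesis by (simp add: nrm_def real_sqrt_mult)
qed

lemma nrm_triangle:
  assumes "x \<in> V" "y \<in> V"
  shows "nrm (x + y) \<le> nrm x + nrm y"
proof (rule power2_le_imp_le)
  have "(nrm (x + y))\<^sup>2 = (nrm x)\<^sup>2 + 2 * ip x y + (nrm y)\<^sup>2"
    using assms ip_sym[of y x] by (simp add: nrm_sq ip_add_left ip_add_right)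
  also have "\<dots> \<le> (nrm x + nrm y)\<^sup>2"
    using cauchy_schwarz[OF assms] by (simp add: power2_sum)
  finally show "(nrm (x + y))\<^sup>2 \<le> (nrm x + nrm y)\<^sup>2" .
qed (use assms in \<open>simp add: nrm_nonneg\<close>)

lemma nrm_scale: "x \<in> V \<Longrightarrow> nrm (c *\<^sub>R x) = \<bar>c\<bar> * nrm x"
  by (simp add: nrm_def ip_scale_left ip_scale_right real_sqrt_mult flip: mult.assoc power2_eq_square)

lemma nrm_zero: "nrm 0 = 0"
  by (simp add: nrm_def ip_zero_left)

lemma nrm_triangle_diff: "\<lbrakk>x \<in> V; y \<in> V\<rbrakk> \<Longrightarrow> nrm (x - y) \<le> nrm x + nrm y"
  using nrm_triangle[of x "-1 *\<^sub>R y"] nrm_scale[of y "-1"] scale_V[of y "-1"] by simp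

lemma nrm_sum:
  assumes "finite I" "\<And>i. i \<in> I \<Longrightarrow> f i \<in> V"
  shows "nrm (\<Sum>i\<in>I. f i) \<le> (\<Sum>i\<in>I. nrm (f i))"
  using assms
proof (induction I rule: finite_induct)
  case empty then show ?case by (simp add: nrm_zero)
next
  case (insert i I)
  have "nrm (f i + (\<Sum>i\<in>I. f i)) \<le> nrm (f i) + nrm (\<Sum>i\<in>I. f i)"
    by (rule nrm_triangle) (use insert in \<open>auto intro: sum_V\<close>)
  then show ?case using insert by simp
qed

text \<open>Induction on the upper end. The last term is controlled because the whole sum divided by
  \<open>g b\<close> is \<open>d b\<close> minus an element of the earlier span; removing it
  enlarges the norm of the rest by at most \<open>1 + 1 / c\<close>. The exponent
  \<open>b - 1 - n\<close> counts the terms removed before \<open>d n\<close> becomes the last one.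
  Increments of norm zero cause no trouble, since \<open>sine\<close> contains no quotient.\<close>

lemma coeff_bound:
  fixes d :: "nat \<Rightarrow> 'v" and g :: "nat \<Rightarrow> real"
  assumes c: "c > 0" and d: "\<And>n. n \<in> {a..<b} \<Longrightarrow> d n \<in> V"
    and sine: "\<And>n s. \<lbrakk>n \<in> {a..<b}; s \<in> span (d ` {a..<n})\<rbrakk> \<Longrightarrow> c * nrm (d n) \<le> nrm (d n - s)"
    and n: "n \<in> {a..<b}"
  shows "\<bar>g n\<bar> * nrm (d n) \<le> (1 + 1 / c) ^ (b - 1 - n) / c * nrm (\<Sum>i\<in>{a..<b}. g i *\<^sub>R d i)"
  using d sine n
proof (induction b)
  case 0 then show ?case by simp
next
  case (Suc b)
  let ?q = "\<Sum>i\<in>{a..<b}. g i *\<^sub>R d i"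
  let ?p = "\<Sum>i\<in>{a..<Suc b}. g i *\<^sub>R d i"
  have ab: "a \<le> b" using Suc.prems(3) by auto
  have dV: "d i \<in> V" if "i \<in> {a..b}" for i using Suc.prems(1) that by auto
  have q: "?q \<in> V" using dV by (intro sum_V) auto
  have p: "?p \<in> V" using dV by (intro sum_V) auto
  have pq: "?p = ?q + g b *\<^sub>R d b" using ab by simp
  have last: "\<bar>g b\<bar> * nrm (d b) \<le> nrm ?p / c"
  proof (cases "g b = 0")
    case True
    then show ?thesis using c nrm_nonneg[OF p] by simp
  next
    case False
    \<comment> \<open>Chosen so that \<open>g b\<close> times \<open>d b - ?s\<close> is the full
      sum \<open>?p\<close>.\<close>
    let ?s = "- (1 / g b) *\<^sub>R ?q"
    have "?s \<in> span (d ` {a..<b})"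
      by (intro span_scale span_sum) (auto intro: span_base)
    then have "c * nrm (d b) \<le> nrm (d b - ?s)"
      by (rule Suc.prems(2)[rotated]) (use ab in auto)
    then have "\<bar>g b\<bar> * (c * nrm (d b)) \<le> \<bar>g b\<bar> * nrm (d b - ?s)" by (rule mult_left_mono) simp
    also have "\<dots> = nrm (g b *\<^sub>R (d b - ?s))"
      by (rule nrm_scale[symmetric]) (intro diff_V scale_V q dV, use ab in auto)
    also have "g b *\<^sub>R (d b - ?s) = ?p" unfolding pq using False by (simp add: scaleR_add_right)
    finally show ?thesis using c by (simp add: field_simps)
  qed
  have np: "nrm ?p \<ge> 0" using nrm_nonneg[OF p] .
  show ?case
  proof (cases "n = b")
    case True
    then show ?thesis using last by simp
  next
    case False
    then have n: "n \<in> {a..<b}" using Suc.prems(3) by auto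
    have "?q = ?p - g b *\<^sub>R d b" using pq by simp
    then have "nrm ?q \<le> nrm ?p + nrm (g b *\<^sub>R d b)"
      using nrm_triangle_diff[OF p, of "g b *\<^sub>R d b"] dV[of b] ab by auto
    also have "nrm (g b *\<^sub>R d b) = \<bar>g b\<bar> * nrm (d b)" using dV[of b] ab by (simp add: nrm_scale)
    finally have nq: "nrm ?q \<le> (1 + 1 / c) * nrm ?p" using last by (simp add: algebra_simps)
    have "\<bar>g n\<bar> * nrm (d n) \<le> (1 + 1 / c) ^ (b - 1 - n) / c * nrm ?q"
      using Suc.prems(1,2) n by (intro Suc.IH) auto
    also have "\<dots> \<le> (1 + 1 / c) ^ (b - 1 - n) / c * ((1 + 1 / c) * nrm ?p)"
      using nq c by (intro mult_left_mono) auto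
    also have "\<dots> = (1 + 1 / c) ^ Suc (b - 1 - n) / c * nrm ?p" by simp
    also have "Suc (b - 1 - n) = Suc b - 1 - n" using n by auto
    finally show ?thesis .
  qed
qed

text \<open>Raising the exponent to \<open>m\<close> makes the constant independent of
  \<open>n\<close> and of the position of the window.\<close>

lemma coeff_bound_uniform:
  fixes d :: "nat \<Rightarrow> 'v" and g :: "nat \<Rightarrow> real"
  assumes c: "c > 0" and d: "\<And>n. n \<in> {a..<b} \<Longrightarrow> d n \<in> V"
    and sine: "\<And>n s. \<lbrakk>n \<in> {a..<b}; s \<in> span (d ` {a..<n})\<rbrakk> \<Longrightarrow> c * nrm (d n) \<le> nrm (d n - s)"
    and n: "n \<in> {a..<b}" and m: "b \<le> a + m"
  shows "\<bar>g n\<bar> * nrm (d n) \<le> (1 + 1 / c) ^ m / c * nrm (\<Sum>i\<in>{a..<b}. g i *\<^sub>R d i)"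
proof -
  have "(1 + 1 / c) ^ (b - 1 - n) \<le> (1 + 1 / c) ^ m"
    using c n m by (intro power_increasing) auto
  then have "(1 + 1 / c) ^ (b - 1 - n) / c * nrm (\<Sum>i\<in>{a..<b}. g i *\<^sub>R d i)
      \<le> (1 + 1 / c) ^ m / c * nrm (\<Sum>i\<in>{a..<b}. g i *\<^sub>R d i)"
    using c d by (intro mult_right_mono divide_right_mono nrm_nonneg sum_V) auto
  moreover have "\<bar>g n\<bar> * nrm (d n) \<le> (1 + 1 / c) ^ (b - 1 - n) / c * nrm (\<Sum>i\<in>{a..<b}. g i *\<^sub>R d i)"
    by (rule coeff_bound[OF c]) (use d sine n in auto)
  ultimately show ?thesis by linarith
qed

text \<open>Minimality along the line through \<open>p\<close> already gives orthogonality of the residual to \<open>p\<close>.\<close>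

lemma nrm_minimizer:
  assumes w: "w \<in> V" and p: "p \<in> V"
    and min: "\<And>s. nrm (w - p) \<le> nrm (w - s *\<^sub>R p)"
  shows "(nrm p)\<^sup>2 = (nrm w)\<^sup>2 - (nrm (w - p))\<^sup>2"
proof -
  define b c where "b = ip w p" and "c = ip p p"
  have eq: "(nrm (w - s *\<^sub>R p))\<^sup>2 = ip w w - 2 * s * b + s\<^sup>2 * c" for s
    using w p by (simp add: nrm_sq ip_diff_scale b_def c_def)
  have le: "ip w w - 2 * b + c \<le> ip w w - 2 * s * b + s\<^sup>2 * c" for s
  proof -
    have "(nrm (w - p))\<^sup>2 \<le> (nrm (w - s *\<^sub>R p))\<^sup>2"
      using min[of s] w p by (intro power_mono nrm_nonneg) auto
    then show ?thesis using eq[of 1] eq[of s] by simp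
  qed
  have c0: "c \<ge> 0" using ip_nonneg[OF p] by (simp add: c_def)
  have "b = c"
  proof (cases "c = 0")
    case True
    \<comment> \<open>Comparison with \<open>s = 0\<close> gives \<open>b \<ge> 0\<close>,
      comparison with \<open>s = 2\<close> gives \<open>b \<le> 0\<close>.\<close>
    with le[of 0] le[of 2] show ?thesis by simp
  next
    case False
    with c0 have c: "c > 0" by simp
    have "(b / c)\<^sup>2 * c = b * b / c" using c by (simp add: power2_eq_square field_simps)
    \<comment> \<open>The parabola is lowest at \<open>s = b / c\<close>; its value at
      \<open>s = 1\<close> exceeds this minimum by \<open>(b - c)\<^sup>2 / c\<close>, which must
      therefore vanish.\<close>
    then have "c - 2 * b + b * b / c \<le> 0" using le[of "b / c"] by simp
    then have "(b - c)\<^sup>2 \<le> 0" using c by (simp add: power2_eq_square field_simps)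
    then show ?thesis by simp
  qed
  then show ?thesis using eq[of 1] w p by (simp add: nrm_sq b_def c_def)
qed

end

text \<open>Abel summation: the coefficient of an increment is the partial sum of the
  \<open>a i\<close> from the start of the window. The same coefficients serve for every sequence
  \<open>x\<close>, so residuals and shifted iterates are corrected in parallel.\<close>

lemma aa_comb_increments:
  fixes x :: "nat \<Rightarrow> 'v::real_vector"
  assumes "k \<ge> 1"
  shows "aa_comb m k a x =
    x k - (\<Sum>n\<in>{k - depth m k..<k}. (\<Sum>i\<in>{k - depth m k..n}. a i) *\<^sub>R (x (Suc n) - x n))"
proof -
  let ?l = "k - depth m k"
  have eq: "{?l..k - 1} = {?l..<k}" using assms by auto
  \<comment> \<open>Passing from \<open>k\<close> to \<open>Suc k\<close> adds the increment
    \<open>x (Suc k) - x k\<close> to every difference, so it collects the sum of all coefficients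
    so far.\<close>
  have abel: "(\<Sum>j\<in>{l..<k}. a j *\<^sub>R (x k - x j)) =
      (\<Sum>n\<in>{l..<k}. (\<Sum>i\<in>{l..n}. a i) *\<^sub>R (x (Suc n) - x n))" if "l \<le> k" for l
    using that
  proof (induction k rule: dec_induct)
    case base then show ?case by simp
  next
    case (step k)
    have "(\<Sum>j\<in>{l..<Suc k}. a j *\<^sub>R (x (Suc k) - x j)) =
        (\<Sum>j\<in>{l..<k}. a j *\<^sub>R (x k - x j)) + (\<Sum>j\<in>{l..<Suc k}. a j *\<^sub>R (x (Suc k) - x k))"
      using step(1) by (simp add: sum.distrib[symmetric] scaleR_right_diff_distrib algebra_simps)
    also have "(\<Sum>j\<in>{l..<Suc k}. a j *\<^sub>R (x (Suc k) - x k)) = (\<Sum>i\<in>{l..k}. a i) *\<^sub>R (x (Suc k) - x k)"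
      by (simp add: scaleR_sum_left atLeastLessThanSuc_atLeastAtMost)
    finally show ?case using step by simp
  qed
  have "aa_comb m k a x = x k - (\<Sum>j\<in>{?l..<k}. a j *\<^sub>R (x k - x j))"
    unfolding aa_comb_def eq
    by (simp add: scaleR_right_diff_distrib sum_subtractf scaleR_left_diff_distrib scaleR_sum_left)
  then show ?thesis using abel[of ?l] by simp
qed

text \<open>The transporting field lives in \<open>U\<close> and the transported quantity in
  \<open>Z\<close>, so that one set of estimates serves the velocity, where the two spaces agree,
  and the temperature. Skew symmetry makes the energy bound independent of the transporting
  field.\<close>

locale convection_diffusion = semi_inner Z ip
  for Z :: "'z::real_vector set" and ip +
  fixes U :: "'u::real_vector set" and nU :: "'u \<Rightarrow> real"
    and c :: "'u \<Rightarrow> 'z \<Rightarrow> 'z \<Rightarrow> real" and \<mu> M :: real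
  assumes subspace_U: "subspace U"
    and nU_nonneg: "u \<in> U \<Longrightarrow> nU u \<ge> 0"
    and c_add1: "\<lbrakk>u \<in> U; u' \<in> U; z \<in> Z; z' \<in> Z\<rbrakk> \<Longrightarrow> c (u + u') z z' = c u z z' + c u' z z'"
    and c_scale1: "\<lbrakk>u \<in> U; z \<in> Z; z' \<in> Z\<rbrakk> \<Longrightarrow> c (r *\<^sub>R u) z z' = r * c u z z'"
    and c_add2: "\<lbrakk>u \<in> U; y \<in> Z; z \<in> Z; z' \<in> Z\<rbrakk> \<Longrightarrow> c u (y + z) z' = c u y z' + c u z z'"
    and c_scale2: "\<lbrakk>u \<in> U; z \<in> Z; z' \<in> Z\<rbrakk> \<Longrightarrow> c u (r *\<^sub>R z) z' = r * c u z z'"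
    and c_skew: "\<lbrakk>u \<in> U; z \<in> Z\<rbrakk> \<Longrightarrow> c u z z = 0"
    and c_bound: "\<lbrakk>u \<in> U; z \<in> Z; z' \<in> Z\<rbrakk> \<Longrightarrow> \<bar>c u z z'\<bar> \<le> M * nU u * nrm z * nrm z'"
    and \<mu>_pos: "\<mu> > 0" and M_nonneg: "M \<ge> 0"
begin

text \<open>The right-hand side \<open>l\<close> may be any map on \<open>Z\<close>; this lets the
  velocity source contain the temperature computed in the same step.\<close>

definition sol :: "'u \<Rightarrow> 'z \<Rightarrow> ('z \<Rightarrow> real) \<Rightarrow> bool"
  where "sol u z l \<longleftrightarrow> u \<in> U \<and> z \<in> Z \<and> (\<forall>\<phi>\<in>Z. c u z \<phi> + \<mu> * ip z \<phi> = l \<phi>)"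

lemma U_closed [intro, simp]:
  "u \<in> U \<Longrightarrow> u' \<in> U \<Longrightarrow> u + u' \<in> U" "u \<in> U \<Longrightarrow> r *\<^sub>R u \<in> U"
  "u \<in> U \<Longrightarrow> u' \<in> U \<Longrightarrow> u - u' \<in> U" "0 \<in> U"
  using subspace_U
  by (auto intro: subspace_add subspace_scale subspace_diff subspace_0)

lemma U_sum [intro]: "(\<And>i. i \<in> I \<Longrightarrow> f i \<in> U) \<Longrightarrow> (\<Sum>i\<in>I. f i) \<in> U"
  using subspace_U by (rule subspace_sum)

lemma c_diff1: "\<lbrakk>u \<in> U; u' \<in> U; z \<in> Z; z' \<in> Z\<rbrakk> \<Longrightarrow> c (u - u') z z' = c u z z' - c u' z z'"
  using c_add1[of "u - u'" u' z z'] by simp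

lemma c_diff2: "\<lbrakk>u \<in> U; y \<in> Z; z \<in> Z; z' \<in> Z\<rbrakk> \<Longrightarrow> c u (y - z) z' = c u y z' - c u z z'"
  using c_add2[of u "y - z" z z'] by simp

lemma c_sum1:
  assumes "finite I" "\<And>i. i \<in> I \<Longrightarrow> f i \<in> U" "z \<in> Z" "z' \<in> Z"
  shows "c (\<Sum>i\<in>I. f i) z z' = (\<Sum>i\<in>I. c (f i) z z')"
  using assms
proof (induction I rule: finite_induct)
  case empty then show ?case using c_scale1[of 0 z z' 0] by simp
next
  case (insert i I) then show ?case by (simp add: c_add1 U_sum)
qed

lemma c_sum2:
  assumes "finite I" "\<And>i. i \<in> I \<Longrightarrow> f i \<in> Z" "u \<in> U" "z' \<in> Z"
  shows "c u (\<Sum>i\<in>I. f i) z' = (\<Sum>i\<in>I. c u (f i) z')"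
  using assms
proof (induction I rule: finite_induct)
  case empty then show ?case using c_scale2[of u 0 z' 0] by simp
next
  case (insert i I) then show ?case by (simp add: c_add2 sum_V)
qed

lemma energy:
  assumes "R \<in> Z" "\<mu> * ip R R \<le> T * nrm R" "T \<ge> 0"
  shows "nrm R \<le> T / \<mu>"
proof (cases "nrm R = 0")
  case False
  then have "nrm R > 0" using nrm_nonneg[OF assms(1)] by simp
  moreover have "(\<mu> * nrm R) * nrm R \<le> T * nrm R"
    using assms(2) by (simp add: power2_eq_square flip: nrm_sq[OF assms(1)])
  ultimately have "\<mu> * nrm R \<le> T" by (rule mult_right_le_imp_le[rotated])
  then show ?thesis using \<mu>_pos by (simp add: field_simps)
qed (use assms \<mu>_pos in simp)

lemma sol_bound:
  assumes "sol u z l" and "\<bar>l z\<bar> \<le> \<rho> * nrm z" "\<rho> \<ge> 0"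
  shows "nrm z \<le> \<rho> / \<mu>"
proof (rule energy)
  show z: "z \<in> Z" using assms by (simp add: sol_def)
  show "\<mu> * ip z z \<le> \<rho> * nrm z"
    using assms c_skew[of u z] by (force simp: sol_def)
qed (use assms in simp)

text \<open>The reason is purely algebraic. All equations are combined with the coefficients that
  define \<open>R\<close> and tested with \<open>R\<close>; subtracting \<open>c p1 R R = 0\<close>
  leaves convection by differences of transporting fields. The relation between
  \<open>p1 - p0\<close> and \<open>s\<close> gathers the first-order ones into
  \<open>c s q0 R\<close>, and only products of two differences remain. This plays the part of a
  Taylor expansion with remainder.\<close>

lemma perturbation:
  assumes fin: "finite I" and p1: "sol p1 q1 l1" and p0: "sol p0 q0 l0"
    and b: "\<And>n. n \<in> I \<Longrightarrow> sol (b n) (b' n) (lb n)"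
    and a: "\<And>n. n \<in> I \<Longrightarrow> sol (a n) (a' n) (la n)"
    and s: "p1 - p0 = s - (\<Sum>n\<in>I. g n *\<^sub>R (b n - a n))"
    and R: "R = q1 - q0 + (\<Sum>n\<in>I. g n *\<^sub>R (b' n - a' n))"
    and l: "\<bar>l1 R - l0 R + (\<Sum>n\<in>I. g n * (lb n R - la n R))\<bar> \<le> \<rho> * nrm R" and \<rho>: "\<rho> \<ge> 0"
  shows "nrm R \<le> (M * nU s * nrm q0
      + (\<Sum>n\<in>I. \<bar>g n\<bar> * (M * nU (b n - a n) * nrm (q0 - a' n) + M * nU (p1 - b n) * nrm (b' n - a' n)))
      + \<rho>) / \<mu>"
proof -
  have U: "p1 \<in> U" "p0 \<in> U" "n \<in> I \<Longrightarrow> b n \<in> U" "n \<in> I \<Longrightarrow> a n \<in> U" for n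
    using p1 p0 a b by (auto simp: sol_def)
  have Z: "q1 \<in> Z" "q0 \<in> Z" "n \<in> I \<Longrightarrow> b' n \<in> Z" "n \<in> I \<Longrightarrow> a' n \<in> Z" for n
    using p1 p0 a b by (auto simp: sol_def)
  have "s = p1 - p0 + (\<Sum>n\<in>I. g n *\<^sub>R (b n - a n))" using s by simp
  then have sU: "s \<in> U" using U by (auto intro!: U_closed(1) U_sum)
  have RZ: "R \<in> Z" unfolding R using Z by (auto intro!: add_V sum_V)
  have eqs: "\<mu> * ip z R = l R - c u z R" if "sol u z l" for u z l
    using that RZ by (auto simp: sol_def algebra_simps)
  \<comment> \<open>Linearity in the first argument only: the second argument stays the test
    function \<open>R\<close>, so each diffusion term can be exchanged for a source and a convection
    term.\<close>
  have "\<mu> * ip R R = \<mu> * ip q1 R - \<mu> * ip q0 R + (\<Sum>n\<in>I. g n * (\<mu> * ip (b' n) R - \<mu> * ip (a' n) R))"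
  proof -
    have "ip R R = ip (q1 - q0 + (\<Sum>n\<in>I. g n *\<^sub>R (b' n - a' n))) R"
      by (rule arg_cong[OF R, of "\<lambda>x. ip x R"])
    also have "\<dots> = ip q1 R - ip q0 R + (\<Sum>n\<in>I. ip (g n *\<^sub>R (b' n - a' n)) R)"
      using Z RZ fin by (simp add: ip_add_left ip_diff_left ip_sum_left sum_V)
    also have "(\<Sum>n\<in>I. ip (g n *\<^sub>R (b' n - a' n)) R) = (\<Sum>n\<in>I. g n * (ip (b' n) R - ip (a' n) R))"
      using Z RZ by (intro sum.cong) (auto simp: ip_scale_left ip_diff_left)
    finally have e: "ip R R = ip q1 R - ip q0 R + (\<Sum>n\<in>I. g n * (ip (b' n) R - ip (a' n) R))" .
    show ?thesis unfolding e by (simp add: algebra_simps sum_distrib_left sum_subtractf)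
  qed
  also have "\<dots> = (l1 R - l0 R + (\<Sum>n\<in>I. g n * (lb n R - la n R))) - c p1 q1 R + c p0 q0 R
      - (\<Sum>n\<in>I. g n * (c (b n) (b' n) R - c (a n) (a' n) R))"
  proof -
    have "(\<Sum>n\<in>I. g n * (\<mu> * ip (b' n) R - \<mu> * ip (a' n) R))
        = (\<Sum>n\<in>I. g n * ((lb n R - c (b n) (b' n) R) - (la n R - c (a n) (a' n) R)))"
      by (intro sum.cong refl) (simp add: eqs[OF b] eqs[OF a])
    also have "\<dots> = (\<Sum>n\<in>I. g n * (lb n R - la n R)) - (\<Sum>n\<in>I. g n * (c (b n) (b' n) R - c (a n) (a' n) R))"
      by (simp add: sum_subtractf[symmetric] algebra_simps)
    finally show ?thesis by (simp add: eqs[OF p1] eqs[OF p0])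
  qed
  finally have 1: "\<mu> * ip R R = (l1 R - l0 R + (\<Sum>n\<in>I. g n * (lb n R - la n R))) - c p1 q1 R + c p0 q0 R
      - (\<Sum>n\<in>I. g n * (c (b n) (b' n) R - c (a n) (a' n) R))" .
  \<comment> \<open>Expanding this zero transports every increment by the new field
    \<open>p1\<close>.\<close>
  have "0 = c p1 R R" using c_skew U RZ by simp
  also have "\<dots> = c p1 (q1 - q0 + (\<Sum>n\<in>I. g n *\<^sub>R (b' n - a' n))) R"
    by (rule arg_cong[OF R, of "\<lambda>x. c p1 x R"])
  also have "\<dots> = c p1 q1 R - c p1 q0 R + (\<Sum>n\<in>I. c p1 (g n *\<^sub>R (b' n - a' n)) R)"
    using Z RZ U fin by (simp add: c_add2 c_diff2 c_sum2 sum_V)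
  also have "(\<Sum>n\<in>I. c p1 (g n *\<^sub>R (b' n - a' n)) R) = (\<Sum>n\<in>I. g n * (c p1 (b' n) R - c p1 (a' n) R))"
    using Z RZ U by (intro sum.cong) (auto simp: c_scale2 c_diff2)
  finally have 2: "0 = c p1 q1 R - c p1 q0 R + (\<Sum>n\<in>I. g n * (c p1 (b' n) R - c p1 (a' n) R))" .
  \<comment> \<open>The only place where the hypothesis on \<open>s\<close> enters.\<close>
  have "c p1 q0 R - c p0 q0 R = c (p1 - p0) q0 R" using U Z RZ by (simp add: c_diff1)
  also have "\<dots> = c s q0 R - (\<Sum>n\<in>I. c (g n *\<^sub>R (b n - a n)) q0 R)"
    unfolding s using U Z RZ fin sU by (simp add: c_diff1 c_sum1 U_sum)
  also have "(\<Sum>n\<in>I. c (g n *\<^sub>R (b n - a n)) q0 R) = (\<Sum>n\<in>I. g n * (c (b n) q0 R - c (a n) q0 R))"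
    using Z RZ U by (intro sum.cong) (auto simp: c_scale1 c_diff1)
  finally have 3: "c p1 q0 R - c p0 q0 R = c s q0 R - (\<Sum>n\<in>I. g n * (c (b n) q0 R - c (a n) q0 R))" .
  \<comment> \<open>The mixed term \<open>c (b n) (a' n) R\<close> occurs in both products with
    opposite signs and cancels.\<close>
  have 4: "(\<Sum>n\<in>I. g n * (c (b n - a n) (q0 - a' n) R + c (p1 - b n) (b' n - a' n) R))
    = (\<Sum>n\<in>I. g n * (c (b n) q0 R - c (a n) q0 R)) + (\<Sum>n\<in>I. g n * (c p1 (b' n) R - c p1 (a' n) R))
      - (\<Sum>n\<in>I. g n * (c (b n) (b' n) R - c (a n) (a' n) R))"
    unfolding sum.distrib[symmetric] sum_subtractf[symmetric]
    using Z RZ U by (intro sum.cong) (auto simp: c_diff1 c_diff2 algebra_simps)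
  have "\<mu> * ip R R = (l1 R - l0 R + (\<Sum>n\<in>I. g n * (lb n R - la n R))) - c s q0 R
      + (\<Sum>n\<in>I. g n * (c (b n - a n) (q0 - a' n) R + c (p1 - b n) (b' n - a' n) R))"
    using 1 2 3 4 by linarith
  also have "\<dots> \<le> \<rho> * nrm R + M * nU s * nrm q0 * nrm R
    + (\<Sum>n\<in>I. \<bar>g n\<bar> * (M * nU (b n - a n) * nrm (q0 - a' n) * nrm R
                         + M * nU (p1 - b n) * nrm (b' n - a' n) * nrm R))"
  proof (intro add_mono sum_mono)
    show "l1 R - l0 R + (\<Sum>n\<in>I. g n * (lb n R - la n R)) - c s q0 R \<le> \<rho> * nrm R + M * nU s * nrm q0 * nrm R"
      using l c_bound[OF sU Z(2) RZ] by linarith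
    fix n assume n: "n \<in> I"
    let ?x = "c (b n - a n) (q0 - a' n) R + c (p1 - b n) (b' n - a' n) R"
    have "g n * ?x \<le> \<bar>g n\<bar> * \<bar>?x\<bar>" by (simp flip: abs_mult)
    also have "\<dots> \<le> \<bar>g n\<bar> * (M * nU (b n - a n) * nrm (q0 - a' n) * nrm R
                         + M * nU (p1 - b n) * nrm (b' n - a' n) * nrm R)"
      using c_bound[of "b n - a n" "q0 - a' n" R] c_bound[of "p1 - b n" "b' n - a' n" R] U Z RZ n
      by (intro mult_left_mono) auto
    finally show "g n * ?x \<le> \<dots>" .
  qed
  also have "\<dots> = (M * nU s * nrm q0
      + (\<Sum>n\<in>I. \<bar>g n\<bar> * (M * nU (b n - a n) * nrm (q0 - a' n) + M * nU (p1 - b n) * nrm (b' n - a' n)))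
      + \<rho>) * nrm R"
    by (simp add: algebra_simps sum_distrib_left sum_distrib_right sum.distrib)
  finally show ?thesis
    using RZ U Z sU \<rho> M_nonneg
    by (intro energy) (auto intro!: add_nonneg_nonneg mult_nonneg_nonneg sum_nonneg nU_nonneg nrm_nonneg)
qed

text \<open>The case without correction terms, with \<open>s = p1 - p0\<close>.\<close>

lemma lipschitz:
  assumes p1: "sol p1 q1 l1" and p0: "sol p0 q0 l0"
    and l: "\<bar>l1 (q1 - q0) - l0 (q1 - q0)\<bar> \<le> \<rho> * nrm (q1 - q0)" and \<rho>: "\<rho> \<ge> 0"
  shows "nrm (q1 - q0) \<le> (M * nU (p1 - p0) * nrm q0 + \<rho>) / \<mu>"
  using perturbation[of "{}" p1 q1 l1 p0 q0 l0 undefined undefined undefined undefined undefined undefined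
      "p1 - p0" undefined "q1 - q0" \<rho>] assms by simp

end

section \<open>The space of square integrable functions\<close>

lemma continuous_measurable_lebesgue_on:
  fixes f :: "'a::euclidean_space \<Rightarrow> 'b::euclidean_space"
  shows "continuous_on UNIV f \<Longrightarrow> f \<in> borel_measurable (lebesgue_on \<Omega>)"
  by (intro measurable_restrict_space1 measurable_completion)
     (simp add: borel_measurable_continuous_onI)

lemma finite_measure_lebesgue_on:
  assumes "open \<Omega>" "bounded \<Omega>"
  shows "finite_measure (lebesgue_on \<Omega>)"
proof
  have "emeasure lebesgue \<Omega> < \<infinity>"
    using assms emeasure_bounded_finite[of \<Omega>] by (simp add: less_top)
  then show "emeasure (lebesgue_on \<Omega>) (space (lebesgue_on \<Omega>)) \<noteq> \<infinity>"
    using assms by (simp add: emeasure_restrict_space borel_open)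
qed

lemma inner_le_sq:
  fixes x y :: "'b::real_inner"
  shows "\<bar>x \<bullet> y\<bar> \<le> (norm x)\<^sup>2 + (norm y)\<^sup>2"
proof -
  have "\<bar>x \<bullet> y\<bar> \<le> norm x * norm y" by (rule Cauchy_Schwarz_ineq2)
  moreover have "0 \<le> (norm x - norm y)\<^sup>2" "0 \<le> (norm x + norm y)\<^sup>2" by simp_all
  ultimately show ?thesis by (simp add: power2_eq_square algebra_simps)
qed

lemma norm_add_sq_le:
  fixes x y :: "'b::real_inner"
  shows "(norm (x + y))\<^sup>2 \<le> 2 * (norm x)\<^sup>2 + 2 * (norm y)\<^sup>2"
proof -
  have "(norm (x + y))\<^sup>2 \<le> (norm x + norm y)\<^sup>2"
    by (intro power_mono norm_triangle_ineq) simp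
  moreover have "0 \<le> (norm x - norm y)\<^sup>2" by simp
  ultimately show ?thesis by (simp add: power2_eq_square algebra_simps)
qed

lemma L2_D [dest]:
  assumes "u \<in> L2 \<Omega>"
  shows "u \<in> borel_measurable (lebesgue_on \<Omega>)" "integrable (lebesgue_on \<Omega>) (\<lambda>x. (norm (u x))\<^sup>2)"
  using assms by (auto simp: L2_def)

lemma L2_bound:
  fixes u :: "'a::euclidean_space \<Rightarrow> 'b::euclidean_space" and v :: "'a \<Rightarrow> 'c::euclidean_space"
  assumes v: "v \<in> L2 \<Omega>" and m: "u \<in> borel_measurable (lebesgue_on \<Omega>)"
    and le: "\<And>x. norm (u x) \<le> norm (v x)"
  shows "u \<in> L2 \<Omega>"
  unfolding L2_def
proof (intro CollectI conjI m)
  show "integrable (lebesgue_on \<Omega>) (\<lambda>x. (norm (u x))\<^sup>2)"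
    by (rule Bochner_Integration.integrable_bound[OF L2_D(2)[OF v]])
       (use m le in \<open>auto intro!: power_mono\<close>)
qed

lemma integrable_inner_L2:
  fixes u v :: "'a::euclidean_space \<Rightarrow> 'b::euclidean_space"
  assumes u: "u \<in> L2 \<Omega>" and v: "v \<in> L2 \<Omega>"
  shows "integrable (lebesgue_on \<Omega>) (\<lambda>x. u x \<bullet> v x)"
proof (rule Bochner_Integration.integrable_bound)
  show "integrable (lebesgue_on \<Omega>) (\<lambda>x. (norm (u x))\<^sup>2 + (norm (v x))\<^sup>2)"
    using u v by (auto simp: L2_def)
  show "(\<lambda>x. u x \<bullet> v x) \<in> borel_measurable (lebesgue_on \<Omega>)"
    using u v by (auto simp: L2_def)
  show "AE x in lebesgue_on \<Omega>. norm (u x \<bullet> v x) \<le> norm ((norm (u x))\<^sup>2 + (norm (v x))\<^sup>2)"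
    using inner_le_sq by auto
qed

lemma L2_add:
  fixes u v :: "'a::euclidean_space \<Rightarrow> 'b::euclidean_space"
  assumes u: "u \<in> L2 \<Omega>" and v: "v \<in> L2 \<Omega>"
  shows "u + v \<in> L2 \<Omega>"
  unfolding L2_def
proof (intro CollectI conjI)
  show m: "u + v \<in> borel_measurable (lebesgue_on \<Omega>)"
    using u v by (auto simp: L2_def plus_fun_def)
  show "integrable (lebesgue_on \<Omega>) (\<lambda>x. (norm ((u + v) x))\<^sup>2)"
  proof (rule Bochner_Integration.integrable_bound)
    show "integrable (lebesgue_on \<Omega>) (\<lambda>x. 2 * (norm (u x))\<^sup>2 + 2 * (norm (v x))\<^sup>2)"
      using u v by (auto simp: L2_def)
    show "(\<lambda>x. (norm ((u + v) x))\<^sup>2) \<in> borel_measurable (lebesgue_on \<Omega>)"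
      using u v by (auto simp: L2_def)
    show "AE x in lebesgue_on \<Omega>. norm ((norm ((u + v) x))\<^sup>2) \<le> norm (2 * (norm (u x))\<^sup>2 + 2 * (norm (v x))\<^sup>2)"
      using norm_add_sq_le[of "u _" "v _"] by auto
  qed
qed

lemma L2_scale:
  fixes u :: "'a::euclidean_space \<Rightarrow> 'b::euclidean_space"
  shows "u \<in> L2 \<Omega> \<Longrightarrow> c *\<^sub>R u \<in> L2 \<Omega>"
  by (auto simp: L2_def scaleR_fun_def power_mult_distrib)

lemma subspace_L2: "subspace (L2 \<Omega> :: ('a::euclidean_space \<Rightarrow> 'b::euclidean_space) set)"
  by (auto intro!: subspaceI L2_add L2_scale) (auto simp: L2_def zero_fun_def)

interpretation L2: semi_inner "L2 \<Omega> :: ('a::euclidean_space \<Rightarrow> 'b::euclidean_space) set" "l2inner \<Omega>"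
proof
  fix x y z :: "'a \<Rightarrow> 'b" and c :: real
  show "l2inner \<Omega> (x + y) z = l2inner \<Omega> x z + l2inner \<Omega> y z"
    if "x \<in> L2 \<Omega>" "y \<in> L2 \<Omega>" "z \<in> L2 \<Omega>"
    using that by (simp add: l2inner_def inner_add_left integrable_inner_L2)
  show "l2inner \<Omega> (c *\<^sub>R x) y = c * l2inner \<Omega> x y"
    by (simp add: l2inner_def scaleR_fun_def)
  show "l2inner \<Omega> x y = l2inner \<Omega> y x" by (simp add: l2inner_def inner_commute)
  show "l2inner \<Omega> x x \<ge> 0" by (simp add: l2inner_def)
qed (rule subspace_L2)

lemma L2_nrm: "L2.nrm \<Omega> u = l2norm \<Omega> u"
  by (simp add: L2.nrm_def l2norm_def l2inner_def dot_square_norm)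

lemma l2norm_nonneg [simp]: "l2norm \<Omega> u \<ge> 0"
  by (simp add: l2norm_def)

lemma l2norm_sq: "(l2norm \<Omega> u)\<^sup>2 = (\<integral>x. (norm (u x))\<^sup>2 \<partial>lebesgue_on \<Omega>)"
  by (simp add: l2norm_def)

lemma l2norm_mono:
  fixes u :: "'a::euclidean_space \<Rightarrow> 'b::euclidean_space" and v :: "'a \<Rightarrow> 'c::euclidean_space"
  assumes v: "v \<in> L2 \<Omega>" and m: "u \<in> borel_measurable (lebesgue_on \<Omega>)"
    and le: "\<And>x. norm (u x) \<le> norm (v x)"
  shows "l2norm \<Omega> u \<le> l2norm \<Omega> v"
  unfolding l2norm_def
  using L2_bound[OF assms] v le by (intro real_sqrt_le_mono integral_mono) (auto simp: L2_def intro!: power_mono)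

lemma l2norm_eq_0:
  assumes "u \<in> L2 \<Omega>"
  shows "l2norm \<Omega> u = 0 \<longleftrightarrow> (AE x in lebesgue_on \<Omega>. u x = 0)"
proof -
  have "l2norm \<Omega> u = 0 \<longleftrightarrow> (\<integral>x. (norm (u x))\<^sup>2 \<partial>lebesgue_on \<Omega>) = 0"
    by (simp add: l2norm_def)
  also have "\<dots> \<longleftrightarrow> (AE x in lebesgue_on \<Omega>. (norm (u x))\<^sup>2 = 0)"
    using assms by (intro integral_nonneg_eq_0_iff_AE) auto
  finally show ?thesis by simp
qed

lemma continuous_in_L2:
  fixes u :: "'a::euclidean_space \<Rightarrow> 'b::euclidean_space"
  assumes "open \<Omega>" "bounded \<Omega>" "continuous_on UNIV u"
  shows "u \<in> L2 \<Omega>"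
proof -
  interpret finite_measure "lebesgue_on \<Omega>" using assms by (intro finite_measure_lebesgue_on)
  have "compact (closure \<Omega>)" using assms by (simp add: compact_closure)
  then have "bounded (u ` closure \<Omega>)"
    by (meson assms(3) compact_continuous_image compact_imp_bounded continuous_on_subset top_greatest)
  then obtain B where B: "\<And>x. x \<in> closure \<Omega> \<Longrightarrow> norm (u x) \<le> B" by (auto simp: bounded_iff)
  have m: "u \<in> borel_measurable (lebesgue_on \<Omega>)" by (rule continuous_measurable_lebesgue_on[OF assms(3)])
  have "integrable (lebesgue_on \<Omega>) (\<lambda>x. (norm (u x))\<^sup>2)"
  proof (rule integrable_const_bound)
    show "AE x in lebesgue_on \<Omega>. norm ((norm (u x))\<^sup>2) \<le> B\<^sup>2"
      using B closure_subset by (intro AE_I2) (auto simp: space_restrict_space intro!: power_mono)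
  qed (use m in simp)
  with m show ?thesis by (simp add: L2_def)
qed

lemma integrable_L2:
  fixes u :: "'a::euclidean_space \<Rightarrow> real"
  assumes "open \<Omega>" "bounded \<Omega>" "u \<in> L2 \<Omega>"
  shows "integrable (lebesgue_on \<Omega>) u"
  using integrable_inner_L2[OF assms(3) continuous_in_L2[OF assms(1,2), of "\<lambda>_. 1"]] by simp

lemma L2_component:
  fixes g :: "'a::euclidean_space \<Rightarrow> 'b::euclidean_space^'d"
  assumes "g \<in> L2 \<Omega>"
  shows "(\<lambda>x. g x $ i) \<in> L2 \<Omega>"
proof (rule L2_bound[OF assms])
  have "(\<lambda>y :: 'b^'d. y $ i) \<in> borel_measurable borel"
    by (intro borel_measurable_continuous_onI continuous_intros)
  then show "(\<lambda>x. g x $ i) \<in> borel_measurable (lebesgue_on \<Omega>)"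
    using assms by (auto intro: measurable_compose)
qed (rule Finite_Cartesian_Product.norm_nth_le)

lemma L2_inner_right:
  fixes u :: "'a::euclidean_space \<Rightarrow> 'b::euclidean_space"
  assumes "u \<in> L2 \<Omega>" "norm b \<le> 1"
  shows "(\<lambda>x. u x \<bullet> b) \<in> L2 \<Omega>"
proof (rule L2_bound[OF assms(1)])
  show "norm (u x \<bullet> b) \<le> norm (u x)" for x
    using Cauchy_Schwarz_ineq2[of "u x" b] mult_left_mono[OF assms(2), of "norm (u x)"] by simp
qed (use assms in auto)

section \<open>Integration by parts\<close>

text \<open>One direction at a time is all that integration by parts needs, and the derivative is
  carried as an explicit function \<open>D\<close>. Components of test functions and polynomials
  both fit this notion.\<close>

definition C1_along :: "'a::real_normed_vector \<Rightarrow> ('a \<Rightarrow> real) \<Rightarrow> ('a \<Rightarrow> real) \<Rightarrow> bool"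
  where "C1_along e f D \<longleftrightarrow> continuous_on UNIV f \<and> continuous_on UNIV D \<and>
    (\<forall>x. ((\<lambda>t. f (x + t *\<^sub>R e)) has_real_derivative D x) (at 0))"

lemma C1_along_deriv:
  assumes "C1_along e f D"
  shows "((\<lambda>t. f (x + t *\<^sub>R e)) has_real_derivative D (x + t *\<^sub>R e)) (at t)"
proof -
  have "((\<lambda>s. f (x + t *\<^sub>R e + s *\<^sub>R e)) has_real_derivative D (x + t *\<^sub>R e)) (at 0)"
    using assms by (simp add: C1_along_def)
  then have "((\<lambda>s. f (x + (s + t) *\<^sub>R e)) has_real_derivative D (x + t *\<^sub>R e)) (at 0)"
    by (simp add: algebra_simps)
  then show ?thesis using DERIV_shift[of "\<lambda>t. f (x + t *\<^sub>R e)" _ 0 t] by simp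
qed

lemma C1_along_mult:
  assumes f: "C1_along e f D" and g: "C1_along e g E"
  shows "C1_along e (\<lambda>x. f x * g x) (\<lambda>x. D x * g x + E x * f x)"
proof -
  have "((\<lambda>t. f (x + t *\<^sub>R e) * g (x + t *\<^sub>R e)) has_real_derivative D x * g x + E x * f x) (at 0)" for x
    using DERIV_mult[of "\<lambda>t. f (x + t *\<^sub>R e)" "D x" 0 UNIV "\<lambda>t. g (x + t *\<^sub>R e)" "E x"] f g
    by (simp add: C1_along_def)
  then show ?thesis using f g by (auto simp: C1_along_def intro!: continuous_intros)
qed

text \<open>Polynomials are the multipliers in the integration by parts below. The compact support
  comes from the test function, so they need no cutoff, and they are dense in the continuous
  functions on the closure of a bounded set.\<close>

lemma C1_along_polynomial:
  assumes "real_polynomial_function p"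
  shows "\<exists>D. C1_along e p D"
  using assms
proof induction
  case (linear f)
  have "((\<lambda>t. f (x + t *\<^sub>R e)) has_real_derivative f e) (at 0)" for x
  proof -
    have "(\<lambda>t. f (x + t *\<^sub>R e)) = (\<lambda>t. f x + t * f e)"
      using linear by (simp add: bounded_linear.linear linear_add linear_scale)
    then show ?thesis by (auto intro!: derivative_eq_intros)
  qed
  then show ?case using linear
    by (intro exI[of _ "\<lambda>_. f e"])
       (auto simp: C1_along_def intro!: continuous_intros linear_continuous_on)
next
  case (const c)
  show ?case by (intro exI[of _ "\<lambda>_. 0"]) (auto simp: C1_along_def)
next
  case (add f g)
  then obtain D E where f: "C1_along e f D" and g: "C1_along e g E" by blast
  have "((\<lambda>t. f (x + t *\<^sub>R e) + g (x + t *\<^sub>R e)) has_real_derivative D x + E x) (at 0)" for x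
    using f g by (auto simp: C1_along_def intro!: DERIV_add)
  then show ?case using f g
    by (intro exI[of _ "\<lambda>x. D x + E x"]) (auto simp: C1_along_def intro!: continuous_intros)
next
  case (mult f g)
  then show ?case using C1_along_mult by blast
qed

lemma C1_along_zero_outside:
  assumes f: "C1_along e f D" and K: "compact K" and z: "\<And>x. x \<notin> K \<Longrightarrow> f x = 0" and x: "x \<notin> K"
  shows "D x = 0"
proof -
  have "open (- K)" using K by (simp add: compact_imp_closed open_Compl)
  moreover have "((\<lambda>t::real. x + t *\<^sub>R e) \<longlongrightarrow> x + 0 *\<^sub>R e) (at 0)" by (intro tendsto_intros)
  ultimately have "\<forall>\<^sub>F t in at (0::real). x + t *\<^sub>R e \<in> - K"
    using x by (intro topological_tendstoD) auto
  then have ev: "\<forall>\<^sub>F t in at (0::real). f (x + t *\<^sub>R e) = 0"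
    by (rule eventually_mono) (use z in auto)
  have "((\<lambda>t. f (x + t *\<^sub>R e)) has_real_derivative D x) (at 0)" using f by (simp add: C1_along_def)
  moreover have "((\<lambda>t. f (x + t *\<^sub>R e)) has_real_derivative 0) (at 0) \<longleftrightarrow> ((\<lambda>t. 0) has_real_derivative (0::real)) (at (0::real))"
    using ev z[OF x] by (intro has_field_derivative_cong_eventually) auto
  ultimately show ?thesis by (simp add: DERIV_unique)
qed

lemma integrable_continuous_compact:
  fixes f :: "'a::euclidean_space \<Rightarrow> real"
  assumes "continuous_on UNIV f" "compact K" "\<And>x. x \<notin> K \<Longrightarrow> f x = 0"
  shows "integrable lborel f"
proof -
  have "integrable lborel (\<lambda>x. indicator K x *\<^sub>R f x)"
    using assms by (intro borel_integrable_compact) (auto intro: continuous_on_subset)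
  moreover have "(\<lambda>x. indicator K x *\<^sub>R f x) = f"
    using assms(3) by (auto simp: indicator_def fun_eq_iff)
  ultimately show ?thesis by simp
qed

lemma integral_lborel_translate:
  fixes f :: "'a::euclidean_space \<Rightarrow> real"
  assumes "f \<in> borel_measurable borel"
  shows "(\<integral>x. f (x + a) \<partial>lborel) = (\<integral>x. f x \<partial>lborel)"
proof -
  have "(\<integral>x. f x \<partial>lborel) = (\<integral>x. f x \<partial>distr lborel borel ((+) a))"
    by (simp add: lborel_distr_plus)
  also have "\<dots> = (\<integral>x. f (a + x) \<partial>lborel)" using assms by (intro integral_distr) auto
  finally show ?thesis by (simp add: add.commute)
qed

text \<open>Translation invariance of the integral annihilates the difference quotients, which converge
  dominatedly.\<close>

lemma integral_C1_along_zero: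
  fixes f :: "'a::euclidean_space \<Rightarrow> real"
  assumes f: "C1_along e f D" and K: "compact K" and z: "\<And>x. x \<notin> K \<Longrightarrow> f x = 0"
  shows "(\<integral>x. D x \<partial>lborel) = 0"
proof -
  have cf: "continuous_on UNIV f" and cD: "continuous_on UNIV D" using f by (auto simp: C1_along_def)
  have zD: "\<And>x. x \<notin> K \<Longrightarrow> D x = 0" using C1_along_zero_outside[OF f K z] .
  have "bounded (D ` K)"
    using cD K by (meson compact_continuous_image compact_imp_bounded continuous_on_subset top_greatest)
  then obtain B where B: "\<And>x. x \<in> K \<Longrightarrow> \<bar>D x\<bar> \<le> B" and B0: "B > 0"
    by (auto simp: bounded_pos)
  then have B: "\<bar>D x\<bar> \<le> B" for x by (cases "x \<in> K") (auto simp: zD)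
  define h where "h = (\<lambda>n. 1 / real (Suc n))"
  have h0: "h n > 0" "h n \<le> 1" for n by (auto simp: h_def field_simps)
  have hlim: "filterlim h (at 0) sequentially"
  proof -
    have "h \<longlonglongrightarrow> 0" unfolding h_def using LIMSEQ_inverse_real_of_nat by (simp add: inverse_eq_divide)
    then show ?thesis using h0(1) by (auto simp: filterlim_at intro!: always_eventually) (metis less_irrefl)
  qed
  define q where "q = (\<lambda>n x. (f (x + h n *\<^sub>R e) - f x) / h n)"
  have qlim: "(\<lambda>n. q n x) \<longlonglongrightarrow> D x" for x
  proof -
    have "((\<lambda>t. f (x + t *\<^sub>R e)) has_real_derivative D x) (at 0)" using f by (simp add: C1_along_def)
    then have "((\<lambda>t. (f (x + t *\<^sub>R e) - f x) / t) \<longlongrightarrow> D x) (at 0)" by (simp add: DERIV_def)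
    then show ?thesis unfolding q_def by (rule filterlim_compose[OF _ hlim])
  qed
  \<comment> \<open>By the mean value theorem each quotient is a value of \<open>D\<close>, so one
    bound serves all \<open>n\<close>.\<close>
  have qB: "\<bar>q n x\<bar> \<le> B" for n x
  proof -
    obtain t where "f (x + h n *\<^sub>R e) - f (x + 0 *\<^sub>R e) = (h n - 0) * D (x + t *\<^sub>R e)"
      using MVT2[of 0 "h n" "\<lambda>t. f (x + t *\<^sub>R e)" "\<lambda>t. D (x + t *\<^sub>R e)"] h0(1)[of n] C1_along_deriv[OF f, of x]
      by blast
    then show ?thesis using B[of "x + t *\<^sub>R e"] h0(1)[of n] by (simp add: q_def)
  qed
  \<comment> \<open>The set swept out by \<open>K\<close> under translation by
    \<open>- t *\<^sub>R e\<close> for \<open>t\<close> up to 1. As \<open>h n \<le> 1\<close>, it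
    contains the supports of all the difference quotients and is still compact.\<close>
  define K' where "K' = (\<lambda>(x, t). x - t *\<^sub>R e) ` (K \<times> {0..1})"
  have K': "compact K'"
    unfolding K'_def case_prod_unfold
    by (intro compact_continuous_image compact_Times K continuous_intros) auto
  have q0: "q n x = 0" if "x \<notin> K'" for n x
  proof -
    have "x \<notin> K"
    proof
      assume "x \<in> K"
      then have "(x, 0) \<in> K \<times> {0..1::real}" by simp
      then have "(\<lambda>(x, t). x - t *\<^sub>R e) (x, 0) \<in> K'" unfolding K'_def by (rule imageI)
      then show False using that by simp
    qed
    moreover have "x + h n *\<^sub>R e \<notin> K"
    proof
      assume "x + h n *\<^sub>R e \<in> K"
      then have "(x + h n *\<^sub>R e, h n) \<in> K \<times> {0..1::real}" using h0[of n] by simp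
      then have "(\<lambda>(x, t). x - t *\<^sub>R e) (x + h n *\<^sub>R e, h n) \<in> K'" unfolding K'_def by (rule imageI)
      then show False using that by simp
    qed
    ultimately show ?thesis by (simp add: q_def z)
  qed
  have fm [measurable]: "f \<in> borel_measurable borel" by (rule borel_measurable_continuous_onI[OF cf])
  have Dm [measurable]: "D \<in> borel_measurable borel" by (rule borel_measurable_continuous_onI[OF cD])
  have fi: "integrable lborel f" by (rule integrable_continuous_compact[OF cf K z])
  have fi': "integrable lborel (\<lambda>x. f (x + h n *\<^sub>R e))" for n
  proof (rule integrable_continuous_compact[OF _ K'])
    show "continuous_on UNIV (\<lambda>x. f (x + h n *\<^sub>R e))"
      by (rule continuous_on_compose2[OF cf]) (auto intro!: continuous_intros)
    show "f (x + h n *\<^sub>R e) = 0" if "x \<notin> K'" for x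
    proof (rule z, rule notI)
      assume "x + h n *\<^sub>R e \<in> K"
      then have "(x + h n *\<^sub>R e, h n) \<in> K \<times> {0..1::real}" using h0[of n] by simp
      then have "(\<lambda>(x, t). x - t *\<^sub>R e) (x + h n *\<^sub>R e, h n) \<in> K'" unfolding K'_def by (rule imageI)
      then show False using that by simp
    qed
  qed
  have qi: "(\<integral>x. q n x \<partial>lborel) = 0" for n
    unfolding q_def using fi fi'[of n] integral_lborel_translate[OF fm, of "h n *\<^sub>R e"]
    by (simp add: Bochner_Integration.integral_diff)
  have "(\<lambda>n. \<integral>x. q n x \<partial>lborel) \<longlonglongrightarrow> (\<integral>x. D x \<partial>lborel)"
  proof (rule integral_dominated_convergence[where w = "\<lambda>x. B * indicator K' x"])
    have "emeasure lborel K' < \<infinity>" using K' emeasure_compact_finite by blast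
    then show "integrable lborel (\<lambda>x. B * indicator K' x)"
      using compact_imp_closed[OF K'] by (intro integrable_mult_right integrable_real_indicator) auto
    show "AE x in lborel. norm (q n x) \<le> B * indicator K' x" for n
      using qB[of n] q0[of _ n] B0 by (intro AE_I2) (auto simp: indicator_def)
    show "(\<lambda>x. q n x) \<in> borel_measurable lborel" for n unfolding q_def by measurable
  qed (use qlim in auto)
  then show ?thesis by (simp add: qi LIMSEQ_const_iff)
qed

text \<open>The derivative of the product \<open>f * g\<close> has integral zero. The product
  inherits its compact support from \<open>f\<close>, so \<open>g\<close> may be a
  polynomial.\<close>

lemma integral_by_parts_along:
  fixes f g :: "'a::euclidean_space \<Rightarrow> real"
  assumes f: "C1_along e f D" and g: "C1_along e g E"
    and K: "compact K" and z: "\<And>x. x \<notin> K \<Longrightarrow> f x = 0"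
  shows "(\<integral>x. D x * g x \<partial>lborel) = - (\<integral>x. f x * E x \<partial>lborel)"
proof -
  have c: "continuous_on UNIV f" "continuous_on UNIV D" "continuous_on UNIV g" "continuous_on UNIV E"
    using f g by (auto simp: C1_along_def)
  have "(\<integral>x. D x * g x + E x * f x \<partial>lborel) = 0"
    using C1_along_mult[OF f g] K by (rule integral_C1_along_zero) (simp add: z)
  moreover have "integrable lborel (\<lambda>x. D x * g x)"
    by (rule integrable_continuous_compact[OF _ K]) (auto intro!: continuous_intros c simp: C1_along_zero_outside[OF f K z])
  moreover have "integrable lborel (\<lambda>x. E x * f x)"
    by (rule integrable_continuous_compact[OF _ K]) (auto intro!: continuous_intros c simp: z)
  ultimately show ?thesis by (simp add: mult.commute)
qed

lemma integral_lebesgue_on_lborel: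
  fixes f :: "'a::euclidean_space \<Rightarrow> real"
  assumes "open \<Omega>" "f \<in> borel_measurable borel" "\<And>x. x \<notin> \<Omega> \<Longrightarrow> f x = 0"
  shows "(\<integral>x. f x \<partial>lebesgue_on \<Omega>) = (\<integral>x. f x \<partial>lborel)"
proof -
  have "(\<integral>x. f x \<partial>lebesgue_on \<Omega>) = (\<integral>x. indicator \<Omega> x *\<^sub>R f x \<partial>lebesgue)"
    using assms by (intro integral_restrict_space) auto
  also have "(\<lambda>x. indicator \<Omega> x *\<^sub>R f x) = f" using assms(3) by (auto simp: indicator_def fun_eq_iff)
  also have "(\<integral>x. f x \<partial>lebesgue) = (\<integral>x. f x \<partial>lborel)"
    using assms by (intro integral_completion) auto
  finally show ?thesis .
qed

text \<open>The sign of \<open>G\<close> is an almost everywhere limit of continuous functions; in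
  the limit, orthogonality says that the integral of the absolute value of \<open>G\<close> is
  zero.\<close>

lemma AE_zero_if_orthogonal_continuous:
  fixes G :: "'a::euclidean_space \<Rightarrow> real"
  assumes \<Omega>: "open \<Omega>" and G: "integrable (lebesgue_on \<Omega>) G"
    and orth: "\<And>p. continuous_on UNIV p \<Longrightarrow> (\<integral>x. G x * p x \<partial>lebesgue_on \<Omega>) = 0"
  shows "AE x in lebesgue_on \<Omega>. G x = 0"
proof -
  have \<Omega>m: "\<Omega> \<in> sets lebesgue" using \<Omega> by auto
  have Gm [measurable]: "G \<in> borel_measurable (lebesgue_on \<Omega>)" using G by auto
  have sm [measurable]: "(\<lambda>x. sgn (G x)) \<in> borel_measurable (lebesgue_on \<Omega>)" by measurable
  have "(\<lambda>x. sgn (G x)) measurable_on \<Omega>" using sm \<Omega>m by (simp add: measurable_on_iff_borel_measurable)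
  then obtain N p where N: "negligible N" and p: "\<And>n. continuous_on UNIV (p n)"
    and lim: "\<And>x. x \<notin> N \<Longrightarrow> (\<lambda>n. p n x) \<longlonglongrightarrow> (if x \<in> \<Omega> then sgn (G x) else 0)"
    unfolding measurable_on_def by blast
  \<comment> \<open>Truncation to the interval from -1 to 1 keeps the limit, since signs lie there,
    and makes the absolute value of \<open>G\<close> a dominating function.\<close>
  define r where "r = (\<lambda>n x. max (-1) (min 1 (p n x)) :: real)"
  have r: "continuous_on UNIV (r n)" for n unfolding r_def by (intro continuous_intros p)
  have "AE x in lebesgue. x \<notin> N" using N by (intro AE_not_in) (simp add: negligible_iff_null_sets)
  then have aeN: "AE x in lebesgue_on \<Omega>. x \<notin> N"
    using \<Omega>m by (subst AE_restrict_space_iff) auto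
  have "(\<lambda>n. \<integral>x. G x * r n x \<partial>lebesgue_on \<Omega>) \<longlonglongrightarrow> (\<integral>x. \<bar>G x\<bar> \<partial>lebesgue_on \<Omega>)"
  proof (rule integral_dominated_convergence[where w = "\<lambda>x. \<bar>G x\<bar>"])
    show "AE x in lebesgue_on \<Omega>. (\<lambda>n. G x * r n x) \<longlonglongrightarrow> \<bar>G x\<bar>"
    proof (use aeN AE_space[of "lebesgue_on \<Omega>"] in eventually_elim)
      case (elim x)
      then have "(\<lambda>n. p n x) \<longlonglongrightarrow> sgn (G x)" using lim[of x] by (simp add: space_restrict_space)
      then have "(\<lambda>n. G x * r n x) \<longlonglongrightarrow> G x * max (-1) (min 1 (sgn (G x)))"
        unfolding r_def by (intro tendsto_intros)
      moreover have "G x * max (-1) (min 1 (sgn (G x))) = \<bar>G x\<bar>" by (simp add: sgn_if)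
      ultimately show ?case by (simp only:)
    qed
    show "AE x in lebesgue_on \<Omega>. norm (G x * r n x) \<le> \<bar>G x\<bar>" for n
      by (intro AE_I2) (auto simp: r_def abs_mult intro!: mult_left_le)
    show "(\<lambda>x. G x * r n x) \<in> borel_measurable (lebesgue_on \<Omega>)" for n
      using continuous_measurable_lebesgue_on[OF r] by measurable
  qed (use G in auto)
  then have "(\<integral>x. \<bar>G x\<bar> \<partial>lebesgue_on \<Omega>) = 0"
    by (simp add: orth[OF r] LIMSEQ_const_iff)
  then show ?thesis using G by (subst (asm) integral_nonneg_eq_0_iff_AE) auto
qed

text \<open>On the compact closure of the domain a continuous function is within \<open>e\<close> of
  a polynomial, and replacing one by the other changes the integral by at most \<open>e\<close>
  times the integral of the absolute value of \<open>G\<close>.\<close>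

lemma AE_zero_if_orthogonal_polynomials:
  fixes G :: "'a::euclidean_space \<Rightarrow> real"
  assumes \<Omega>: "open \<Omega>" "bounded \<Omega>" and G: "integrable (lebesgue_on \<Omega>) G"
    and orth: "\<And>p. real_polynomial_function p \<Longrightarrow> (\<integral>x. G x * p x \<partial>lebesgue_on \<Omega>) = 0"
  shows "AE x in lebesgue_on \<Omega>. G x = 0"
proof (rule AE_zero_if_orthogonal_continuous[OF \<Omega>(1) G])
  fix p :: "'a \<Rightarrow> real" assume p: "continuous_on UNIV p"
  have bnd: "integrable (lebesgue_on \<Omega>) (\<lambda>x. G x * p x)" if "continuous_on UNIV p" for p :: "'a \<Rightarrow> real"
  proof -
    have "compact (p ` closure \<Omega>)"
      using \<Omega> that by (meson compact_closure compact_continuous_image continuous_on_subset top_greatest)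
    then obtain B where B: "\<And>x. x \<in> closure \<Omega> \<Longrightarrow> \<bar>p x\<bar> \<le> B"
      using compact_imp_bounded by (force simp: bounded_iff)
    show ?thesis
    proof (rule Bochner_Integration.integrable_bound)
      show "integrable (lebesgue_on \<Omega>) (\<lambda>x. B * G x)" using G by simp
      show "(\<lambda>x. G x * p x) \<in> borel_measurable (lebesgue_on \<Omega>)"
        using continuous_measurable_lebesgue_on[OF that, of \<Omega>] G by auto
      show "AE x in lebesgue_on \<Omega>. norm (G x * p x) \<le> norm (B * G x)"
      proof (rule AE_I2)
        fix x assume "x \<in> space (lebesgue_on \<Omega>)"
        then have "\<bar>p x\<bar> \<le> \<bar>B\<bar>" using B[of x] closure_subset[of \<Omega>] by (force simp: space_restrict_space)
        then show "norm (G x * p x) \<le> norm (B * G x)"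
          using mult_left_mono[of "\<bar>p x\<bar>" "\<bar>B\<bar>" "\<bar>G x\<bar>"] by (simp add: abs_mult mult.commute)
      qed
    qed
  qed
  define c where "c = (\<integral>x. \<bar>G x\<bar> \<partial>lebesgue_on \<Omega>)"
  have "\<bar>\<integral>x. G x * p x \<partial>lebesgue_on \<Omega>\<bar> \<le> e * c" if e: "e > 0" for e
  proof -
    obtain g where g: "real_polynomial_function g" and le: "\<And>x. x \<in> closure \<Omega> \<Longrightarrow> \<bar>p x - g x\<bar> < e"
      using Stone_Weierstrass_real_polynomial_function[of "closure \<Omega>" p e] \<Omega> p e
      by (auto simp: compact_closure intro: continuous_on_subset)
    have gc: "continuous_on UNIV g" using g by (simp add: real_polynomial_function_eq continuous_on_polymonial_function)
    have "(\<integral>x. G x * p x \<partial>lebesgue_on \<Omega>) = (\<integral>x. G x * p x \<partial>lebesgue_on \<Omega>) - (\<integral>x. G x * g x \<partial>lebesgue_on \<Omega>)"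
      using orth[OF g] by simp
    also have "\<dots> = (\<integral>x. G x * p x - G x * g x \<partial>lebesgue_on \<Omega>)"
      using bnd[OF p] bnd[OF gc] by simp
    also have "\<bar>\<dots>\<bar> \<le> (\<integral>x. e * \<bar>G x\<bar> \<partial>lebesgue_on \<Omega>)"
    proof (rule integral_abs_bound_integral)
      show "\<bar>G x * p x - G x * g x\<bar> \<le> e * \<bar>G x\<bar>" if "x \<in> space (lebesgue_on \<Omega>)" for x
      proof -
        have "\<bar>p x - g x\<bar> \<le> e" using le[of x] that closure_subset[of \<Omega>] by (force simp: space_restrict_space)
        then have "\<bar>G x\<bar> * \<bar>p x - g x\<bar> \<le> \<bar>G x\<bar> * e" by (intro mult_left_mono) auto
        then show ?thesis by (simp add: right_diff_distrib[symmetric] abs_mult mult.commute)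
      qed
    qed (use bnd[OF p] bnd[OF gc] G in auto)
    finally show ?thesis by (simp add: c_def)
  qed
  note small = this
  have c0: "c \<ge> 0" by (simp add: c_def)
  show "(\<integral>x. G x * p x \<partial>lebesgue_on \<Omega>) = 0"
  proof (rule ccontr)
    assume ne: "(\<integral>x. G x * p x \<partial>lebesgue_on \<Omega>) \<noteq> 0"
    let ?I = "\<bar>\<integral>x. G x * p x \<partial>lebesgue_on \<Omega>\<bar>"
    \<comment> \<open>The tolerance is chosen to give back at most half of \<open>?I\<close>;
      \<open>c + 1\<close> replaces \<open>c\<close> because \<open>c\<close> may be zero.\<close>
    have "?I \<le> ?I / (2 * (c + 1)) * c" using ne c0 by (intro small) auto
    also have "\<dots> \<le> ?I / 2" using c0 by (simp add: field_simps)
    finally show False using ne by simp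
  qed
qed

section \<open>Uniqueness of the weak gradient\<close>

lemma frechet_derivative_add:
  assumes "f differentiable at x" "g differentiable at x"
  shows "frechet_derivative (\<lambda>x. f x + g x) (at x) = (\<lambda>h. frechet_derivative f (at x) h + frechet_derivative g (at x) h)"
  by (rule frechet_derivative_at[symmetric], intro has_derivative_add)
     (use assms in \<open>simp_all add: frechet_derivative_works\<close>)

lemma frechet_derivative_scaleR:
  assumes "f differentiable at x"
  shows "frechet_derivative (\<lambda>x. c *\<^sub>R f x) (at x) = (\<lambda>h. c *\<^sub>R frechet_derivative f (at x) h)"
  by (rule frechet_derivative_at[symmetric], intro has_derivative_scaleR_right)
     (use assms in \<open>simp_all add: frechet_derivative_works\<close>)

lemma Ck_on_add: "Ck_on n f UNIV \<Longrightarrow> Ck_on n g UNIV \<Longrightarrow> Ck_on n (\<lambda>x. f x + g x) UNIV"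
proof (induction n arbitrary: f g)
  case 0 then show ?case by (auto intro: continuous_intros)
next
  case (Suc n)
  then have "f differentiable at x" "g differentiable at x" for x by (auto simp: differentiable_on_def)
  then show ?case using Suc by (auto simp: frechet_derivative_add differentiable_on_def)
qed

lemma Ck_on_scaleR: "Ck_on n f UNIV \<Longrightarrow> Ck_on n (\<lambda>x. c *\<^sub>R f x) UNIV"
proof (induction n arbitrary: f)
  case 0 then show ?case by (auto intro: continuous_intros)
next
  case (Suc n)
  then have "f differentiable at x" for x by (auto simp: differentiable_on_def)
  then show ?case using Suc by (auto simp: frechet_derivative_scaleR differentiable_on_def)
qed

lemma test_fun_add:
  assumes "test_fun \<Omega> \<phi>" "test_fun \<Omega> \<psi>"
  shows "test_fun \<Omega> (\<phi> + \<psi>)"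
proof -
  obtain K L where K: "compact K" "K \<subseteq> \<Omega>" "\<forall>x. x \<notin> K \<longrightarrow> \<phi> x = 0"
    and L: "compact L" "L \<subseteq> \<Omega>" "\<forall>x. x \<notin> L \<longrightarrow> \<psi> x = 0"
    using assms by (auto simp: test_fun_def)
  have "smooth_on (\<phi> + \<psi>) UNIV"
    using assms by (auto simp: test_fun_def smooth_on_def plus_fun_def intro: Ck_on_add)
  moreover have "compact (K \<union> L) \<and> K \<union> L \<subseteq> \<Omega> \<and> (\<forall>x. x \<notin> K \<union> L \<longrightarrow> (\<phi> + \<psi>) x = 0)"
    using K L by auto
  ultimately show ?thesis unfolding test_fun_def by blast
qed

lemma test_fun_scale: "test_fun \<Omega> \<phi> \<Longrightarrow> test_fun \<Omega> (c *\<^sub>R \<phi>)"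
  by (auto simp: test_fun_def smooth_on_def scaleR_fun_def intro: Ck_on_scaleR)

lemma test_fun_differentiable: "test_fun \<Omega> \<phi> \<Longrightarrow> \<phi> differentiable at x"
  unfolding test_fun_def smooth_on_def by (auto simp: differentiable_on_def dest!: spec[of _ "Suc 0"])

lemma test_fun_continuous: "test_fun \<Omega> \<phi> \<Longrightarrow> continuous_on UNIV \<phi>"
  unfolding test_fun_def smooth_on_def by (auto dest!: spec[of _ 0])

lemma classical_grad_add:
  assumes "test_fun \<Omega> \<phi>" "test_fun \<Omega> \<psi>"
  shows "classical_grad (\<phi> + \<psi>) = classical_grad \<phi> + classical_grad \<psi>"
  using frechet_derivative_add[OF test_fun_differentiable[OF assms(1)] test_fun_differentiable[OF assms(2)]]
  by (simp add: fun_eq_iff classical_grad_def vec_eq_iff plus_fun_def)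

lemma classical_grad_scale:
  assumes "test_fun \<Omega> \<phi>"
  shows "classical_grad (c *\<^sub>R \<phi>) = c *\<^sub>R classical_grad \<phi>"
  using frechet_derivative_scaleR[OF test_fun_differentiable[OF assms]]
  by (simp add: fun_eq_iff classical_grad_def vec_eq_iff scaleR_fun_def)

lemma classical_grad_continuous:
  assumes "test_fun \<Omega> \<phi>"
  shows "continuous_on UNIV (classical_grad \<phi>)"
proof -
  have "Ck_on (Suc 0) \<phi> UNIV" using assms by (simp add: test_fun_def smooth_on_def)
  then have "continuous_on UNIV (\<lambda>x. frechet_derivative \<phi> (at x) (axis i 1))" for i
    by (auto simp: axis_in_Basis_iff)
  then show ?thesis unfolding classical_grad_def by (intro continuous_on_vec_lambda)
qed

lemma test_fun_C1_along:
  assumes \<phi>: "test_fun \<Omega> \<phi>"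
  shows "C1_along (axis i 1) (\<lambda>x. \<phi> x \<bullet> b) (\<lambda>x. classical_grad \<phi> x $ i \<bullet> b)"
  unfolding C1_along_def
proof (intro conjI allI)
  show "continuous_on UNIV (\<lambda>x. \<phi> x \<bullet> b)" by (intro continuous_intros test_fun_continuous[OF \<phi>])
  show "continuous_on UNIV (\<lambda>x. classical_grad \<phi> x $ i \<bullet> b)"
    by (intro continuous_intros classical_grad_continuous[OF \<phi>])
  fix x
  let ?F = "frechet_derivative \<phi> (at x)"
  have F: "(\<phi> has_derivative ?F) (at x)"
    using test_fun_differentiable[OF \<phi>] by (simp add: frechet_derivative_works)
  have "((\<lambda>t. x + t *\<^sub>R axis i 1) has_derivative (\<lambda>t. t *\<^sub>R axis i 1)) (at (0::real))"
    by (auto intro!: derivative_eq_intros)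
  then have "((\<lambda>t. \<phi> (x + t *\<^sub>R axis i 1)) has_derivative (\<lambda>t. ?F (t *\<^sub>R axis i 1))) (at (0::real))"
    by (rule has_derivative_compose) (simp add: F)
  then have "((\<lambda>t. \<phi> (x + t *\<^sub>R axis i 1) \<bullet> b) has_derivative (\<lambda>t. ?F (t *\<^sub>R axis i 1) \<bullet> b)) (at (0::real))"
    by (rule has_derivative_inner_left)
  moreover have "(\<lambda>t. ?F (t *\<^sub>R axis i 1) \<bullet> b) = (*) (classical_grad \<phi> x $ i \<bullet> b)"
    using has_derivative_linear[OF F] by (simp add: fun_eq_iff linear_scale classical_grad_def)
  ultimately show "((\<lambda>t. \<phi> (x + t *\<^sub>R axis i 1) \<bullet> b) has_real_derivative classical_grad \<phi> x $ i \<bullet> b) (at 0)"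
    by (simp add: has_field_derivative_def)
qed

locale domain =
  fixes \<Omega> :: "(real^'d) set"
  assumes open_dom: "open \<Omega>" and bounded_dom: "bounded \<Omega>"
begin

lemma test_fun_L2: "test_fun \<Omega> \<phi> \<Longrightarrow> \<phi> \<in> L2 \<Omega>"
  by (intro continuous_in_L2 open_dom bounded_dom test_fun_continuous)

lemma classical_grad_L2: "test_fun \<Omega> \<phi> \<Longrightarrow> classical_grad \<phi> \<in> L2 \<Omega>"
  by (intro continuous_in_L2 open_dom bounded_dom classical_grad_continuous)

lemma test_fun_by_parts:
  assumes \<phi>: "test_fun \<Omega> \<phi>" and p: "C1_along (axis i 1) p q"
  shows "(\<integral>x. (classical_grad \<phi> x $ i \<bullet> b) * p x \<partial>lebesgue_on \<Omega>) = - (\<integral>x. (\<phi> x \<bullet> b) * q x \<partial>lebesgue_on \<Omega>)"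
proof -
  obtain K where K: "compact K" "K \<subseteq> \<Omega>" "\<And>x. x \<notin> K \<Longrightarrow> \<phi> x = 0"
    using \<phi> by (auto simp: test_fun_def)
  note C = test_fun_C1_along[OF \<phi>, of i b]
  have zero: "\<And>x. x \<notin> K \<Longrightarrow> classical_grad \<phi> x $ i \<bullet> b = 0"
    by (rule C1_along_zero_outside[OF C K(1)]) (simp_all add: K(3))
  have zero': "\<And>x. x \<notin> K \<Longrightarrow> \<phi> x \<bullet> b = 0" by (simp add: K(3))
  have c: "continuous_on UNIV (\<lambda>x. \<phi> x \<bullet> b)" "continuous_on UNIV (\<lambda>x. classical_grad \<phi> x $ i \<bullet> b)"
      "continuous_on UNIV p" "continuous_on UNIV q"
    using C p by (auto simp: C1_along_def)
  have "(\<integral>x. (classical_grad \<phi> x $ i \<bullet> b) * p x \<partial>lebesgue_on \<Omega>) = (\<integral>x. (classical_grad \<phi> x $ i \<bullet> b) * p x \<partial>lborel)"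
    by (rule integral_lebesgue_on_lborel[OF open_dom])
       (use K(2) zero in \<open>auto intro!: borel_measurable_continuous_onI continuous_intros c\<close>)
  also have "\<dots> = - (\<integral>x. (\<phi> x \<bullet> b) * q x \<partial>lborel)"
    by (rule integral_by_parts_along[OF C p K(1)]) (simp add: K(3))
  also have "(\<integral>x. (\<phi> x \<bullet> b) * q x \<partial>lborel) = (\<integral>x. (\<phi> x \<bullet> b) * q x \<partial>lebesgue_on \<Omega>)"
    by (rule integral_lebesgue_on_lborel[OF open_dom, symmetric])
       (use K(2) zero' in \<open>auto intro!: borel_measurable_continuous_onI continuous_intros c\<close>)
  finally show ?thesis .
qed

text \<open>Each scalar component of \<open>g\<close> is tested against a polynomial. Integration by
  parts moves the derivative to the polynomial, where \<open>\<phi> n\<close> tends to zero, while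
  the derivatives of \<open>\<phi> n\<close> tend to \<open>g\<close>; so the component is
  orthogonal to all polynomials.\<close>

lemma gradient_closable:
  fixes \<phi> :: "nat \<Rightarrow> real^'d \<Rightarrow> 'b::euclidean_space"
  assumes \<phi>: "\<And>n. test_fun \<Omega> (\<phi> n)" and g: "g \<in> L2 \<Omega>"
    and \<phi>0: "(\<lambda>n. l2norm \<Omega> (\<phi> n)) \<longlonglongrightarrow> 0"
    and \<phi>g: "(\<lambda>n. l2norm \<Omega> (classical_grad (\<phi> n) - g)) \<longlonglongrightarrow> 0"
  shows "AE x in lebesgue_on \<Omega>. g x = 0"
proof -
  have comp: "AE x in lebesgue_on \<Omega>. g x $ i \<bullet> b = 0" if b: "b \<in> Basis" for i b
  proof -
    have nb: "norm b \<le> 1" using b by simp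
    define G where "G = (\<lambda>x. g x $ i \<bullet> b)"
    define f where "f = (\<lambda>n x. \<phi> n x \<bullet> b)"
    define D where "D = (\<lambda>n x. classical_grad (\<phi> n) x $ i \<bullet> b)"
    have G: "G \<in> L2 \<Omega>" unfolding G_def by (intro L2_inner_right L2_component g nb)
    have f: "f n \<in> L2 \<Omega>" for n unfolding f_def by (intro L2_inner_right test_fun_L2 \<phi> nb)
    have D: "D n \<in> L2 \<Omega>" for n unfolding D_def by (intro L2_inner_right L2_component classical_grad_L2 \<phi> nb)
    have fle: "l2norm \<Omega> (f n) \<le> l2norm \<Omega> (\<phi> n)" for n
      using L2_D(1)[OF f[of n]] Cauchy_Schwarz_ineq2[of "\<phi> n _" b] b
      by (intro l2norm_mono test_fun_L2 \<phi>) (auto simp: f_def)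
    have Dle: "l2norm \<Omega> (D n - G) \<le> l2norm \<Omega> (classical_grad (\<phi> n) - g)" for n
    proof (rule l2norm_mono)
      show "classical_grad (\<phi> n) - g \<in> L2 \<Omega>" by (intro L2.diff_V classical_grad_L2 \<phi> g)
      show "D n - G \<in> borel_measurable (lebesgue_on \<Omega>)" by (intro L2_D L2.diff_V D G)
      fix x
      have "norm ((D n - G) x) = \<bar>(classical_grad (\<phi> n) x - g x) $ i \<bullet> b\<bar>"
        by (simp add: D_def G_def inner_diff_left)
      also have "\<dots> \<le> norm ((classical_grad (\<phi> n) x - g x) $ i)"
        using Cauchy_Schwarz_ineq2[of "(classical_grad (\<phi> n) x - g x) $ i" b] b by simp
      also have "\<dots> \<le> norm ((classical_grad (\<phi> n) - g) x)"
        using Finite_Cartesian_Product.norm_nth_le[of "classical_grad (\<phi> n) x - g x" i] by simp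
      finally show "norm ((D n - G) x) \<le> norm ((classical_grad (\<phi> n) - g) x)" .
    qed
    have "AE x in lebesgue_on \<Omega>. G x = 0"
    proof (rule AE_zero_if_orthogonal_polynomials[OF open_dom bounded_dom integrable_L2[OF open_dom bounded_dom G]])
      fix p :: "real^'d \<Rightarrow> real" assume "real_polynomial_function p"
      then obtain q where pq: "C1_along (axis i 1) p q" using C1_along_polynomial by blast
      have p: "p \<in> L2 \<Omega>" and q: "q \<in> L2 \<Omega>"
        using pq by (auto simp: C1_along_def intro!: continuous_in_L2 open_dom bounded_dom)
      have "\<bar>l2inner \<Omega> G p\<bar> \<le> l2norm \<Omega> (\<phi> n) * l2norm \<Omega> q + l2norm \<Omega> (classical_grad (\<phi> n) - g) * l2norm \<Omega> p" for n
      proof -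
        have "l2inner \<Omega> (D n) p = - l2inner \<Omega> (f n) q"
          using test_fun_by_parts[OF \<phi>[of n] pq, of b] by (simp add: l2inner_def D_def f_def)
        then have "l2inner \<Omega> G p = - l2inner \<Omega> (f n) q - l2inner \<Omega> (D n - G) p"
          using D G p by (simp add: L2.ip_diff_left)
        moreover have "\<bar>l2inner \<Omega> (f n) q\<bar> \<le> l2norm \<Omega> (f n) * l2norm \<Omega> q"
          using L2.cauchy_schwarz[OF f q] by (simp add: L2_nrm)
        moreover have "\<bar>l2inner \<Omega> (D n - G) p\<bar> \<le> l2norm \<Omega> (D n - G) * l2norm \<Omega> p"
          using L2.cauchy_schwarz[OF L2.diff_V[OF D G] p] by (simp add: L2_nrm)
        moreover have "l2norm \<Omega> (f n) * l2norm \<Omega> q \<le> l2norm \<Omega> (\<phi> n) * l2norm \<Omega> q"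
          by (intro mult_right_mono fle) simp
        moreover have "l2norm \<Omega> (D n - G) * l2norm \<Omega> p \<le> l2norm \<Omega> (classical_grad (\<phi> n) - g) * l2norm \<Omega> p"
          by (intro mult_right_mono Dle) simp
        ultimately show ?thesis by linarith
      qed
      moreover have "(\<lambda>n. l2norm \<Omega> (\<phi> n) * l2norm \<Omega> q + l2norm \<Omega> (classical_grad (\<phi> n) - g) * l2norm \<Omega> p)
          \<longlonglongrightarrow> 0 * l2norm \<Omega> q + 0 * l2norm \<Omega> p"
        by (intro tendsto_intros \<phi>0 \<phi>g)
      ultimately have "\<bar>l2inner \<Omega> G p\<bar> \<le> 0"
        by (intro LIMSEQ_le_const[where X = "\<lambda>n. l2norm \<Omega> (\<phi> n) * l2norm \<Omega> q + l2norm \<Omega> (classical_grad (\<phi> n) - g) * l2norm \<Omega> p"]) auto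
      then show "(\<integral>x. G x * p x \<partial>lebesgue_on \<Omega>) = 0" by (simp add: l2inner_def)
    qed
    then show ?thesis by (simp add: G_def)
  qed
  have "AE x in lebesgue_on \<Omega>. \<forall>i\<in>UNIV. \<forall>b\<in>Basis. g x $ i \<bullet> b = 0"
    by (intro AE_finite_allI comp) auto
  then show ?thesis
    by eventually_elim (simp add: vec_eq_iff euclidean_all_zero_iff)
qed

lemma has_grad0_L2:
  assumes "has_grad0 \<Omega> u g"
  shows "u \<in> L2 \<Omega>" "g \<in> L2 \<Omega>"
  using assms by (auto simp: has_grad0_def)

lemma has_grad0_add:
  assumes "has_grad0 \<Omega> u g" "has_grad0 \<Omega> v h"
  shows "has_grad0 \<Omega> (u + v) (g + h)"
proof -
  note L = has_grad0_L2[OF assms(1)] has_grad0_L2[OF assms(2)]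
  obtain \<phi> \<psi> where \<phi>: "\<And>n::nat. test_fun \<Omega> (\<phi> n)" "(\<lambda>n. l2norm \<Omega> (\<phi> n - u)) \<longlonglongrightarrow> 0"
      "(\<lambda>n. l2norm \<Omega> (classical_grad (\<phi> n) - g)) \<longlonglongrightarrow> 0"
    and \<psi>: "\<And>n::nat. test_fun \<Omega> (\<psi> n)" "(\<lambda>n. l2norm \<Omega> (\<psi> n - v)) \<longlonglongrightarrow> 0"
      "(\<lambda>n. l2norm \<Omega> (classical_grad (\<psi> n) - h)) \<longlonglongrightarrow> 0"
    using assms unfolding has_grad0_def by blast
  have tri: "l2norm \<Omega> (a + b - (c + d)) \<le> l2norm \<Omega> (a - c) + l2norm \<Omega> (b - d)"
    if "a \<in> L2 \<Omega>" "b \<in> L2 \<Omega>" "c \<in> L2 \<Omega>" "d \<in> L2 \<Omega>" for a b c d :: "real^'d \<Rightarrow> 'x::euclidean_space"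
    using L2.nrm_triangle[of "a - c" \<Omega> "b - d"] that by (simp add: L2_nrm algebra_simps)
  show ?thesis unfolding has_grad0_def
  proof (intro conjI exI[of _ "\<lambda>n. \<phi> n + \<psi> n"] allI)
    show "(\<lambda>n. l2norm \<Omega> (\<phi> n + \<psi> n - (u + v))) \<longlonglongrightarrow> 0"
      by (rule Lim_null_comparison[OF _ tendsto_add_zero[OF \<phi>(2) \<psi>(2)]])
         (auto intro!: always_eventually tri L test_fun_L2 \<phi>(1) \<psi>(1))
    show "(\<lambda>n. l2norm \<Omega> (classical_grad (\<phi> n + \<psi> n) - (g + h))) \<longlonglongrightarrow> 0"
      by (rule Lim_null_comparison[OF _ tendsto_add_zero[OF \<phi>(3) \<psi>(3)]])
         (auto simp: classical_grad_add[OF \<phi>(1) \<psi>(1)]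
           intro!: always_eventually tri L classical_grad_L2 \<phi>(1) \<psi>(1))
  qed (auto intro: L2_add L test_fun_add \<phi> \<psi>)
qed

lemma has_grad0_scale:
  assumes "has_grad0 \<Omega> u g"
  shows "has_grad0 \<Omega> (c *\<^sub>R u) (c *\<^sub>R g)"
proof -
  note L = has_grad0_L2[OF assms(1)]
  obtain \<phi> where \<phi>: "\<And>n::nat. test_fun \<Omega> (\<phi> n)" "(\<lambda>n. l2norm \<Omega> (\<phi> n - u)) \<longlonglongrightarrow> 0"
      "(\<lambda>n. l2norm \<Omega> (classical_grad (\<phi> n) - g)) \<longlonglongrightarrow> 0"
    using assms unfolding has_grad0_def by blast
  have sc: "l2norm \<Omega> (c *\<^sub>R a - c *\<^sub>R b) = \<bar>c\<bar> * l2norm \<Omega> (a - b)"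
    if "a \<in> L2 \<Omega>" "b \<in> L2 \<Omega>" for a b :: "real^'d \<Rightarrow> 'x::euclidean_space"
    using L2.nrm_scale[of "a - b" \<Omega> c] that by (simp add: L2_nrm scaleR_diff_right)
  show ?thesis unfolding has_grad0_def
  proof (intro conjI exI[of _ "\<lambda>n. c *\<^sub>R \<phi> n"] allI)
    show "(\<lambda>n. l2norm \<Omega> (c *\<^sub>R \<phi> n - c *\<^sub>R u)) \<longlonglongrightarrow> 0"
      using tendsto_mult_right_zero[OF \<phi>(2), of "\<bar>c\<bar>"] by (simp add: sc L test_fun_L2[OF \<phi>(1)])
    show "(\<lambda>n. l2norm \<Omega> (classical_grad (c *\<^sub>R \<phi> n) - c *\<^sub>R g)) \<longlonglongrightarrow> 0"
      using tendsto_mult_right_zero[OF \<phi>(3), of "\<bar>c\<bar>"]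
      by (simp add: classical_grad_scale[OF \<phi>(1)] sc L classical_grad_L2[OF \<phi>(1)])
  qed (auto intro: L2_scale L test_fun_scale \<phi>)
qed

text \<open>The difference of two candidates is a limit gradient of the zero function. This is what
  makes the choice in \<open>grad\<close> harmless and the weak gradient linear almost
  everywhere.\<close>

lemma has_grad0_unique:
  assumes "has_grad0 \<Omega> u g" "has_grad0 \<Omega> u h"
  shows "AE x in lebesgue_on \<Omega>. g x = h x"
proof -
  have "has_grad0 \<Omega> (u + -1 *\<^sub>R u) (g + -1 *\<^sub>R h)"
    by (intro has_grad0_add has_grad0_scale assms)
  then have "has_grad0 \<Omega> 0 (g - h)" by simp
  then obtain \<phi> where \<phi>: "\<And>n::nat. test_fun \<Omega> (\<phi> n)" "(\<lambda>n. l2norm \<Omega> (\<phi> n - 0)) \<longlonglongrightarrow> 0"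
      "(\<lambda>n. l2norm \<Omega> (classical_grad (\<phi> n) - (g - h))) \<longlonglongrightarrow> 0" and L: "g - h \<in> L2 \<Omega>"
    unfolding has_grad0_def by blast
  have "AE x in lebesgue_on \<Omega>. (g - h) x = 0"
    by (rule gradient_closable[OF \<phi>(1) L _ \<phi>(3)]) (use \<phi>(2) in simp)
  then show ?thesis by eventually_elim simp
qed

lemma has_grad0_grad: "u \<in> H10 \<Omega> \<Longrightarrow> has_grad0 \<Omega> u (grad \<Omega> u)"
  using someI_ex[of "has_grad0 \<Omega> u"] by (simp add: H10_def grad_def)

lemma grad_AE_eq: "has_grad0 \<Omega> u g \<Longrightarrow> AE x in lebesgue_on \<Omega>. grad \<Omega> u x = g x"
  by (rule has_grad0_unique[OF has_grad0_grad]) (auto simp: H10_def)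

lemma grad_L2: "u \<in> H10 \<Omega> \<Longrightarrow> grad \<Omega> u \<in> L2 \<Omega>" and H10_L2: "u \<in> H10 \<Omega> \<Longrightarrow> u \<in> L2 \<Omega>"
  using has_grad0_grad has_grad0_L2 by blast+

lemma grad_add:
  "\<lbrakk>u \<in> H10 \<Omega>; v \<in> H10 \<Omega>\<rbrakk> \<Longrightarrow> AE x in lebesgue_on \<Omega>. grad \<Omega> (u + v) x = grad \<Omega> u x + grad \<Omega> v x"
  using grad_AE_eq[OF has_grad0_add[OF has_grad0_grad has_grad0_grad]] by simp

lemma grad_scale:
  "u \<in> H10 \<Omega> \<Longrightarrow> AE x in lebesgue_on \<Omega>. grad \<Omega> (c *\<^sub>R u) x = c *\<^sub>R grad \<Omega> u x"
  using grad_AE_eq[OF has_grad0_scale[OF has_grad0_grad]] by (simp add: scaleR_fun_def)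

lemma subspace_H10: "subspace (H10 \<Omega> :: (real^'d \<Rightarrow> 'b::euclidean_space) set)"
proof (rule subspaceI)
  have "test_fun \<Omega> (0 :: real^'d \<Rightarrow> 'b)"
    unfolding test_fun_def smooth_on_def
  proof (intro conjI allI exI[of _ "{}"])
    have "Ck_on n (\<lambda>_::real^'d. 0 :: 'b) UNIV" for n by (induction n) auto
    then show "Ck_on n (0 :: real^'d \<Rightarrow> 'b) UNIV" for n by (simp add: zero_fun_def)
  qed auto
  note t = this
  have "classical_grad (0 :: real^'d \<Rightarrow> 'b) = 0"
    using classical_grad_scale[OF t, of 0] by simp
  then have "has_grad0 \<Omega> (0 :: real^'d \<Rightarrow> 'b) 0"
    unfolding has_grad0_def using t L2.zero_V
    by (intro conjI exI[of _ "\<lambda>_. 0"]) (auto simp: l2norm_def)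
  then show "(0 :: real^'d \<Rightarrow> 'b) \<in> H10 \<Omega>" by (auto simp: H10_def)
qed (auto simp: H10_def intro: has_grad0_add has_grad0_scale)

end

section \<open>Ladyzhenskaya inequalities\<close>

context
  fixes e1 e2 :: "'a::euclidean_space"
begin

text \<open>With values in \<open>ennreal\<close> the order of integration can be exchanged before
  anything is known to be finite. The point \<open>p\<close> shifts the plane, which is how the
  slices of space are described.\<close>

definition plane_integral :: "('a \<Rightarrow> ennreal) \<Rightarrow> 'a \<Rightarrow> ennreal"
  where "plane_integral F p = (\<integral>\<^sup>+y. \<integral>\<^sup>+x. F (x *\<^sub>R e1 + (y *\<^sub>R e2 + p)) \<partial>lborel \<partial>lborel)"

lemma plane_integral_pair:
  assumes [measurable]: "F \<in> borel_measurable borel"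
  shows "plane_integral F p = (\<integral>\<^sup>+w. F (fst w *\<^sub>R e1 + (snd w *\<^sub>R e2 + p)) \<partial>(lborel \<Otimes>\<^sub>M lborel))"
  unfolding plane_integral_def by (subst lborel_pair.nn_integral_snd[symmetric]) auto

lemma plane_integral_measurable [measurable]:
  assumes [measurable]: "F \<in> borel_measurable borel"
  shows "plane_integral F \<in> borel_measurable borel"
  unfolding plane_integral_def by measurable

lemma plane_cauchy_schwarz:
  assumes [measurable]: "F \<in> borel_measurable borel" "G \<in> borel_measurable borel"
  shows "(plane_integral (\<lambda>x. F x * G x) p)\<^sup>2 \<le> plane_integral (\<lambda>x. (F x)\<^sup>2) p * plane_integral (\<lambda>x. (G x)\<^sup>2) p"
  by (subst (1 2 3) plane_integral_pair) (auto intro!: Cauchy_Schwarz_nn_integral)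

text \<open>The fourth power is split into two squares, one bounded along the direction
  \<open>e1\<close>, the other along \<open>e2\<close>. The first bound no longer depends on
  \<open>x\<close>, the second no longer on \<open>y\<close>, so the double integral of their
  product factorises. \<open>A\<close> and \<open>B\<close> stand for the absolute values of the two
  partial derivatives.\<close>

lemma plane_ladyzhenskaya:
  fixes U A B :: "'a \<Rightarrow> ennreal"
  assumes [measurable]: "U \<in> borel_measurable borel" "A \<in> borel_measurable borel" "B \<in> borel_measurable borel"
    and h1: "\<And>s q. (U (s *\<^sub>R e1 + q))\<^sup>2 \<le> (\<integral>\<^sup>+t. 2 * U (t *\<^sub>R e1 + q) * A (t *\<^sub>R e1 + q) \<partial>lborel)"
    and h2: "\<And>s q. (U (s *\<^sub>R e2 + q))\<^sup>2 \<le> (\<integral>\<^sup>+t. 2 * U (t *\<^sub>R e2 + q) * B (t *\<^sub>R e2 + q) \<partial>lborel)"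
  shows "plane_integral (\<lambda>x. (U x)^4) p
    \<le> plane_integral (\<lambda>x. 2 * U x * A x) p * plane_integral (\<lambda>x. 2 * U x * B x) p"
proof -
  define P where "P = (\<lambda>y. \<integral>\<^sup>+t. 2 * U (t *\<^sub>R e1 + (y *\<^sub>R e2 + p)) * A (t *\<^sub>R e1 + (y *\<^sub>R e2 + p)) \<partial>lborel)"
  define Q where "Q = (\<lambda>x. \<integral>\<^sup>+t. 2 * U (t *\<^sub>R e2 + (x *\<^sub>R e1 + p)) * B (t *\<^sub>R e2 + (x *\<^sub>R e1 + p)) \<partial>lborel)"
  have [measurable]: "P \<in> borel_measurable borel" "Q \<in> borel_measurable borel"
    unfolding P_def Q_def by measurable
  have le: "(U (x *\<^sub>R e1 + (y *\<^sub>R e2 + p)))^4 \<le> P y * Q x" for x y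
  proof -
    have "(U (x *\<^sub>R e1 + (y *\<^sub>R e2 + p)))^4 = (U (x *\<^sub>R e1 + (y *\<^sub>R e2 + p)))\<^sup>2 * (U (y *\<^sub>R e2 + (x *\<^sub>R e1 + p)))\<^sup>2"
      by (simp add: add.left_commute flip: power_add)
    also have "\<dots> \<le> P y * Q x" unfolding P_def Q_def by (intro mult_mono h1 h2) auto
    finally show ?thesis .
  qed
  have "plane_integral (\<lambda>x. (U x)^4) p \<le> (\<integral>\<^sup>+y. \<integral>\<^sup>+x. P y * Q x \<partial>lborel \<partial>lborel)"
    unfolding plane_integral_def by (intro nn_integral_mono le)
  also have "\<dots> = (\<integral>\<^sup>+y. P y \<partial>lborel) * (\<integral>\<^sup>+x. Q x \<partial>lborel)"
    by (simp add: nn_integral_cmult nn_integral_multc)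
  also have "(\<integral>\<^sup>+y. P y \<partial>lborel) = plane_integral (\<lambda>x. 2 * U x * A x) p"
    by (simp add: P_def plane_integral_def)
  also have "(\<integral>\<^sup>+x. Q x \<partial>lborel) = plane_integral (\<lambda>x. 2 * U x * B x) p"
  proof -
    have "(\<integral>\<^sup>+x. Q x \<partial>lborel) = (\<integral>\<^sup>+x. \<integral>\<^sup>+t. 2 * U (x *\<^sub>R e1 + (t *\<^sub>R e2 + p)) * B (x *\<^sub>R e1 + (t *\<^sub>R e2 + p)) \<partial>lborel \<partial>lborel)"
      unfolding Q_def by (simp add: add.left_commute)
    also have "\<dots> = plane_integral (\<lambda>x. 2 * U x * B x) p"
      unfolding plane_integral_def by (rule lborel_pair.Fubini') measurable
    finally show ?thesis .
  qed
  finally show ?thesis .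
qed

text \<open>The plane inequality is applied on every slice orthogonal to the third coordinate,
  followed by Cauchy-Schwarz within the slice. Of the two resulting factors, the integral of
  \<open>U\<close> squared is bounded uniformly over the slices and can be taken out; the other is
  integrated.\<close>

lemma space_ladyzhenskaya:
  fixes U A B C :: "'a \<Rightarrow> ennreal" and e3 :: 'a
  assumes [measurable]: "U \<in> borel_measurable borel" "A \<in> borel_measurable borel" "B \<in> borel_measurable borel"
      "C \<in> borel_measurable borel"
    and h1: "\<And>s q. (U (s *\<^sub>R e1 + q))\<^sup>2 \<le> (\<integral>\<^sup>+t. 2 * U (t *\<^sub>R e1 + q) * A (t *\<^sub>R e1 + q) \<partial>lborel)"
    and h2: "\<And>s q. (U (s *\<^sub>R e2 + q))\<^sup>2 \<le> (\<integral>\<^sup>+t. 2 * U (t *\<^sub>R e2 + q) * B (t *\<^sub>R e2 + q) \<partial>lborel)"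
    and h3: "\<And>s q. (U (s *\<^sub>R e3 + q))\<^sup>2 \<le> (\<integral>\<^sup>+t. 2 * U (t *\<^sub>R e3 + q) * C (t *\<^sub>R e3 + q) \<partial>lborel)"
  defines "I \<equiv> \<lambda>F. \<integral>\<^sup>+z. plane_integral F (z *\<^sub>R e3) \<partial>lborel"
  shows "I (\<lambda>x. (U x)^4) \<le> 4 * (I (\<lambda>x. (U x)\<^sup>2) + I (\<lambda>x. (C x)\<^sup>2)) * (I (\<lambda>x. (A x)\<^sup>2) + I (\<lambda>x. (B x)\<^sup>2))"
proof -
  let ?J = "\<lambda>F z. plane_integral F (z *\<^sub>R e3)"
  have cs: "(?J (\<lambda>x. 2 * U x * G x) z)\<^sup>2 \<le> 4 * ?J (\<lambda>x. (U x)\<^sup>2) z * ?J (\<lambda>x. (G x)\<^sup>2) z"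
    if [measurable]: "G \<in> borel_measurable borel" for G z
  proof -
    have "?J (\<lambda>x. 2 * U x * G x) z = 2 * ?J (\<lambda>x. U x * G x) z"
      unfolding plane_integral_def by (simp add: nn_integral_cmult mult.assoc)
    then have "(?J (\<lambda>x. 2 * U x * G x) z)\<^sup>2 = 4 * (?J (\<lambda>x. U x * G x) z)\<^sup>2"
      by (simp add: power_mult_distrib)
    also have "\<dots> \<le> 4 * (?J (\<lambda>x. (U x)\<^sup>2) z * ?J (\<lambda>x. (G x)\<^sup>2) z)"
      by (intro mult_left_mono plane_cauchy_schwarz) auto
    finally show ?thesis by (simp add: mult.assoc)
  qed
  \<comment> \<open>Integration along \<open>e3\<close> bounds each value of \<open>U\<close>
    squared by a line integral that has forgotten the height \<open>z\<close> of the slice.\<close>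
  have E: "?J (\<lambda>x. (U x)\<^sup>2) z \<le> I (\<lambda>x. (U x)\<^sup>2) + I (\<lambda>x. (C x)\<^sup>2)" for z
  proof -
    have "?J (\<lambda>x. (U x)\<^sup>2) z = (\<integral>\<^sup>+y. \<integral>\<^sup>+x. (U (z *\<^sub>R e3 + (x *\<^sub>R e1 + y *\<^sub>R e2)))\<^sup>2 \<partial>lborel \<partial>lborel)"
      unfolding plane_integral_def by (simp add: ac_simps)
    also have "\<dots> \<le> (\<integral>\<^sup>+y. \<integral>\<^sup>+x. \<integral>\<^sup>+t. (U (t *\<^sub>R e3 + (x *\<^sub>R e1 + y *\<^sub>R e2)))\<^sup>2
        + (C (t *\<^sub>R e3 + (x *\<^sub>R e1 + y *\<^sub>R e2)))\<^sup>2 \<partial>lborel \<partial>lborel \<partial>lborel)"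
      by (intro nn_integral_mono order_trans[OF h3] sum_of_squares_ge_ennreal)
    also have "\<dots> = (\<integral>\<^sup>+y. \<integral>\<^sup>+t. \<integral>\<^sup>+x. (U (t *\<^sub>R e3 + (x *\<^sub>R e1 + y *\<^sub>R e2)))\<^sup>2
        + (C (t *\<^sub>R e3 + (x *\<^sub>R e1 + y *\<^sub>R e2)))\<^sup>2 \<partial>lborel \<partial>lborel \<partial>lborel)"
      by (intro nn_integral_cong lborel_pair.Fubini') measurable
    also have "\<dots> = (\<integral>\<^sup>+t. \<integral>\<^sup>+y. \<integral>\<^sup>+x. (U (t *\<^sub>R e3 + (x *\<^sub>R e1 + y *\<^sub>R e2)))\<^sup>2
        + (C (t *\<^sub>R e3 + (x *\<^sub>R e1 + y *\<^sub>R e2)))\<^sup>2 \<partial>lborel \<partial>lborel \<partial>lborel)"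
      by (rule lborel_pair.Fubini') measurable
    also have "\<dots> = (\<integral>\<^sup>+t. ?J (\<lambda>x. (U x)\<^sup>2) t + ?J (\<lambda>x. (C x)\<^sup>2) t \<partial>lborel)"
      unfolding plane_integral_def by (simp add: nn_integral_add ac_simps)
    also have "\<dots> = I (\<lambda>x. (U x)\<^sup>2) + I (\<lambda>x. (C x)\<^sup>2)"
      unfolding I_def by (rule nn_integral_add) measurable
    finally show ?thesis .
  qed
  let ?K = "I (\<lambda>x. (U x)\<^sup>2) + I (\<lambda>x. (C x)\<^sup>2)"
  have pt: "?J (\<lambda>x. (U x)^4) z \<le> 4 * ?K * (?J (\<lambda>x. (A x)\<^sup>2) z + ?J (\<lambda>x. (B x)\<^sup>2) z)" for z
  proof -
    define a b where "a = ?J (\<lambda>x. 2 * U x * A x) z" and "b = ?J (\<lambda>x. 2 * U x * B x) z"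
    have "?J (\<lambda>x. (U x)^4) z \<le> a * b"
      unfolding a_def b_def by (intro plane_ladyzhenskaya h1 h2) measurable
    \<comment> \<open>The factor two given away here is immaterial: later only the finiteness of the
      bound counts.\<close>
    also have "a * b \<le> 2 * a * b" using mult_right_mono[of 1 2 "a * b"] by (simp add: mult.assoc)
    also have "\<dots> \<le> a\<^sup>2 + b\<^sup>2" by (rule sum_of_squares_ge_ennreal)
    also have "\<dots> \<le> 4 * ?J (\<lambda>x. (U x)\<^sup>2) z * ?J (\<lambda>x. (A x)\<^sup>2) z + 4 * ?J (\<lambda>x. (U x)\<^sup>2) z * ?J (\<lambda>x. (B x)\<^sup>2) z"
      unfolding a_def b_def by (intro add_mono cs) measurable
    also have "\<dots> = 4 * ?J (\<lambda>x. (U x)\<^sup>2) z * (?J (\<lambda>x. (A x)\<^sup>2) z + ?J (\<lambda>x. (B x)\<^sup>2) z)"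
      by (simp add: distrib_left)
    also have "\<dots> \<le> 4 * ?K * (?J (\<lambda>x. (A x)\<^sup>2) z + ?J (\<lambda>x. (B x)\<^sup>2) z)"
      by (intro mult_left_mono mult_right_mono E) auto
    finally show ?thesis .
  qed
  have "I (\<lambda>x. (U x)^4) = (\<integral>\<^sup>+z. ?J (\<lambda>x. (U x)^4) z \<partial>lborel)" by (simp add: I_def)
  also have "\<dots> \<le> (\<integral>\<^sup>+z. 4 * ?K * (?J (\<lambda>x. (A x)\<^sup>2) z + ?J (\<lambda>x. (B x)\<^sup>2) z) \<partial>lborel)"
    by (intro nn_integral_mono pt)
  also have "\<dots> = 4 * ?K * (\<integral>\<^sup>+z. ?J (\<lambda>x. (A x)\<^sup>2) z + ?J (\<lambda>x. (B x)\<^sup>2) z \<partial>lborel)"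
    by (rule nn_integral_cmult) measurable
  also have "(\<integral>\<^sup>+z. ?J (\<lambda>x. (A x)\<^sup>2) z + ?J (\<lambda>x. (B x)\<^sup>2) z \<partial>lborel) = I (\<lambda>x. (A x)\<^sup>2) + I (\<lambda>x. (B x)\<^sup>2)"
    unfolding I_def by (rule nn_integral_add) measurable
  finally show ?thesis .
qed

end

text \<open>The square of \<open>f\<close> is the integral of its derivative
  \<open>2 * f * D\<close> along the line, started at a point where \<open>f\<close>
  vanishes.\<close>

lemma square_le_line_integral:
  fixes f :: "'a::euclidean_space \<Rightarrow> real"
  assumes f: "C1_along e f D" and e: "e \<noteq> 0" and K: "compact K" and z: "\<And>x. x \<notin> K \<Longrightarrow> f x = 0"
  shows "(ennreal \<bar>f (s *\<^sub>R e + q)\<bar>)\<^sup>2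
    \<le> (\<integral>\<^sup>+t. 2 * ennreal \<bar>f (t *\<^sub>R e + q)\<bar> * ennreal \<bar>D (t *\<^sub>R e + q)\<bar> \<partial>lborel)"
proof -
  obtain B where B: "\<And>x. x \<in> K \<Longrightarrow> norm x \<le> B" and B0: "B > 0"
    using compact_imp_bounded[OF K] by (auto simp: bounded_pos)
  \<comment> \<open>The parameter of the starting point: to the left of \<open>s\<close>, and so far
    out that \<open>a *\<^sub>R e + q\<close> has norm at least \<open>B + 1\<close> and lies
    outside \<open>K\<close>.\<close>
  define a where "a = - (\<bar>s\<bar> + (B + norm q + 1) / norm e)"
  have "(B + norm q + 1) / norm e \<ge> 0" using B0 by simp
  then have as: "a \<le> s" and abs_a: "\<bar>a\<bar> = \<bar>s\<bar> + (B + norm q + 1) / norm e" by (auto simp: a_def)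
  have "norm (a *\<^sub>R e) = \<bar>a\<bar> * norm e" by simp
  also have "\<bar>a\<bar> = \<bar>s\<bar> + (B + norm q + 1) / norm e" by (rule abs_a)
  also have "\<dots> * norm e = \<bar>s\<bar> * norm e + (B + norm q + 1)" using e by (simp add: field_simps)
  also have "\<dots> \<ge> B + norm q + 1" by simp
  finally have "norm (a *\<^sub>R e) \<ge> B + norm q + 1" .
  moreover have "norm (a *\<^sub>R e) \<le> norm (a *\<^sub>R e + q) + norm q"
    using norm_triangle_ineq4[of "a *\<^sub>R e + q" q] by simp
  ultimately have "norm (a *\<^sub>R e + q) > B" by linarith
  then have "a *\<^sub>R e + q \<notin> K" using B by fastforce
  then have fa: "f (a *\<^sub>R e + q) = 0" by (rule z)
  define F where "F = (\<lambda>t. (f (t *\<^sub>R e + q))\<^sup>2)"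
  define g where "g = (\<lambda>t. 2 * f (t *\<^sub>R e + q) * D (t *\<^sub>R e + q))"
  have c: "continuous_on UNIV f" "continuous_on UNIV D" using f by (auto simp: C1_along_def)
  have gc: "continuous_on UNIV g" unfolding g_def
    by (intro continuous_intros continuous_on_compose2[OF c(1)] continuous_on_compose2[OF c(2)]) auto
  have "has_bochner_integral lborel (\<lambda>x. g x * indicator {a..s} x) (F s - F a)"
  proof (rule has_bochner_integral_FTC_Icc_real[OF as])
    fix t
    have "((\<lambda>t. f (q + t *\<^sub>R e)) has_real_derivative D (q + t *\<^sub>R e)) (at t)"
      by (rule C1_along_deriv[OF f])
    then have *: "((\<lambda>t. f (t *\<^sub>R e + q)) has_real_derivative D (t *\<^sub>R e + q)) (at t)"
      by (simp add: add.commute)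
    show "DERIV F t :> g t" unfolding F_def g_def
      by (rule derivative_eq_intros * refl | simp)+
    show "isCont g t" using gc by (simp add: continuous_on_eq_continuous_at)
  qed
  then have i: "integrable lborel (\<lambda>x. g x * indicator {a..s} x)"
    and v: "(\<integral>x. g x * indicator {a..s} x \<partial>lborel) = F s - F a"
    by (auto simp: has_bochner_integral_iff)
  have "(ennreal \<bar>f (s *\<^sub>R e + q)\<bar>)\<^sup>2 = ennreal (norm (\<integral>x. g x * indicator {a..s} x \<partial>lborel))"
    unfolding v by (simp add: F_def fa ennreal_power)
  also have "\<dots> \<le> (\<integral>\<^sup>+x. norm (g x * indicator {a..s} x) \<partial>lborel)"
    by (rule integral_norm_bound_ennreal[OF i])
  also have "\<dots> \<le> (\<integral>\<^sup>+t. 2 * ennreal \<bar>f (t *\<^sub>R e + q)\<bar> * ennreal \<bar>D (t *\<^sub>R e + q)\<bar> \<partial>lborel)"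
  proof (rule nn_integral_mono)
    fix t
    have "ennreal (norm (g t * indicator {a..s} t)) \<le> ennreal (2 * \<bar>f (t *\<^sub>R e + q)\<bar> * \<bar>D (t *\<^sub>R e + q)\<bar>)"
      by (intro ennreal_leI) (auto simp: g_def abs_mult indicator_def)
    also have "\<dots> = 2 * ennreal \<bar>f (t *\<^sub>R e + q)\<bar> * ennreal \<bar>D (t *\<^sub>R e + q)\<bar>"
      by (simp add: ennreal_mult)
    finally show "ennreal (norm (g t * indicator {a..s} t)) \<le> 2 * ennreal \<bar>f (t *\<^sub>R e + q)\<bar> * ennreal \<bar>D (t *\<^sub>R e + q)\<bar>" .
  qed
  finally show ?thesis .
qed

section \<open>Lebesgue measure as an iterated integral in two and three dimensions\<close>

interpretation lborel_product: product_sigma_finite "\<lambda>_ :: 'i. lborel :: real measure"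
  by standard

lemma nn_integral_lborel_coordinates:
  fixes F :: "'a::euclidean_space \<Rightarrow> ennreal"
  assumes [measurable]: "F \<in> borel_measurable borel"
  shows "(\<integral>\<^sup>+x. F x \<partial>lborel) = (\<integral>\<^sup>+f. F (\<Sum>b\<in>Basis. f b *\<^sub>R b) \<partial>(\<Pi>\<^sub>M b\<in>Basis. lborel))"
  by (subst lborel_eq, subst nn_integral_distr) auto

lemma plane_integral_product:
  fixes F :: "'a::euclidean_space \<Rightarrow> ennreal"
  assumes [measurable]: "F \<in> borel_measurable borel" and ne: "e1 \<noteq> e2"
  shows "(\<integral>\<^sup>+f. F (f e1 *\<^sub>R e1 + (f e2 *\<^sub>R e2 + p)) \<partial>(\<Pi>\<^sub>M b\<in>{e1, e2}. lborel)) = plane_integral e1 e2 F p"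
proof -
  have "case_prod (\<lambda>x y. F (x *\<^sub>R e1 + (y *\<^sub>R e2 + p))) \<in> borel_measurable (lborel \<Otimes>\<^sub>M lborel)"
    by measurable
  from lborel_product.product_nn_integral_pair[OF this ne]
  show ?thesis by (simp only: plane_integral_pair[OF assms(1)])
qed

lemma nn_integral_lborel_2:
  fixes F :: "'a::euclidean_space \<Rightarrow> ennreal"
  assumes F: "F \<in> borel_measurable borel" and B: "Basis = {e1, e2}" "e1 \<noteq> e2"
  shows "(\<integral>\<^sup>+x. F x \<partial>lborel) = plane_integral e1 e2 F 0"
proof -
  have "(\<Sum>b\<in>{e1, e2}. f b *\<^sub>R b) = f e1 *\<^sub>R e1 + (f e2 *\<^sub>R e2 + 0)" for f
    using B(2) by simp
  then show ?thesis
    by (simp only: nn_integral_lborel_coordinates[OF F] B(1) plane_integral_product[OF F B(2)])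
qed

lemma nn_integral_lborel_3:
  fixes F :: "'a::euclidean_space \<Rightarrow> ennreal"
  assumes [measurable]: "F \<in> borel_measurable borel"
    and B: "Basis = {e1, e2, e3}" "e1 \<noteq> e2" "e1 \<noteq> e3" "e2 \<noteq> e3"
  shows "(\<integral>\<^sup>+x. F x \<partial>lborel) = (\<integral>\<^sup>+z. plane_integral e1 e2 F (z *\<^sub>R e3) \<partial>lborel)"
proof -
  let ?G = "\<lambda>f. F (f e1 *\<^sub>R e1 + (f e2 *\<^sub>R e2 + f e3 *\<^sub>R e3))"
  have "(\<integral>\<^sup>+x. F x \<partial>lborel) = (\<integral>\<^sup>+f. ?G f \<partial>(\<Pi>\<^sub>M b\<in>insert e3 {e1, e2}. lborel))"
  proof -
    have "Basis = insert e3 {e1, e2}" using B by auto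
    moreover have "(\<Sum>b\<in>insert e3 {e1, e2}. f b *\<^sub>R b) = f e1 *\<^sub>R e1 + (f e2 *\<^sub>R e2 + f e3 *\<^sub>R e3)" for f
      using B(2-) by (auto simp: ac_simps)
    ultimately show ?thesis by (simp only: nn_integral_lborel_coordinates[OF assms(1)])
  qed
  \<comment> \<open>Splitting off \<open>e3\<close> in this order makes its integral the outermost
    one, as the slicing argument requires.\<close>
  also have "\<dots> = (\<integral>\<^sup>+z. (\<integral>\<^sup>+f. ?G (f(e3 := z)) \<partial>(\<Pi>\<^sub>M b\<in>{e1, e2}. lborel)) \<partial>lborel)"
    by (rule lborel_product.product_nn_integral_insert_rev[where f = ?G]) (use B in auto)
  also have "\<dots> = (\<integral>\<^sup>+z. plane_integral e1 e2 F (z *\<^sub>R e3) \<partial>lborel)"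
  proof (rule nn_integral_cong)
    fix z
    have "?G (f(e3 := z)) = F (f e1 *\<^sub>R e1 + (f e2 *\<^sub>R e2 + z *\<^sub>R e3))" for f
      using B(3,4) by simp
    then show "(\<integral>\<^sup>+f. ?G (f(e3 := z)) \<partial>(\<Pi>\<^sub>M b\<in>{e1, e2}. lborel)) = plane_integral e1 e2 F (z *\<^sub>R e3)"
      by (simp only: plane_integral_product[OF assms(1) B(2)])
  qed
  finally show ?thesis .
qed

section \<open>The embedding into fourth powers\<close>

context domain
begin

lemma nn_integral_lborel_l2norm:
  fixes w :: "real^'d \<Rightarrow> 'b::euclidean_space"
  assumes w: "continuous_on UNIV w" and K: "compact K" "K \<subseteq> \<Omega>" and z: "\<And>x. x \<notin> K \<Longrightarrow> w x = 0"
  shows "(\<integral>\<^sup>+x. ennreal ((norm (w x))\<^sup>2) \<partial>lborel) = ennreal ((l2norm \<Omega> w)\<^sup>2)"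
proof -
  have c: "continuous_on UNIV (\<lambda>x. (norm (w x))\<^sup>2)" by (intro continuous_intros w)
  have "integrable lborel (\<lambda>x. (norm (w x))\<^sup>2)"
    by (rule integrable_continuous_compact[OF c K(1)]) (simp add: z)
  then have "(\<integral>\<^sup>+x. ennreal ((norm (w x))\<^sup>2) \<partial>lborel) = ennreal (\<integral>x. (norm (w x))\<^sup>2 \<partial>lborel)"
    by (rule nn_integral_eq_integral) simp
  also have "(\<integral>x. (norm (w x))\<^sup>2 \<partial>lborel) = (l2norm \<Omega> w)\<^sup>2"
    unfolding l2norm_sq
    by (rule integral_lebesgue_on_lborel[OF open_dom, symmetric])
       (use K(2) z in \<open>auto intro!: borel_measurable_continuous_onI c\<close>)
  finally show ?thesis .
qed

text \<open>The two Ladyzhenskaya inequalities are applied to one component. With \<open>S\<close>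
  the sum of the two squared norms, the plane yields \<open>S\<^sup>2\<close> and space yields
  \<open>4 * S * (S + S)\<close>, so the constant 8 covers both.\<close>

lemma test_fun_L4:
  fixes \<phi> :: "real^'d \<Rightarrow> 'b::euclidean_space"
  assumes card: "CARD('d) = 2 \<or> CARD('d) = 3" and \<phi>: "test_fun \<Omega> \<phi>" and b: "b \<in> Basis"
  shows "(\<integral>\<^sup>+x. (ennreal \<bar>\<phi> x \<bullet> b\<bar>)^4 \<partial>lborel)
    \<le> 8 * (ennreal ((l2norm \<Omega> \<phi>)\<^sup>2) + ennreal ((l2norm \<Omega> (classical_grad \<phi>))\<^sup>2))\<^sup>2"
proof -
  obtain K where K: "compact K" "K \<subseteq> \<Omega>" "\<And>x. x \<notin> K \<Longrightarrow> \<phi> x = 0"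
    using \<phi> by (auto simp: test_fun_def)
  have fK: "\<And>x. x \<notin> K \<Longrightarrow> \<phi> x \<bullet> c = 0" for c by (simp add: K(3))
  have gK: "classical_grad \<phi> x = 0" if "x \<notin> K" for x
  proof -
    have "classical_grad \<phi> x $ i \<bullet> c = 0" for i c
      by (rule C1_along_zero_outside[OF test_fun_C1_along[OF \<phi>] K(1) fK that])
    then have "classical_grad \<phi> x $ i = 0" for i
      using inner_eq_zero_iff[of "classical_grad \<phi> x $ i"] by blast
    then show ?thesis by (simp add: vec_eq_iff)
  qed
  define U where "U = (\<lambda>x. ennreal \<bar>\<phi> x \<bullet> b\<bar>)"
  define A where "A = (\<lambda>i x. ennreal \<bar>classical_grad \<phi> x $ i \<bullet> b\<bar>)"
  define S where "S = ennreal ((l2norm \<Omega> \<phi>)\<^sup>2) + ennreal ((l2norm \<Omega> (classical_grad \<phi>))\<^sup>2)"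
  have C: "C1_along (axis i 1) (\<lambda>x. \<phi> x \<bullet> b) (\<lambda>x. classical_grad \<phi> x $ i \<bullet> b)" for i
    by (rule test_fun_C1_along[OF \<phi>])
  have [measurable]: "(\<lambda>x. \<phi> x \<bullet> b) \<in> borel_measurable borel" "(\<lambda>x. classical_grad \<phi> x $ i \<bullet> b) \<in> borel_measurable borel" for i
    using C[of i] by (auto simp: C1_along_def intro: borel_measurable_continuous_onI)
  have U [measurable]: "U \<in> borel_measurable borel" and A [measurable]: "A i \<in> borel_measurable borel" for i
    unfolding U_def A_def by measurable
  have h: "(U (s *\<^sub>R axis i 1 + q))\<^sup>2 \<le> (\<integral>\<^sup>+t. 2 * U (t *\<^sub>R axis i 1 + q) * A i (t *\<^sub>R axis i 1 + q) \<partial>lborel)" for i s q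
    unfolding U_def A_def by (rule square_le_line_integral[OF C _ K(1) fK]) (simp add: axis_eq_0_iff)
  have NU: "(\<integral>\<^sup>+x. (U x)\<^sup>2 \<partial>lborel) \<le> ennreal ((l2norm \<Omega> \<phi>)\<^sup>2)"
  proof -
    have "(U x)\<^sup>2 \<le> ennreal ((norm (\<phi> x))\<^sup>2)" for x
    proof -
      have "\<bar>\<phi> x \<bullet> b\<bar> \<le> norm (\<phi> x)" using Cauchy_Schwarz_ineq2[of "\<phi> x" b] b by simp
      then have "\<bar>\<phi> x \<bullet> b\<bar>\<^sup>2 \<le> (norm (\<phi> x))\<^sup>2" by (rule power_mono) simp
      then show ?thesis unfolding U_def by (subst ennreal_power) (auto intro: ennreal_leI)
    qed
    then have "(\<integral>\<^sup>+x. (U x)\<^sup>2 \<partial>lborel) \<le> (\<integral>\<^sup>+x. ennreal ((norm (\<phi> x))\<^sup>2) \<partial>lborel)" by (intro nn_integral_mono)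
    then show ?thesis by (simp add: nn_integral_lborel_l2norm[OF test_fun_continuous[OF \<phi>] K])
  qed
  have NA: "(\<integral>\<^sup>+x. (A i x)\<^sup>2 \<partial>lborel) \<le> ennreal ((l2norm \<Omega> (classical_grad \<phi>))\<^sup>2)" for i
  proof -
    have "(A i x)\<^sup>2 \<le> ennreal ((norm (classical_grad \<phi> x))\<^sup>2)" for x
    proof -
      have "\<bar>classical_grad \<phi> x $ i \<bullet> b\<bar> \<le> norm (classical_grad \<phi> x)"
        using Cauchy_Schwarz_ineq2[of "classical_grad \<phi> x $ i" b] b
          Finite_Cartesian_Product.norm_nth_le[of "classical_grad \<phi> x" i] by simp
      then have "\<bar>classical_grad \<phi> x $ i \<bullet> b\<bar>\<^sup>2 \<le> (norm (classical_grad \<phi> x))\<^sup>2" by (rule power_mono) simp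
      then show ?thesis unfolding A_def by (subst ennreal_power) (auto intro: ennreal_leI)
    qed
    then have "(\<integral>\<^sup>+x. (A i x)\<^sup>2 \<partial>lborel) \<le> (\<integral>\<^sup>+x. ennreal ((norm (classical_grad \<phi> x))\<^sup>2) \<partial>lborel)"
      by (intro nn_integral_mono)
    then show ?thesis by (simp add: nn_integral_lborel_l2norm[OF classical_grad_continuous[OF \<phi>] K(1,2) gK])
  qed
  have NS: "(\<integral>\<^sup>+x. (U x)\<^sup>2 \<partial>lborel) + (\<integral>\<^sup>+x. (A i x)\<^sup>2 \<partial>lborel) \<le> S" for i
    unfolding S_def by (intro add_mono NU NA)
  have AS: "(\<integral>\<^sup>+x. (A i x)\<^sup>2 \<partial>lborel) \<le> S" for i
    using NA[of i] by (simp add: S_def add_increasing)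
  have "(\<integral>\<^sup>+x. (U x)^4 \<partial>lborel) \<le> 8 * S\<^sup>2"
    using card
  proof
    assume "CARD('d) = 2"
    then obtain i j :: 'd where ij: "UNIV = {i, j}" "i \<noteq> j" by (auto simp: card_2_iff)
    have B: "Basis = {axis i (1::real), axis j 1}"
      using ij(1) by (auto simp: Basis_vec_def)
    have ne: "axis i (1::real) \<noteq> axis j 1" using ij(2) by (simp add: axis_eq_axis)
    note eq = nn_integral_lborel_2[OF _ B ne, symmetric]
    have "(\<integral>\<^sup>+x. (U x)^4 \<partial>lborel) \<le> (\<integral>\<^sup>+x. 2 * U x * A i x \<partial>lborel) * (\<integral>\<^sup>+x. 2 * U x * A j x \<partial>lborel)"
      using plane_ladyzhenskaya[OF U A[of i] A[of j] h h, of 0] by (simp add: eq)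
    also have "\<dots> \<le> (\<integral>\<^sup>+x. (U x)\<^sup>2 + (A i x)\<^sup>2 \<partial>lborel) * (\<integral>\<^sup>+x. (U x)\<^sup>2 + (A j x)\<^sup>2 \<partial>lborel)"
      by (intro mult_mono nn_integral_mono sum_of_squares_ge_ennreal) auto
    also have "\<dots> \<le> S * S"
      using NS by (intro mult_mono) (auto simp: nn_integral_add)
    also have "\<dots> \<le> 8 * S\<^sup>2" using mult_right_mono[of 1 8 "S\<^sup>2"] by (simp add: power2_eq_square)
    finally show ?thesis .
  next
    assume "CARD('d) = 3"
    then obtain i j k :: 'd where ij: "UNIV = {i, j, k}" "i \<noteq> j" "i \<noteq> k" "j \<noteq> k"
      by (auto simp: card_3_iff)
    have B: "Basis = {axis i (1::real), axis j 1, axis k 1}"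
      using ij(1) by (auto simp: Basis_vec_def)
    have ne: "axis i (1::real) \<noteq> axis j 1" "axis i (1::real) \<noteq> axis k 1" "axis j (1::real) \<noteq> axis k 1"
      using ij(2-) by (simp_all add: axis_eq_axis)
    note eq = nn_integral_lborel_3[OF _ B ne, symmetric]
    have "(\<integral>\<^sup>+x. (U x)^4 \<partial>lborel) \<le> 4 * ((\<integral>\<^sup>+x. (U x)\<^sup>2 \<partial>lborel) + (\<integral>\<^sup>+x. (A k x)\<^sup>2 \<partial>lborel))
        * ((\<integral>\<^sup>+x. (A i x)\<^sup>2 \<partial>lborel) + (\<integral>\<^sup>+x. (A j x)\<^sup>2 \<partial>lborel))"
      using space_ladyzhenskaya[OF U A[of i] A[of j] A[of k] h h h] by (simp add: eq)
    also have "\<dots> \<le> 4 * S * (S + S)" by (intro mult_mono add_mono NS AS) auto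
    also have "\<dots> = 4 * S * (2 * S)" by (simp add: mult_2)
    also have "\<dots> = (4 * 2) * (S * S)"
    proof -
      have "a * b * (c * d) = (a * c) * (b * d)" for a b c d :: ennreal by (simp add: ac_simps)
      then show ?thesis .
    qed
    also have "\<dots> = 8 * S\<^sup>2" by (simp add: power2_eq_square)
    finally show ?thesis .
  qed
  then show ?thesis by (simp add: U_def S_def)
qed

text \<open>The approximating test functions are bounded in both norms, so their fourth powers have
  uniformly bounded integrals. Fatou's lemma along an almost everywhere convergent subsequence
  passes the bound to \<open>u\<close>.\<close>

lemma H10_square_L2:
  fixes u :: "real^'d \<Rightarrow> 'b::euclidean_space"
  assumes card: "CARD('d) = 2 \<or> CARD('d) = 3" and u: "u \<in> H10 \<Omega>" and b: "b \<in> Basis"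
  shows "(\<lambda>x. (u x \<bullet> b)\<^sup>2) \<in> L2 \<Omega>"
proof -
  let ?M = "lebesgue_on \<Omega>"
  obtain g \<phi> where \<phi>: "\<And>n::nat. test_fun \<Omega> (\<phi> n)" and \<phi>u: "(\<lambda>n. l2norm \<Omega> (\<phi> n - u)) \<longlonglongrightarrow> 0"
      and \<phi>g: "(\<lambda>n. l2norm \<Omega> (classical_grad (\<phi> n) - g)) \<longlonglongrightarrow> 0" and L: "u \<in> L2 \<Omega>" "g \<in> L2 \<Omega>"
    using u unfolding H10_def has_grad0_def by blast
  obtain B1 where B1: "\<And>n. l2norm \<Omega> (\<phi> n - u) \<le> B1"
    using convergent_imp_Bseq[OF convergentI[OF \<phi>u]] by (auto simp: Bseq_def)
  obtain B2 where B2: "\<And>n. l2norm \<Omega> (classical_grad (\<phi> n) - g) \<le> B2"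
    using convergent_imp_Bseq[OF convergentI[OF \<phi>g]] by (auto simp: Bseq_def)
  define C where "C = 8 * (ennreal ((B1 + l2norm \<Omega> u)\<^sup>2) + ennreal ((B2 + l2norm \<Omega> g)\<^sup>2))\<^sup>2"
  have n1: "l2norm \<Omega> (\<phi> n) \<le> B1 + l2norm \<Omega> u" for n
    using L2.nrm_triangle[of "\<phi> n - u" \<Omega> u] B1[of n] test_fun_L2[OF \<phi>] L by (simp add: L2_nrm)
  have n2: "l2norm \<Omega> (classical_grad (\<phi> n)) \<le> B2 + l2norm \<Omega> g" for n
    using L2.nrm_triangle[of "classical_grad (\<phi> n) - g" \<Omega> g] B2[of n] classical_grad_L2[OF \<phi>] L by (simp add: L2_nrm)
  have bound: "(\<integral>\<^sup>+x. ennreal ((\<phi> n x \<bullet> b)^4) \<partial>?M) \<le> C" for n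
  proof -
    have "(\<integral>\<^sup>+x. ennreal ((\<phi> n x \<bullet> b)^4) \<partial>?M) = (\<integral>\<^sup>+x. ennreal ((\<phi> n x \<bullet> b)^4) * indicator \<Omega> x \<partial>lebesgue)"
      using open_dom by (intro nn_integral_restrict_space) auto
    also have "\<dots> \<le> (\<integral>\<^sup>+x. ennreal ((\<phi> n x \<bullet> b)^4) \<partial>lebesgue)"
      by (intro nn_integral_mono) (auto simp: indicator_def)
    also have "\<dots> = (\<integral>\<^sup>+x. (ennreal \<bar>\<phi> n x \<bullet> b\<bar>)^4 \<partial>lborel)"
      by (simp add: nn_integral_completion ennreal_power)
    also have "\<dots> \<le> 8 * (ennreal ((l2norm \<Omega> (\<phi> n))\<^sup>2) + ennreal ((l2norm \<Omega> (classical_grad (\<phi> n)))\<^sup>2))\<^sup>2"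
      by (rule test_fun_L4[OF card \<phi> b])
    also have "\<dots> \<le> C" unfolding C_def
      by (intro mult_left_mono power_mono add_mono ennreal_leI n1 n2) auto
    finally show ?thesis .
  qed
  \<comment> \<open>Convergence in the square norm is L1 convergence of the squared distances to
    zero.\<close>
  have "\<exists>r::nat\<Rightarrow>nat. strict_mono r \<and> (AE x in ?M. (\<lambda>n. (norm ((\<phi> (r n) - u) x))\<^sup>2) \<longlonglongrightarrow> 0)"
  proof (rule tendsto_L1_AE_subseq)
    show "integrable ?M (\<lambda>x. (norm ((\<phi> n - u) x))\<^sup>2)" for n
      by (intro L2_D L2.diff_V test_fun_L2 \<phi> L)
    show "(\<lambda>n. \<integral>x. norm ((norm ((\<phi> n - u) x))\<^sup>2) \<partial>?M) \<longlonglongrightarrow> 0"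
      using tendsto_power[OF \<phi>u, of 2] by (simp add: l2norm_sq)
  qed
  then obtain r :: "nat \<Rightarrow> nat" where r: "AE x in ?M. (\<lambda>n. (norm ((\<phi> (r n) - u) x))\<^sup>2) \<longlonglongrightarrow> 0" by blast
  have um: "u \<in> borel_measurable ?M" using L by auto
  have "(\<integral>\<^sup>+x. ennreal ((u x \<bullet> b)^4) \<partial>?M) = (\<integral>\<^sup>+x. liminf (\<lambda>n. ennreal ((\<phi> (r n) x \<bullet> b)^4)) \<partial>?M)"
  proof (rule nn_integral_cong_AE, use r in eventually_elim)
    case (elim x)
    have "(\<lambda>n. sqrt ((norm ((\<phi> (r n) - u) x))\<^sup>2)) \<longlonglongrightarrow> sqrt 0" by (intro tendsto_intros elim)
    then have "(\<lambda>n. \<phi> (r n) x - u x) \<longlonglongrightarrow> 0" by (simp add: tendsto_norm_zero_iff)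
    then have "(\<lambda>n. \<phi> (r n) x) \<longlonglongrightarrow> u x" by (simp add: LIM_zero_iff)
    then have "(\<lambda>n. ennreal ((\<phi> (r n) x \<bullet> b)^4)) \<longlonglongrightarrow> ennreal ((u x \<bullet> b)^4)"
      by (intro tendsto_ennrealI tendsto_intros)
    then show ?case by (rule lim_imp_Liminf[OF trivial_limit_sequentially, symmetric])
  qed
  also have "\<dots> \<le> liminf (\<lambda>n. \<integral>\<^sup>+x. ennreal ((\<phi> (r n) x \<bullet> b)^4) \<partial>?M)"
    using continuous_measurable_lebesgue_on[OF test_fun_continuous[OF \<phi>], where \<Omega> = \<Omega>]
    by (intro nn_integral_liminf) auto
  also have "\<dots> \<le> liminf (\<lambda>n::nat. C)" by (intro Liminf_mono always_eventually allI bound)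
  also have "\<dots> < \<infinity>" by (simp add: C_def Liminf_const ennreal_mult_less_top power_less_top_ennreal)
  finally have fin: "(\<integral>\<^sup>+x. ennreal ((u x \<bullet> b)^4) \<partial>?M) < \<infinity>" .
  have "integrable ?M (\<lambda>x. (u x \<bullet> b)^4)"
    using um fin by (intro integrableI_bounded) auto
  moreover have "(\<lambda>x. (norm ((u x \<bullet> b)\<^sup>2))\<^sup>2) = (\<lambda>x. (u x \<bullet> b)^4)" by simp
  ultimately show ?thesis using um unfolding L2_def by (auto simp del: power_even_abs)
qed

lemma H10_mult_L2:
  fixes u :: "real^'d \<Rightarrow> 'b::euclidean_space" and v :: "real^'d \<Rightarrow> 'c::euclidean_space"
  assumes card: "CARD('d) = 2 \<or> CARD('d) = 3"
    and u: "u \<in> H10 \<Omega>" "b \<in> Basis" and v: "v \<in> H10 \<Omega>" "c \<in> Basis"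
  shows "(\<lambda>x. (u x \<bullet> b) * (v x \<bullet> c)) \<in> L2 \<Omega>"
proof (rule L2_bound[OF L2_add[OF H10_square_L2[OF card u] H10_square_L2[OF card v]]])
  show "(\<lambda>x. (u x \<bullet> b) * (v x \<bullet> c)) \<in> borel_measurable (lebesgue_on \<Omega>)"
    using L2_D(1)[OF H10_L2[OF u(1)]] L2_D(1)[OF H10_L2[OF v(1)]] by auto
  show "norm ((u x \<bullet> b) * (v x \<bullet> c)) \<le> norm (((\<lambda>x. (u x \<bullet> b)\<^sup>2) + (\<lambda>x. (v x \<bullet> c)\<^sup>2)) x)" for x
    using inner_le_sq[of "u x \<bullet> b" "v x \<bullet> c"] by simp
qed

text \<open>Each summand of the expanded integrand is a product of two undifferentiated components,
  square integrable by the fourth-power embedding, with a component of the gradient. Without this,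
  an integral could silently take its default value zero and additivity would fail.\<close>

lemma integrable_convect:
  fixes v w :: "real^'d \<Rightarrow> 'b::euclidean_space"
  assumes card: "CARD('d) = 2 \<or> CARD('d) = 3"
    and u: "u \<in> H10 \<Omega>" and v: "v \<in> H10 \<Omega>" and w: "w \<in> H10 \<Omega>"
  shows "integrable (lebesgue_on \<Omega>) (\<lambda>x. convect \<Omega> u v x \<bullet> w x)"
proof -
  have eq: "convect \<Omega> u v x \<bullet> w x
      = (\<Sum>i\<in>UNIV. \<Sum>b\<in>Basis. ((u x \<bullet> axis i 1) * (w x \<bullet> b)) * (grad \<Omega> v x $ i \<bullet> b))" for x
  proof -
    have "convect \<Omega> u v x \<bullet> w x = (\<Sum>i\<in>UNIV. u x $ i * (grad \<Omega> v x $ i \<bullet> w x))"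
      by (simp add: convect_def inner_sum_left)
    also have "\<dots> = (\<Sum>i\<in>UNIV. u x $ i * (\<Sum>b\<in>Basis. (grad \<Omega> v x $ i \<bullet> b) * (w x \<bullet> b)))"
      by (simp only: euclidean_inner[symmetric])
    finally show ?thesis by (simp add: sum_distrib_left inner_axis ac_simps)
  qed
  have "integrable (lebesgue_on \<Omega>) (\<lambda>x. ((u x \<bullet> axis i 1) * (w x \<bullet> b)) * (grad \<Omega> v x $ i \<bullet> b))"
    if b: "b \<in> Basis" for i b
  proof -
    have "(\<lambda>x. (u x \<bullet> axis i 1) * (w x \<bullet> b)) \<in> L2 \<Omega>"
      by (rule H10_mult_L2[OF card u _ w b]) (simp add: axis_in_Basis_iff)
    moreover have "(\<lambda>x. grad \<Omega> v x $ i \<bullet> b) \<in> L2 \<Omega>"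
      using b by (intro L2_inner_right L2_component grad_L2 v) simp
    ultimately show ?thesis by (auto dest: integrable_inner_L2)
  qed
  then show ?thesis unfolding eq by (intro Bochner_Integration.integrable_sum) auto
qed

end

section \<open>Residuals of Anderson acceleration\<close>

context semi_inner
begin

text \<open>The equations enter only through \<open>lip\<close>, a contraction estimate, and
  \<open>key\<close>, a first-order part with the same constant \<open>q\<close> plus products of
  increments weighted by \<open>L\<close>. The gains \<open>h\<close> are taken equal to their upper
  bounds.\<close>

theorem anderson_residual_bound:
  fixes y t :: "nat \<Rightarrow> 'v" and \<beta> :: "nat \<Rightarrow> real" and \<alpha> :: "nat \<Rightarrow> nat \<Rightarrow> real" and m k :: nat
  defines "r \<equiv> residual y t"
  defines "\<xi> \<equiv> \<lambda>j. if j = 1 then 1 else nrm (aa_comb m j (\<alpha> j) r) / nrm (r j)"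
  defines "mk \<equiv> depth m k"
  assumes yV: "\<And>j. y j \<in> V" and tV: "\<And>j. j \<ge> 1 \<Longrightarrow> t j \<in> V"
    and y1: "y 1 = t 1"
    and opt: "\<And>k a. k \<ge> 2 \<Longrightarrow> nrm (aa_comb m k (\<alpha> k) r) \<le> nrm (aa_comb m k a r)"
    and upd: "\<And>k. k \<ge> 2 \<Longrightarrow> y k = aa_comb m k (\<alpha> k) (\<lambda>j. y (j - 1)) + \<beta> k *\<^sub>R aa_comb m k (\<alpha> k) r"
    and \<beta>1: "\<beta> 1 = 1" and \<beta>: "\<And>k. k \<ge> 2 \<Longrightarrow> 0 < \<beta> k \<and> \<beta> k \<le> 1"
    and q: "0 \<le> q" "q < 1" and L: "L \<ge> 0"
    and lip: "\<And>n. n \<ge> 1 \<Longrightarrow> nrm (t (Suc n) - t n) \<le> q * nrm (y n - y (n - 1))"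
    and key: "\<And>k I g s. \<lbrakk>k \<ge> 1; finite I; \<And>n. n \<in> I \<Longrightarrow> n \<ge> 1;
        y k - y (k - 1) = s - (\<Sum>n\<in>I. g n *\<^sub>R (y n - y (n - 1)))\<rbrakk> \<Longrightarrow>
        nrm (t (Suc k) - t k + (\<Sum>n\<in>I. g n *\<^sub>R (t (Suc n) - t n)))
        \<le> q * nrm s + (\<Sum>n\<in>I. \<bar>g n\<bar> * (L * nrm (y n - y (n - 1)) *
             (nrm (y (k - 1) - y (n - 1)) + nrm (y k - y n))))"
    and m: "m \<ge> 1" and k: "k \<ge> 2" and cs: "c_s > 0"
    and r0: "\<And>j. j \<in> {1..k} \<Longrightarrow> nrm (r j) \<noteq> 0"
    and sine: "\<And>j s. \<lbrakk>j \<in> {1..k - 1};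
        s \<in> span ((\<lambda>n. r (n + 1) - r n) ` {max 1 (j + 1 - mk)..j - 1})\<rbrakk>
        \<Longrightarrow> c_s * nrm (r (j + 1) - r j) \<le> nrm (r (j + 1) - r j - s)"
  defines "C \<equiv> real m * ((1 + 1 / c_s) ^ m / c_s / (1 - q))"
  defines "h \<equiv> \<lambda>j. C * sqrt (1 - (\<xi> j)\<^sup>2) + \<beta> j * \<xi> j"
  shows "nrm (r (k + 1)) \<le> nrm (r k) *
      (\<xi> k * (1 - \<beta> k + q * \<beta> k) + C * (2 * L) * sqrt (1 - (\<xi> k)\<^sup>2) / 2 *
        (nrm (r k) * h k + 2 * (\<Sum>j = k - mk + 1..k - 1. real (k - j) * nrm (r j) * h j)
          + real mk * nrm (r (k - mk)) * h (k - mk)))"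
proof -
  define e where "e = (\<lambda>n. y n - y (n - 1))"
  define d where "d = (\<lambda>n. r (n + 1) - r n)"
  \<comment> \<open>The cost of one correction term: the sine bound on coefficients, and
    \<open>1 - q\<close> for passing from residual differences \<open>d\<close> to iterate
    differences \<open>e\<close>.\<close>
  define C1 where "C1 = (1 + 1 / c_s) ^ m / c_s / (1 - q)"
  define l where "l = (\<lambda>k. k - depth m k)"
  define g where "g = (\<lambda>k n. \<Sum>i\<in>{l k..n}. \<alpha> k i)"
  have C1: "C1 \<ge> 0" using cs q by (simp add: C1_def)
  have C: "C = real m * C1" by (simp add: C_def C1_def)
  have rV: "r j \<in> V" if "j \<ge> 1" for j unfolding r_def residual_def using yV tV[OF that] by auto
  have eV: "e n \<in> V" for n unfolding e_def using yV by auto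
  have dV: "d n \<in> V" if "n \<ge> 1" for n unfolding d_def using rV that by auto
  have rpos: "nrm (r j) > 0" if "j \<in> {1..k}" for j
    using r0[OF that] nrm_nonneg[OF rV[of j]] that by auto
  have l1: "1 \<le> l j" "l j < j" "j \<le> l j + m" if "j \<ge> 2" for j
    using that m by (auto simp: l_def depth_def)
  have comb: "aa_comb m j a x = x j - (\<Sum>n\<in>{l j..<j}. (\<Sum>i\<in>{l j..n}. a i) *\<^sub>R (x (Suc n) - x n))"
    if "j \<ge> 2" for j a and x :: "nat \<Rightarrow> 'v"
    unfolding l_def using that by (intro aa_comb_increments) simp
  have wcomb: "aa_comb m j (\<alpha> j) r = r j - (\<Sum>n\<in>{l j..<j}. g j n *\<^sub>R d n)" if "j \<ge> 2" for j
    unfolding comb[OF that] by (simp add: g_def d_def)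
  have ycomb: "aa_comb m j (\<alpha> j) (\<lambda>j. y (j - 1)) = y (j - 1) - (\<Sum>n\<in>{l j..<j}. g j n *\<^sub>R e n)"
    if "j \<ge> 2" for j
    unfolding comb[OF that] by (simp add: g_def e_def)
  \<comment> \<open>The iterate increment is the increment of solutions minus that of residuals; by
    contraction the former is absorbed on the left.\<close>
  have ed: "(1 - q) * nrm (e n) \<le> nrm (d n)" if n: "n \<ge> 1" for n
  proof -
    have "e n = (t (Suc n) - t n) - d n" by (simp add: e_def d_def r_def residual_def)
    then have "nrm (e n) \<le> nrm (t (Suc n) - t n) + nrm (d n)"
      using nrm_triangle_diff[of "t (Suc n) - t n" "d n"] tV dV n by auto
    also have "\<dots> \<le> q * nrm (e n) + nrm (d n)" using lip[OF n] by (simp add: e_def)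
    finally show ?thesis by (simp add: algebra_simps)
  qed
  have gsum: "(nrm (\<Sum>n\<in>{l j..<j}. g j n *\<^sub>R d n)) = sqrt (1 - (\<xi> j)\<^sup>2) * nrm (r j)"
    and \<xi>1: "0 \<le> \<xi> j" "(\<xi> j)\<^sup>2 \<le> 1" and wnrm: "nrm (aa_comb m j (\<alpha> j) r) = \<xi> j * nrm (r j)"
    if j: "j \<in> {2..k}" for j
  proof -
    let ?p = "\<Sum>n\<in>{l j..<j}. g j n *\<^sub>R d n"
    have j2: "j \<ge> 2" and rj: "nrm (r j) > 0" and jV: "r j \<in> V" using j rpos rV by auto
    have pV: "?p \<in> V" using l1[OF j2] by (intro sum_V scale_V dV) auto
    \<comment> \<open>Scaling the optimal coefficients stays within the competitors and traces the
      line on which \<open>nrm_minimizer\<close> needs minimality.\<close>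
    have sc: "aa_comb m j (\<lambda>i. s * \<alpha> j i) r = r j - s *\<^sub>R ?p" for s
      unfolding comb[OF j2] by (simp add: g_def d_def scaleR_sum_right sum_distrib_left)
    have pyth: "(nrm ?p)\<^sup>2 = (nrm (r j))\<^sup>2 - (nrm (r j - ?p))\<^sup>2"
    proof (rule nrm_minimizer[OF jV pV])
      show "nrm (r j - ?p) \<le> nrm (r j - s *\<^sub>R ?p)" for s
        using opt[OF j2, of "\<lambda>i. s * \<alpha> j i"] by (simp add: sc wcomb[OF j2])
    qed
    have \<xi>: "\<xi> j = nrm (r j - ?p) / nrm (r j)" using j by (simp add: \<xi>_def wcomb[OF j2])
    then show w: "nrm (aa_comb m j (\<alpha> j) r) = \<xi> j * nrm (r j)" using rj by (simp add: wcomb[OF j2])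
    have sq: "(nrm ?p)\<^sup>2 = (1 - (\<xi> j)\<^sup>2) * (nrm (r j))\<^sup>2"
    proof -
      have "nrm (r j - ?p) = \<xi> j * nrm (r j)" using w by (simp add: wcomb[OF j2])
      then show ?thesis unfolding pyth by (simp add: power_mult_distrib algebra_simps)
    qed
    show "0 \<le> \<xi> j" unfolding \<xi> using nrm_nonneg jV pV by auto
    have "0 \<le> (1 - (\<xi> j)\<^sup>2) * (nrm (r j))\<^sup>2" unfolding sq[symmetric] by simp
    then show "(\<xi> j)\<^sup>2 \<le> 1" using rj by (simp add: zero_le_mult_iff)
    have "nrm ?p = sqrt ((nrm ?p)\<^sup>2)" using nrm_nonneg[OF pV] by simp
    then show "nrm ?p = sqrt (1 - (\<xi> j)\<^sup>2) * nrm (r j)"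
      unfolding sq using rj by (simp add: real_sqrt_mult)
  qed
  have coeff: "\<bar>g j n\<bar> * nrm (e n) \<le> C1 * sqrt (1 - (\<xi> j)\<^sup>2) * nrm (r j)"
    if j: "j \<in> {2..k}" and n: "n \<in> {l j..<j}" for j n
  proof -
    have j2: "j \<ge> 2" using j by simp
    have "\<bar>g j n\<bar> * nrm (d n) \<le> (1 + 1 / c_s) ^ m / c_s * nrm (\<Sum>i\<in>{l j..<j}. g j i *\<^sub>R d i)"
    proof (rule coeff_bound_uniform[OF cs _ _ n l1(3)[OF j2]])
      show "d i \<in> V" if "i \<in> {l j..<j}" for i using that l1(1)[OF j2] by (intro dV) auto
      fix i s assume i: "i \<in> {l j..<j}" and s: "s \<in> span (d ` {l j..<i})"
      \<comment> \<open>The sine hypothesis uses the depth at \<open>k\<close> for all indices. As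
        \<open>i < j\<close> and \<open>j \<le> k\<close>, its window below \<open>i\<close> reaches
        back at least as far as the one used at step \<open>j\<close>.\<close>
      have "{l j..<i} \<subseteq> {max 1 (i + 1 - mk)..i - 1}"
        using i j m unfolding l_def mk_def depth_def by (auto simp: min_def split: if_splits)
      then have "s \<in> span (d ` {max 1 (i + 1 - mk)..i - 1})" using s by (meson image_mono span_mono subsetD)
      moreover have "i \<in> {1..k - 1}" using i j l1(1)[OF j2] by auto
      ultimately show "c_s * nrm (d i) \<le> nrm (d i - s)"
        using sine[of i s] by (simp add: d_def)
    qed
    then have "\<bar>g j n\<bar> * nrm (d n) \<le> (1 + 1 / c_s) ^ m / c_s * (sqrt (1 - (\<xi> j)\<^sup>2) * nrm (r j))"
      by (simp only: gsum[OF j])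
    moreover have "\<bar>g j n\<bar> * ((1 - q) * nrm (e n)) \<le> \<bar>g j n\<bar> * nrm (d n)"
      using n l1(1)[OF j2] by (intro mult_left_mono ed) auto
    moreover have "\<bar>g j n\<bar> * ((1 - q) * nrm (e n)) = \<bar>g j n\<bar> * nrm (e n) * (1 - q)" by simp
    ultimately have "\<bar>g j n\<bar> * nrm (e n) * (1 - q) \<le> (1 + 1 / c_s) ^ m / c_s * (sqrt (1 - (\<xi> j)\<^sup>2) * nrm (r j))"
      by linarith
    with q(2) have "\<bar>g j n\<bar> * nrm (e n) \<le> (1 + 1 / c_s) ^ m / c_s * (sqrt (1 - (\<xi> j)\<^sup>2) * nrm (r j)) / (1 - q)"
      by (intro mult_imp_le_div_pos) auto
    then show ?thesis by (simp add: C1_def algebra_simps)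
  qed
  \<comment> \<open>The update, rewritten in increments: the damped optimised residual minus the
    correction, with the same coefficients as for the residuals.\<close>
  have e_upd: "e j = \<beta> j *\<^sub>R aa_comb m j (\<alpha> j) r - (\<Sum>n\<in>{l j..<j}. g j n *\<^sub>R e n)" if "j \<ge> 2" for j
    using upd[OF that] ycomb[OF that] by (simp add: e_def[of] algebra_simps)
  have wV: "aa_comb m j (\<alpha> j) r \<in> V" if "j \<ge> 2" for j
    unfolding wcomb[OF that] using l1(1)[OF that] that by (intro diff_V rV sum_V scale_V dV) auto
  define E where "E = (\<lambda>j. nrm (r j) * h j)"
  have eE: "nrm (e j) \<le> E j" if j: "j \<in> {1..k}" for j
  proof (cases "j = 1")
    \<comment> \<open>The first step is undamped and unaccelerated; the conventions
      \<open>\<xi> 1 = 1\<close> and \<open>\<beta> 1 = 1\<close> give \<open>h 1 = 1\<close>,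
      matching \<open>e 1 = r 1\<close>.\<close>
    case True
    have "e 1 = r 1" using y1 by (simp add: e_def r_def residual_def)
    then show ?thesis using True \<beta>1 by (simp add: E_def h_def \<xi>_def)
  next
    case False
    then have j': "j \<in> {2..k}" and j2: "j \<ge> 2" using j by auto
    let ?B = "C1 * sqrt (1 - (\<xi> j)\<^sup>2) * nrm (r j)"
    have B0: "?B \<ge> 0" using C1 \<xi>1(2)[OF j'] nrm_nonneg[OF rV] j2 by auto
    have "nrm (e j) \<le> nrm (\<beta> j *\<^sub>R aa_comb m j (\<alpha> j) r) + nrm (\<Sum>n\<in>{l j..<j}. g j n *\<^sub>R e n)"
      unfolding e_upd[OF j2] by (intro nrm_triangle_diff scale_V wV j2 sum_V eV)
    also have "nrm (\<beta> j *\<^sub>R aa_comb m j (\<alpha> j) r) = \<beta> j * \<xi> j * nrm (r j)"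
      using \<beta>[OF j2] by (simp add: nrm_scale wV[OF j2] wnrm[OF j'])
    also have "nrm (\<Sum>n\<in>{l j..<j}. g j n *\<^sub>R e n) \<le> (\<Sum>n\<in>{l j..<j}. nrm (g j n *\<^sub>R e n))"
      by (intro nrm_sum scale_V eV) simp
    also have "\<dots> \<le> (\<Sum>n\<in>{l j..<j}. ?B)"
      by (intro sum_mono) (simp add: nrm_scale[OF eV] coeff[OF j'])
    also have "\<dots> = real (j - l j) * ?B" by simp
    \<comment> \<open>The number of correction terms is bounded by \<open>m\<close>; this is the
      factor \<open>m\<close> in \<open>C\<close>.\<close>
    also have "\<dots> \<le> real m * ?B" using l1[OF j2] B0 by (intro mult_right_mono) auto
    finally show ?thesis by (simp add: E_def h_def C algebra_simps)
  qed
  have E0: "E j \<ge> 0" if "j \<in> {1..k}" for j using eE[OF that] nrm_nonneg[OF eV, of j] by linarith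
  have tele: "nrm (y b - y a) \<le> (\<Sum>i\<in>{a<..b}. E i)" if "a \<le> b" "b \<le> k" for a b
    using that
  proof (induction b rule: dec_induct)
    case base then show ?case by (simp add: nrm_zero)
  next
    case (step b)
    have "nrm (y (Suc b) - y a) = nrm (e (Suc b) + (y b - y a))" by (simp add: e_def)
    also have "\<dots> \<le> nrm (e (Suc b)) + nrm (y b - y a)" by (intro nrm_triangle eV diff_V yV)
    also have "\<dots> \<le> E (Suc b) + (\<Sum>i\<in>{a<..b}. E i)" using step by (intro add_mono eE) auto
    also have "\<dots> = (\<Sum>i\<in>insert (Suc b) {a<..b}. E i)" by simp
    also have "insert (Suc b) {a<..b} = {a<..Suc b}" using step(1) by auto
    finally show ?case .
  qed
  let ?l = "l k"
  have lk: "1 \<le> ?l" "?l < k" "k \<le> ?l + m" using l1[OF k] by auto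
  have mk: "mk = k - ?l" "?l = k - mk" "mk \<ge> 1" "mk \<le> m"
    using k m by (auto simp: mk_def l_def depth_def)
  have kk: "k \<in> {2..k}" using k by simp
  define W where "W = aa_comb m k (\<alpha> k) r"
  \<comment> \<open>Two telescoping sums are added, one ending at \<open>k - 1\<close> and one
    starting at \<open>?l + 1\<close>. They overlap in the interior, hence the weight two there and
    one at either end.\<close>
  define T where "T = E k + 2 * (\<Sum>j\<in>{?l + 1..k - 1}. E j) + E ?l"
  have T1: "(\<Sum>i\<in>{?l..k - 1}. E i) + (\<Sum>i\<in>{?l + 1..k}. E i) = T"
  proof -
    have "{?l..k - 1} = insert ?l {?l + 1..k - 1}" "{?l + 1..k} = insert k {?l + 1..k - 1}"
      using lk by auto
    then show ?thesis using lk by (simp add: T_def)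
  qed
  have An: "nrm (y (k - 1) - y (n - 1)) + nrm (y k - y n) \<le> T" if n: "n \<in> {?l..<k}" for n
  proof -
    have "nrm (y (k - 1) - y (n - 1)) \<le> (\<Sum>i\<in>{n - 1<..k - 1}. E i)" using n by (intro tele) auto
    also have "\<dots> \<le> (\<Sum>i\<in>{?l..k - 1}. E i)"
      using n lk by (intro sum_mono2) (auto intro!: E0)
    finally have 1: "nrm (y (k - 1) - y (n - 1)) \<le> (\<Sum>i\<in>{?l..k - 1}. E i)" .
    have "nrm (y k - y n) \<le> (\<Sum>i\<in>{n<..k}. E i)" using n by (intro tele) auto
    also have "\<dots> \<le> (\<Sum>i\<in>{?l + 1..k}. E i)"
      using n lk by (intro sum_mono2) (auto intro!: E0)
    finally show ?thesis using 1 T1 by linarith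
  qed
  have T0: "T \<ge> 0" unfolding T1[symmetric] using lk by (intro add_nonneg_nonneg sum_nonneg E0) auto
  define R where "R = t (Suc k) - t k + (\<Sum>n\<in>{?l..<k}. g k n *\<^sub>R (t (Suc n) - t n))"
  have rk: "r (k + 1) = (1 - \<beta> k) *\<^sub>R W + R"
  proof -
    have "W = t k - y (k - 1) - (\<Sum>n\<in>{?l..<k}. g k n *\<^sub>R ((t (Suc n) - t n) - e n))"
      unfolding W_def wcomb[OF k] using lk
      by (simp add: r_def residual_def d_def e_def algebra_simps)
    then have W: "W = t k - y (k - 1) - (\<Sum>n\<in>{?l..<k}. g k n *\<^sub>R (t (Suc n) - t n)) + (\<Sum>n\<in>{?l..<k}. g k n *\<^sub>R e n)"
      by (simp add: scaleR_diff_right sum_subtractf)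
    define P Q where "P = (\<Sum>n\<in>{?l..<k}. g k n *\<^sub>R e n)"
      and "Q = (\<Sum>n\<in>{?l..<k}. g k n *\<^sub>R (t (Suc n) - t n))"
    have "y (k - 1) - P = t k - Q - W" using W unfolding P_def[symmetric] Q_def[symmetric] by simp
    moreover have "y k = y (k - 1) - P + \<beta> k *\<^sub>R W"
      using upd[OF k] by (simp only: ycomb[OF k] W_def P_def)
    ultimately have "y k = t k - Q - W + \<beta> k *\<^sub>R W" by simp
    moreover have "r (k + 1) = t (Suc k) - y k" by (simp add: r_def residual_def)
    ultimately show ?thesis unfolding R_def Q_def[symmetric] by (simp add: scaleR_diff_left)
  qed
  have RV: "R \<in> V" unfolding R_def using lk k by (intro add_V diff_V sum_V scale_V tV) auto
  have WV: "W \<in> V" unfolding W_def by (rule wV[OF k])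
  have Wn: "nrm W = \<xi> k * nrm (r k)" unfolding W_def by (rule wnrm[OF kk])
  let ?B = "C1 * sqrt (1 - (\<xi> k)\<^sup>2) * nrm (r k)"
  have B0: "?B \<ge> 0" using C1 \<xi>1(2)[OF kk] nrm_nonneg[OF rV] k by auto
  \<comment> \<open>\<open>e_upd\<close> at \<open>k\<close> is precisely the hypothesis of
    \<open>key\<close> with \<open>s\<close> the damped optimised residual.\<close>
  have "nrm R \<le> q * nrm (\<beta> k *\<^sub>R W) + (\<Sum>n\<in>{?l..<k}. \<bar>g k n\<bar> * (L * nrm (y n - y (n - 1)) *
             (nrm (y (k - 1) - y (n - 1)) + nrm (y k - y n))))"
    unfolding R_def
  proof (rule key)
    show "y k - y (k - 1) = \<beta> k *\<^sub>R W - (\<Sum>n\<in>{?l..<k}. g k n *\<^sub>R (y n - y (n - 1)))"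
      using e_upd[OF k] by (simp add: e_def W_def)
  qed (use k lk in auto)
  also have "nrm (\<beta> k *\<^sub>R W) = \<beta> k * \<xi> k * nrm (r k)" using \<beta>[OF k] WV by (simp add: nrm_scale Wn)
  also have "(\<Sum>n\<in>{?l..<k}. \<bar>g k n\<bar> * (L * nrm (y n - y (n - 1)) *
             (nrm (y (k - 1) - y (n - 1)) + nrm (y k - y n)))) \<le> (\<Sum>n\<in>{?l..<k}. ?B * (L * T))"
  proof (rule sum_mono)
    fix n assume n: "n \<in> {?l..<k}"
    have "\<bar>g k n\<bar> * (L * nrm (y n - y (n - 1)) * (nrm (y (k - 1) - y (n - 1)) + nrm (y k - y n)))
        = (\<bar>g k n\<bar> * nrm (e n)) * (L * (nrm (y (k - 1) - y (n - 1)) + nrm (y k - y n)))"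
      by (simp add: e_def mult.left_commute mult.assoc)
    also have "\<dots> \<le> ?B * (L * T)"
    proof (rule mult_mono)
      show "\<bar>g k n\<bar> * nrm (e n) \<le> ?B" by (rule coeff[OF kk n])
      show "L * (nrm (y (k - 1) - y (n - 1)) + nrm (y k - y n)) \<le> L * T" by (rule mult_left_mono[OF An[OF n] L])
      show "0 \<le> ?B" by (rule B0)
      show "0 \<le> L * (nrm (y (k - 1) - y (n - 1)) + nrm (y k - y n))"
        by (intro mult_nonneg_nonneg L add_nonneg_nonneg nrm_nonneg diff_V yV)
    qed
    finally show "\<bar>g k n\<bar> * (L * nrm (y n - y (n - 1)) * (nrm (y (k - 1) - y (n - 1)) + nrm (y k - y n))) \<le> ?B * (L * T)" .
  qed
  also have "(\<Sum>n\<in>{?l..<k}. ?B * (L * T)) = real mk * (?B * (L * T))" using mk by simp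
  also have "\<dots> \<le> real m * (?B * (L * T))" using mk B0 L T0 by (intro mult_right_mono) auto
  finally have R: "nrm R \<le> q * (\<beta> k * \<xi> k * nrm (r k)) + real m * (?B * (L * T))" by simp
  define T' where "T' = nrm (r k) * h k + 2 * (\<Sum>j = k - mk + 1..k - 1. real (k - j) * nrm (r j) * h j)
          + real mk * nrm (r (k - mk)) * h (k - mk)"
  \<comment> \<open>The weights \<open>k - j\<close> and \<open>mk\<close> are at least one, and the
    terms are non-negative.\<close>
  have "T \<le> T'"
  proof -
    have "(\<Sum>j\<in>{?l + 1..k - 1}. E j) \<le> (\<Sum>j = k - mk + 1..k - 1. real (k - j) * nrm (r j) * h j)"
      unfolding mk(2)[symmetric]
    proof (rule sum_mono)
      fix j assume j: "j \<in> {?l + 1..k - 1}"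
      have "1 * E j \<le> real (k - j) * E j" using j lk by (intro mult_right_mono E0) auto
      then show "E j \<le> real (k - j) * nrm (r j) * h j" by (simp add: E_def mult.assoc)
    qed
    moreover have "1 * E ?l \<le> real mk * E ?l" using mk lk by (intro mult_right_mono E0) auto
    ultimately show ?thesis unfolding T_def T'_def mk(2)[symmetric] by (simp add: E_def mult.assoc)
  qed
  then have "real m * (?B * (L * T)) \<le> real m * (?B * (L * T'))"
    using B0 L by (intro mult_left_mono) auto
  \<comment> \<open>\<open>C\<close> absorbs \<open>m\<close> and \<open>C1\<close>; the two in
    \<open>2 * L\<close> cancels the division by two.\<close>
  also have "\<dots> = nrm (r k) * (C * (2 * L) * sqrt (1 - (\<xi> k)\<^sup>2) / 2 * T')"
    by (simp add: C algebra_simps)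
  finally have R': "nrm R \<le> q * (\<beta> k * \<xi> k * nrm (r k)) + nrm (r k) * (C * (2 * L) * sqrt (1 - (\<xi> k)\<^sup>2) / 2 * T')"
    using R by linarith
  have "nrm (r (k + 1)) \<le> nrm ((1 - \<beta> k) *\<^sub>R W) + nrm R"
    unfolding rk by (intro nrm_triangle scale_V WV RV)
  also have "nrm ((1 - \<beta> k) *\<^sub>R W) = (1 - \<beta> k) * (\<xi> k * nrm (r k))" using \<beta>[OF k] WV by (simp add: nrm_scale Wn)
  finally show ?thesis using R' unfolding T'_def[symmetric] by (simp add: algebra_simps)
qed

end

section \<open>The trilinear form\<close>

lemma l2inner_cong_AE:
  fixes u u' w :: "'a::euclidean_space \<Rightarrow> 'b::euclidean_space"
  assumes "AE x in lebesgue_on \<Omega>. u x = u' x" "u \<in> L2 \<Omega>" "u' \<in> L2 \<Omega>" "w \<in> L2 \<Omega>"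
  shows "l2inner \<Omega> u w = l2inner \<Omega> u' w"
  unfolding l2inner_def
proof (rule integral_cong_AE)
  show "AE x in lebesgue_on \<Omega>. u x \<bullet> w x = u' x \<bullet> w x" using assms(1) by eventually_elim simp
qed (use assms integrable_inner_L2 in blast)+

context domain
begin

definition h1inner :: "(real^'d \<Rightarrow> 'b::euclidean_space) \<Rightarrow> (real^'d \<Rightarrow> 'b) \<Rightarrow> real"
  where "h1inner u v = l2inner \<Omega> (grad \<Omega> u) (grad \<Omega> v)"

text \<open>The chosen gradient of a sum agrees with the sum of the chosen gradients almost
  everywhere, which is enough under the integral.\<close>

lemma semi_inner_H10: "semi_inner (H10 \<Omega> :: (real^'d \<Rightarrow> 'b::euclidean_space) set) h1inner"
proof
  fix x y z :: "real^'d \<Rightarrow> 'b" and c :: real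
  show "h1inner (x + y) z = h1inner x z + h1inner y z"
    if H: "x \<in> H10 \<Omega>" "y \<in> H10 \<Omega>" "z \<in> H10 \<Omega>"
  proof -
    have "x + y \<in> H10 \<Omega>" using H subspace_H10 subspace_add by blast
    then have "h1inner (x + y) z = l2inner \<Omega> (grad \<Omega> x + grad \<Omega> y) (grad \<Omega> z)"
      unfolding h1inner_def using grad_add[OF H(1,2)]
      by (intro l2inner_cong_AE L2_add grad_L2 H) auto
    then show ?thesis by (simp add: h1inner_def L2.ip_add_left grad_L2 H)
  qed
  show "h1inner (c *\<^sub>R x) y = c * h1inner x y" if H: "x \<in> H10 \<Omega>" "y \<in> H10 \<Omega>"
  proof -
    have "c *\<^sub>R x \<in> H10 \<Omega>" using H subspace_H10 subspace_scale by blast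
    then have "h1inner (c *\<^sub>R x) y = l2inner \<Omega> (c *\<^sub>R grad \<Omega> x) (grad \<Omega> y)"
      unfolding h1inner_def using grad_scale[OF H(1), of c]
      by (intro l2inner_cong_AE L2_scale grad_L2 H) (auto simp: scaleR_fun_def)
    then show ?thesis by (simp add: h1inner_def L2.ip_scale_left grad_L2 H)
  qed
  show "h1inner x y = h1inner y x" if "x \<in> H10 \<Omega>" "y \<in> H10 \<Omega>"
    unfolding h1inner_def by (simp add: l2inner_def inner_commute)
  show "h1inner x x \<ge> 0" by (simp add: h1inner_def l2inner_def)
qed (rule subspace_H10)

lemma h1_nrm: "semi_inner.nrm h1inner u = grad_norm \<Omega> u"
  by (simp add: semi_inner.nrm_def[OF semi_inner_H10] h1inner_def grad_norm_def l2norm_def l2inner_def dot_square_norm)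

lemma grad_norm_nonneg [simp]: "grad_norm \<Omega> u \<ge> 0"
  by (simp add: grad_norm_def)

lemma grad_norm_scale: "u \<in> H10 \<Omega> \<Longrightarrow> grad_norm \<Omega> (c *\<^sub>R u) = \<bar>c\<bar> * grad_norm \<Omega> u"
  using semi_inner.nrm_scale[OF semi_inner_H10] by (simp add: h1_nrm)

lemma H10_closed:
  "u \<in> H10 \<Omega> \<Longrightarrow> v \<in> H10 \<Omega> \<Longrightarrow> u + v \<in> H10 \<Omega>" "u \<in> H10 \<Omega> \<Longrightarrow> c *\<^sub>R u \<in> H10 \<Omega>" "0 \<in> H10 \<Omega>"
  using subspace_H10 subspace_add subspace_scale subspace_0 by blast+

text \<open>Linearity in the first and third argument holds at every point once the integrals may be
  split. In the second it holds only almost everywhere, because of the chosen representatives of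
  gradients.\<close>

lemma convect_trilinear:
  fixes v w :: "real^'d \<Rightarrow> 'b::euclidean_space"
  assumes card: "CARD('d) = 2 \<or> CARD('d) = 3"
    and H: "u \<in> H10 \<Omega>" "u' \<in> H10 \<Omega>" "v \<in> H10 \<Omega>" "v' \<in> H10 \<Omega>" "w \<in> H10 \<Omega>" "w' \<in> H10 \<Omega>"
  shows "l2inner \<Omega> (convect \<Omega> (u + u') v) w = l2inner \<Omega> (convect \<Omega> u v) w + l2inner \<Omega> (convect \<Omega> u' v) w" (is ?add1)
    and "l2inner \<Omega> (convect \<Omega> (c *\<^sub>R u) v) w = c * l2inner \<Omega> (convect \<Omega> u v) w" (is ?scale1)
    and "l2inner \<Omega> (convect \<Omega> u (v + v')) w = l2inner \<Omega> (convect \<Omega> u v) w + l2inner \<Omega> (convect \<Omega> u v') w" (is ?add2)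
    and "l2inner \<Omega> (convect \<Omega> u (c *\<^sub>R v)) w = c * l2inner \<Omega> (convect \<Omega> u v) w" (is ?scale2)
    and "l2inner \<Omega> (convect \<Omega> u v) (w + w') = l2inner \<Omega> (convect \<Omega> u v) w + l2inner \<Omega> (convect \<Omega> u v) w'" (is ?add3)
    and "l2inner \<Omega> (convect \<Omega> u v) (c *\<^sub>R w) = c * l2inner \<Omega> (convect \<Omega> u v) w" (is ?scale3)
proof -
  note int = integrable_convect[OF card]
  have "convect \<Omega> (u + u') v x = convect \<Omega> u v x + convect \<Omega> u' v x" for x
    by (simp add: convect_def scaleR_left_distrib sum.distrib)
  then show ?add1 by (simp add: l2inner_def inner_add_left int H)
  have "convect \<Omega> (c *\<^sub>R u) v x = c *\<^sub>R convect \<Omega> u v x" for x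
    by (simp add: convect_def scaleR_fun_def scaleR_sum_right)
  then show ?scale1 by (simp add: l2inner_def)
  have "l2inner \<Omega> (convect \<Omega> u (v + v')) w = (\<integral>x. convect \<Omega> u v x \<bullet> w x + convect \<Omega> u v' x \<bullet> w x \<partial>lebesgue_on \<Omega>)"
    unfolding l2inner_def
  proof (rule integral_cong_AE)
    show "AE x in lebesgue_on \<Omega>. convect \<Omega> u (v + v') x \<bullet> w x = convect \<Omega> u v x \<bullet> w x + convect \<Omega> u v' x \<bullet> w x"
      using grad_add[OF H(3,4)]
      by eventually_elim (simp add: convect_def scaleR_add_right sum.distrib inner_add_left)
  qed (use int[OF H(1) H10_closed(1)[OF H(3,4)] H(5)] int[OF H(1,3,5)] int[OF H(1,4,5)] in auto)
  then show ?add2 by (simp add: l2inner_def int H)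
  have "l2inner \<Omega> (convect \<Omega> u (c *\<^sub>R v)) w = (\<integral>x. c * (convect \<Omega> u v x \<bullet> w x) \<partial>lebesgue_on \<Omega>)"
    unfolding l2inner_def
  proof (rule integral_cong_AE)
    show "AE x in lebesgue_on \<Omega>. convect \<Omega> u (c *\<^sub>R v) x \<bullet> w x = c * (convect \<Omega> u v x \<bullet> w x)"
      using grad_scale[OF H(3), of c]
      by eventually_elim (simp add: convect_def inner_sum_left sum_distrib_left ac_simps)
  qed (use int[OF H(1) H10_closed(2)[OF H(3)] H(5)] int[OF H(1,3,5)] in auto)
  then show ?scale2 by (simp add: l2inner_def)
  show ?add3 by (simp add: l2inner_def inner_add_right int H)
  show ?scale3 by (simp add: l2inner_def scaleR_fun_def)
qed

lemma skew_conv_linear: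
  fixes v w :: "real^'d \<Rightarrow> 'b::euclidean_space"
  assumes card: "CARD('d) = 2 \<or> CARD('d) = 3"
    and H: "u \<in> H10 \<Omega>" "u' \<in> H10 \<Omega>" "v \<in> H10 \<Omega>" "v' \<in> H10 \<Omega>" "w \<in> H10 \<Omega>"
  shows "skew_conv \<Omega> (u + u') v w = skew_conv \<Omega> u v w + skew_conv \<Omega> u' v w"
    and "skew_conv \<Omega> (c *\<^sub>R u) v w = c * skew_conv \<Omega> u v w"
    and "skew_conv \<Omega> u (v + v') w = skew_conv \<Omega> u v w + skew_conv \<Omega> u v' w"
    and "skew_conv \<Omega> u (c *\<^sub>R v) w = c * skew_conv \<Omega> u v w"
  unfolding skew_conv_def
  \<comment> \<open>The second instance exchanges \<open>v\<close> and \<open>w\<close>, for the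
    subtracted half of the skew-symmetric form.\<close>
  using convect_trilinear(1,3,5)[OF card H(1,2,3,4,5) H(5)] convect_trilinear(1,3,5)[OF card H(1,2,5,5,3,4)]
    convect_trilinear(2,4,6)[OF card H(1,2,3,4,5) H(5), where c = c]
    convect_trilinear(2,4,6)[OF card H(1,2,5,5,3,4), where c = c]
  by (simp_all add: field_simps)

text \<open>The given bound is one-sided; applied to the negative of \<open>v\<close> it controls
  the other sign.\<close>

lemma skew_conv_abs_bound:
  fixes v w :: "real^'d \<Rightarrow> 'b::euclidean_space"
  assumes card: "CARD('d) = 2 \<or> CARD('d) = 3"
    and bound: "\<And>v w :: real^'d \<Rightarrow> 'b. \<lbrakk>v \<in> H10 \<Omega>; w \<in> H10 \<Omega>\<rbrakk> \<Longrightarrow>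
      skew_conv \<Omega> u v w \<le> M * grad_norm \<Omega> u * grad_norm \<Omega> v * grad_norm \<Omega> w"
    and H: "u \<in> H10 \<Omega>" "v \<in> H10 \<Omega>" "w \<in> H10 \<Omega>"
  shows "\<bar>skew_conv \<Omega> u v w\<bar> \<le> M * grad_norm \<Omega> u * grad_norm \<Omega> v * grad_norm \<Omega> w"
proof -
  have "skew_conv \<Omega> u (-1 *\<^sub>R v) w = - skew_conv \<Omega> u v w"
    using skew_conv_linear(4)[OF card H(1,1,2,2,3), of "-1"] by simp
  then show ?thesis
    using bound[OF H(2,3)] bound[OF H10_closed(2)[OF H(2)] H(3), of "-1"] grad_norm_scale[OF H(2), of "-1"]
    by simp
qed

text \<open>The bound \<open>B\<close> supplied by \<open>Hm1\<close> makes the supremum finite.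
  Where the gradient norm vanishes, the quotient is zero by convention and the same \<open>B\<close>
  forces \<open>F v = 0\<close>.\<close>

lemma dual_norm_bound:
  fixes F :: "(real^'d \<Rightarrow> 'b::euclidean_space) \<Rightarrow> real"
  assumes F: "F \<in> Hm1 \<Omega>"
  shows "v \<in> H10 \<Omega> \<Longrightarrow> \<bar>F v\<bar> \<le> dual_norm \<Omega> F * grad_norm \<Omega> v" and "dual_norm \<Omega> F \<ge> 0"
proof -
  obtain B where B: "\<And>v. v \<in> H10 \<Omega> \<Longrightarrow> \<bar>F v\<bar> \<le> B * grad_norm \<Omega> v" using F unfolding Hm1_def by blast
  have le: "\<bar>F v\<bar> / grad_norm \<Omega> v \<le> \<bar>B\<bar>" if "v \<in> H10 \<Omega>" for v
  proof (cases "grad_norm \<Omega> v = 0")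
    case False
    then have "grad_norm \<Omega> v > 0" using grad_norm_nonneg[of v] by linarith
    then have "\<bar>F v\<bar> / grad_norm \<Omega> v \<le> B" using B[OF that] by (simp add: field_simps)
    then show ?thesis by linarith
  qed simp
  have up: "\<bar>F v\<bar> / grad_norm \<Omega> v \<le> dual_norm \<Omega> F" if "v \<in> H10 \<Omega>" for v
    unfolding dual_norm_def by (rule cSUP_upper[OF that]) (auto intro!: bdd_aboveI2[where M = "\<bar>B\<bar>"] le)
  have "0 \<le> \<bar>F 0\<bar> / grad_norm \<Omega> (0 :: real^'d \<Rightarrow> 'b)" by simp
  with up[OF H10_closed(3)] show "dual_norm \<Omega> F \<ge> 0" by linarith
  show "\<bar>F v\<bar> \<le> dual_norm \<Omega> F * grad_norm \<Omega> v" if v: "v \<in> H10 \<Omega>"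
  proof (cases "grad_norm \<Omega> v = 0")
    case True then show ?thesis using B[OF v] by simp
  next
    case False
    then have "grad_norm \<Omega> v > 0" using grad_norm_nonneg[of v] by linarith
    then show ?thesis using up[OF v] by (simp add: field_simps)
  qed
qed

lemma integrable_divergence:
  assumes v: "v \<in> H10 \<Omega>" and q: "q \<in> L2 \<Omega>"
  shows "integrable (lebesgue_on \<Omega>) (\<lambda>x. divergence \<Omega> v x \<bullet> q x)"
proof -
  have "integrable (lebesgue_on \<Omega>) (\<lambda>x. (grad \<Omega> v x $ i $ i) * q x)" for i
  proof -
    have "(\<lambda>x. grad \<Omega> v x $ i \<bullet> axis i 1) \<in> L2 \<Omega>"
      by (intro L2_inner_right L2_component grad_L2 v) simp
    from integrable_inner_L2[OF this q] show ?thesis by (simp add: inner_axis)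
  qed
  then show ?thesis
    by (simp add: divergence_def sum_distrib_right Bochner_Integration.integrable_sum)
qed

text \<open>This is what makes the discretely divergence-free space \<open>Vh\<close> a
  subspace.\<close>

lemma divergence_pairing_linear:
  assumes H: "u \<in> H10 \<Omega>" "v \<in> H10 \<Omega>" and q: "q \<in> L2 \<Omega>"
  shows "l2inner \<Omega> (divergence \<Omega> (u + v)) q = l2inner \<Omega> (divergence \<Omega> u) q + l2inner \<Omega> (divergence \<Omega> v) q"
    and "l2inner \<Omega> (divergence \<Omega> (c *\<^sub>R u)) q = c * l2inner \<Omega> (divergence \<Omega> u) q"
proof -
  have "l2inner \<Omega> (divergence \<Omega> (u + v)) q = (\<integral>x. divergence \<Omega> u x \<bullet> q x + divergence \<Omega> v x \<bullet> q x \<partial>lebesgue_on \<Omega>)"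
    unfolding l2inner_def
  proof (rule integral_cong_AE)
    show "AE x in lebesgue_on \<Omega>. divergence \<Omega> (u + v) x \<bullet> q x = divergence \<Omega> u x \<bullet> q x + divergence \<Omega> v x \<bullet> q x"
      using grad_add[OF H] by eventually_elim (simp add: divergence_def sum.distrib distrib_right)
  qed (use integrable_divergence[OF H10_closed(1)[OF H] q] integrable_divergence[OF H(1) q]
        integrable_divergence[OF H(2) q] in auto)
  then show "l2inner \<Omega> (divergence \<Omega> (u + v)) q = l2inner \<Omega> (divergence \<Omega> u) q + l2inner \<Omega> (divergence \<Omega> v) q"
    unfolding l2inner_def using integrable_divergence[OF H(1) q] integrable_divergence[OF H(2) q] by simp
  have "l2inner \<Omega> (divergence \<Omega> (c *\<^sub>R u)) q = (\<integral>x. c * (divergence \<Omega> u x \<bullet> q x) \<partial>lebesgue_on \<Omega>)"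
    unfolding l2inner_def
  proof (rule integral_cong_AE)
    show "AE x in lebesgue_on \<Omega>. divergence \<Omega> (c *\<^sub>R u) x \<bullet> q x = c * (divergence \<Omega> u x \<bullet> q x)"
      using grad_scale[OF H(1), of c] by eventually_elim (simp add: divergence_def sum_distrib_left mult.assoc)
  qed (use integrable_divergence[OF H10_closed(2)[OF H(1)] q, of c] integrable_divergence[OF H(1) q] in auto)
  then show "l2inner \<Omega> (divergence \<Omega> (c *\<^sub>R u)) q = c * l2inner \<Omega> (divergence \<Omega> u) q"
    by (simp add: l2inner_def)
qed

end

lemma fin_dim_subspace: "fin_dim S \<Longrightarrow> subspace S"
  by (auto simp: fin_dim_def)

lemma (in semi_inner) semi_inner_subset: "subspace W \<Longrightarrow> W \<subseteq> V \<Longrightarrow> semi_inner W ip"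
  by unfold_locales (auto simp: subset_iff ip_add_left ip_scale_left ip_nonneg intro: ip_sym)

section \<open>The Boussinesq iteration\<close>

text \<open>Minkowski's inequality in the plane after scaling the coordinates by
  \<open>sqrt a\<close> and \<open>sqrt b\<close>. It joins velocity and temperature bounds while
  keeping first-order and second-order parts apart.\<close>

lemma weighted_norm_combination:
  fixes x y x0 x1 y0 y1 c a b :: real
  assumes ab: "a \<ge> 0" "b \<ge> 0" and c: "c \<ge> 0"
    and x: "0 \<le> x" "x \<le> x0 + c * x1" and y: "0 \<le> y" "y \<le> y0 + c * y1"
  shows "sqrt (a * x\<^sup>2 + b * y\<^sup>2) \<le> sqrt (a * x0\<^sup>2 + b * y0\<^sup>2) + c * sqrt (a * x1\<^sup>2 + b * y1\<^sup>2)"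
proof -
  have "sqrt (a * x\<^sup>2 + b * y\<^sup>2) \<le> sqrt (a * (x0 + c * x1)\<^sup>2 + b * (y0 + c * y1)\<^sup>2)"
    using assms by (intro real_sqrt_le_mono add_mono mult_left_mono power_mono) auto
  also have "\<dots> = sqrt ((sqrt a * x0 + c * (sqrt a * x1))\<^sup>2 + (sqrt b * y0 + c * (sqrt b * y1))\<^sup>2)"
  proof -
    have "a * (x0 + c * x1)\<^sup>2 = (sqrt a * (x0 + c * x1))\<^sup>2" "b * (y0 + c * y1)\<^sup>2 = (sqrt b * (y0 + c * y1))\<^sup>2"
      using ab by (simp_all add: power_mult_distrib)
    then show ?thesis by (simp add: algebra_simps)
  qed
  also have "\<dots> \<le> sqrt ((sqrt a * x0)\<^sup>2 + (sqrt b * y0)\<^sup>2) + sqrt ((c * (sqrt a * x1))\<^sup>2 + (c * (sqrt b * y1))\<^sup>2)"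
    by (rule real_sqrt_sum_squares_triangle_ineq)
  also have "sqrt ((sqrt a * x0)\<^sup>2 + (sqrt b * y0)\<^sup>2) = sqrt (a * x0\<^sup>2 + b * y0\<^sup>2)"
    using ab by (simp add: power_mult_distrib)
  also have "(c * (sqrt a * x1))\<^sup>2 + (c * (sqrt b * y1))\<^sup>2 = c\<^sup>2 * (a * x1\<^sup>2 + b * y1\<^sup>2)"
    using ab by (simp add: power_mult_distrib algebra_simps)
  also have "sqrt (c\<^sup>2 * (a * x1\<^sup>2 + b * y1\<^sup>2)) = c * sqrt (a * x1\<^sup>2 + b * y1\<^sup>2)"
    using c by (simp add: real_sqrt_mult)
  finally show ?thesis .
qed

lemma power2_powr: "(x::real) > 0 \<Longrightarrow> (x powr a)\<^sup>2 = x powr (2 * a)"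
  by (simp add: power2_eq_square flip: powr_add)

lemma powr_neg_three: "(x::real) > 0 \<Longrightarrow> x powr (-3) = 1 / x ^ 3"
  by (simp add: powr_minus_divide)

text \<open>Origin of \<open>CG\<close>, with \<open>A\<close> and \<open>B\<close> for
  \<open>K1\<close> and \<open>K2\<close>: the velocity gives \<open>(A + B)\<^sup>2\<close>, at
  most twice each square, and the temperature a third \<open>B\<^sup>2\<close>. The factor
  \<open>sqrt \<nu>\<close> turns a velocity gradient norm into a part of
  \<open>normB\<close>.\<close>

lemma lipschitz_constant_estimate:
  fixes \<nu> \<kappa> \<eta> M A B :: real
  assumes pos: "0 < \<eta>" "\<eta> \<le> \<nu>" "\<eta> \<le> \<kappa>" and nn: "M \<ge> 0"
  shows "sqrt (\<nu> * (M / \<nu> * (A + B))\<^sup>2 + \<kappa> * (M / \<kappa> * B)\<^sup>2)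
    \<le> (\<nu> powr (- 1/2) * \<eta> powr (- 1/2) * M * sqrt (2 * A\<^sup>2 + 3 * B\<^sup>2)) * sqrt \<nu>"
proof (rule real_le_lsqrt)
  have \<nu>\<kappa>: "\<nu> > 0" "\<kappa> > 0" using pos by auto
  have e1: "\<nu> * (M / \<nu> * (A + B))\<^sup>2 = M\<^sup>2 * ((A + B)\<^sup>2 / \<nu>)" "\<kappa> * (M / \<kappa> * B)\<^sup>2 = M\<^sup>2 * (B\<^sup>2 / \<kappa>)"
    using \<nu>\<kappa> by (simp_all add: power2_eq_square field_simps)
  have ab: "(A + B)\<^sup>2 \<le> 2 * A\<^sup>2 + 2 * B\<^sup>2"
    using sum_squares_bound[of A B] by (simp add: power2_sum)
  have "(A + B)\<^sup>2 / \<nu> + B\<^sup>2 / \<kappa> \<le> (A + B)\<^sup>2 / \<eta> + B\<^sup>2 / \<eta>"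
    using pos by (intro add_mono divide_left_mono) auto
  also have "\<dots> \<le> (2 * A\<^sup>2 + 3 * B\<^sup>2) / \<eta>"
    using pos ab by (simp add: divide_right_mono flip: add_divide_distrib)
  finally have "M\<^sup>2 * ((A + B)\<^sup>2 / \<nu> + B\<^sup>2 / \<kappa>) \<le> M\<^sup>2 * ((2 * A\<^sup>2 + 3 * B\<^sup>2) / \<eta>)"
    by (intro mult_left_mono) auto
  also have "\<dots> = ((\<nu> powr (- 1/2) * \<eta> powr (- 1/2) * M * sqrt (2 * A\<^sup>2 + 3 * B\<^sup>2)) * sqrt \<nu>)\<^sup>2"
  proof -
    have half: "(x powr (- 1/2))\<^sup>2 = 1 / x" if "x > 0" for x :: real
      using that by (subst power2_powr) (simp_all add: powr_minus_divide)
    show ?thesis unfolding power_mult_distrib half[OF pos(1)] half[OF \<nu>\<kappa>(1)] using \<nu>\<kappa> by simp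
  qed
  finally show "\<nu> * (M / \<nu> * (A + B))\<^sup>2 + \<kappa> * (M / \<kappa> * B)\<^sup>2 \<le> \<dots>"
    unfolding e1 by (simp only: distrib_left)
qed (use assms in auto)

text \<open>Origin of half of \<open>CG_hat\<close>: the square of \<open>A + 2 * B\<close> costs
  eight \<open>B\<^sup>2\<close> and the temperature a ninth; both denominators are at least the
  cube of \<open>\<eta>\<close>. The factor \<open>\<nu>\<close> is shared by the two velocity
  differences in each product.\<close>

lemma derivative_constant_estimate:
  fixes \<nu> \<kappa> \<eta> M A B :: real
  assumes pos: "0 < \<eta>" "\<eta> \<le> \<nu>" "\<eta> \<le> \<kappa>"
  shows "sqrt (\<nu> * (M\<^sup>2 / (\<nu> * \<eta>) * (A + 2 * B))\<^sup>2 + \<kappa> * (M\<^sup>2 / \<kappa>\<^sup>2 * B)\<^sup>2)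
    \<le> (inverse \<nu> * \<eta> powr (- 3/2) * M\<^sup>2 * sqrt (2 * A\<^sup>2 + 9 * B\<^sup>2)) * \<nu>"
proof (rule real_le_lsqrt)
  have \<nu>\<kappa>: "\<nu> > 0" "\<kappa> > 0" using pos by auto
  have e1: "\<nu> * (M\<^sup>2 / (\<nu> * \<eta>) * (A + 2 * B))\<^sup>2 = M^4 * ((A + 2 * B)\<^sup>2 / (\<nu> * \<eta>\<^sup>2))"
      "\<kappa> * (M\<^sup>2 / \<kappa>\<^sup>2 * B)\<^sup>2 = M^4 * (B\<^sup>2 / \<kappa>^3)"
    using \<nu>\<kappa> pos by (simp_all add: power2_eq_square power3_eq_cube power4_eq_xxxx field_simps)
  have ab: "(A + 2 * B)\<^sup>2 \<le> 2 * A\<^sup>2 + 8 * B\<^sup>2"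
    using sum_squares_bound[of A "2 * B"] by (simp add: power2_sum power_mult_distrib)
  have "\<eta> ^ 3 \<le> \<nu> * \<eta>\<^sup>2"
    using pos by (simp add: power3_eq_cube power2_eq_square)
  moreover have "\<eta> ^ 3 \<le> \<kappa> ^ 3" using pos by (intro power_mono) auto
  ultimately have "(A + 2 * B)\<^sup>2 / (\<nu> * \<eta>\<^sup>2) + B\<^sup>2 / \<kappa>^3 \<le> (A + 2 * B)\<^sup>2 / \<eta>^3 + B\<^sup>2 / \<eta>^3"
    using pos \<nu>\<kappa> by (intro add_mono divide_left_mono) auto
  also have "\<dots> \<le> (2 * A\<^sup>2 + 9 * B\<^sup>2) / \<eta>^3"
    using pos ab by (simp add: divide_right_mono flip: add_divide_distrib)
  finally have "M^4 * ((A + 2 * B)\<^sup>2 / (\<nu> * \<eta>\<^sup>2) + B\<^sup>2 / \<kappa>^3) \<le> M^4 * ((2 * A\<^sup>2 + 9 * B\<^sup>2) / \<eta>^3)"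
    by (intro mult_left_mono) auto
  also have "\<dots> = ((inverse \<nu> * \<eta> powr (- 3/2) * M\<^sup>2 * sqrt (2 * A\<^sup>2 + 9 * B\<^sup>2)) * \<nu>)\<^sup>2"
  proof -
    have p: "(\<eta> powr (- 3/2))\<^sup>2 = 1 / \<eta> ^ 3"
      using pos by (subst power2_powr) (simp_all add: powr_neg_three)
    show ?thesis unfolding power_mult_distrib p using \<nu>\<kappa> by (simp add: power_inverse)
  qed
  finally show "\<nu> * (M\<^sup>2 / (\<nu> * \<eta>) * (A + 2 * B))\<^sup>2 + \<kappa> * (M\<^sup>2 / \<kappa>\<^sup>2 * B)\<^sup>2 \<le> \<dots>"
    unfolding e1 by (simp only: distrib_left)
qed (use assms in auto)

lemma (in domain) convection_diffusion_H10:
  fixes Z :: "(real^'d \<Rightarrow> 'b::euclidean_space) set" and U :: "(real^'d \<Rightarrow> real^'d) set"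
  assumes card: "CARD('d) = 2 \<or> CARD('d) = 3"
    and Z: "subspace Z" "Z \<subseteq> H10 \<Omega>" and U: "subspace U" "U \<subseteq> H10 \<Omega>" and pos: "\<mu> > 0" "M \<ge> 0"
    and bound: "\<And>u v w. \<lbrakk>u \<in> H10 \<Omega>; v \<in> H10 \<Omega>; w \<in> H10 \<Omega>\<rbrakk> \<Longrightarrow>
      skew_conv \<Omega> u v (w :: real^'d \<Rightarrow> 'b) \<le> M * grad_norm \<Omega> u * grad_norm \<Omega> v * grad_norm \<Omega> w"
  shows "convection_diffusion Z h1inner U (grad_norm \<Omega>) (skew_conv \<Omega>) \<mu> M"
proof (intro convection_diffusion.intro convection_diffusion_axioms.intro)
  show "semi_inner Z h1inner"
    by (rule semi_inner.semi_inner_subset[OF semi_inner_H10 Z])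
  fix u u' :: "real^'d \<Rightarrow> real^'d" and y z z' :: "real^'d \<Rightarrow> 'b" and r :: real
  note lin = skew_conv_linear[OF card]
  show "skew_conv \<Omega> (u + u') z z' = skew_conv \<Omega> u z z' + skew_conv \<Omega> u' z z'"
    if "u \<in> U" "u' \<in> U" "z \<in> Z" "z' \<in> Z" using that U Z by (intro lin(1)[of u u' z z z']) auto
  show "skew_conv \<Omega> (r *\<^sub>R u) z z' = r * skew_conv \<Omega> u z z'"
    if "u \<in> U" "z \<in> Z" "z' \<in> Z" using that U Z by (intro lin(2)[of u u z z z']) auto
  show "skew_conv \<Omega> u (y + z) z' = skew_conv \<Omega> u y z' + skew_conv \<Omega> u z z'"
    if "u \<in> U" "y \<in> Z" "z \<in> Z" "z' \<in> Z" using that U Z by (intro lin(3)[of u u y z z']) auto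
  show "skew_conv \<Omega> u (r *\<^sub>R z) z' = r * skew_conv \<Omega> u z z'"
    if "u \<in> U" "z \<in> Z" "z' \<in> Z" using that U Z by (intro lin(4)[of u u z z z']) auto
  show "\<bar>skew_conv \<Omega> u z z'\<bar> \<le> M * grad_norm \<Omega> u * semi_inner.nrm h1inner z * semi_inner.nrm h1inner z'"
    if "u \<in> U" "z \<in> Z" "z' \<in> Z"
    unfolding h1_nrm using that U Z by (intro skew_conv_abs_bound[OF card bound]) auto
qed (use pos U in \<open>auto simp: skew_conv_def\<close>)

lemma (in domain) grad_norm_sq: "(grad_norm \<Omega> u)\<^sup>2 = h1inner u u"
  by (simp add: grad_norm_def l2norm_sq h1inner_def l2inner_def dot_square_norm)

section \<open>Stability and continuous dependence for one discrete Boussinesq step\<close>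

locale boussinesq_problem =
  fixes P :: "'d::{finite,linorder} boussinesq"
  assumes card: "CARD('d) = 2 \<or> CARD('d) = 3" and setting: "boussinesq_setting P"
    and buoyancy_small: "Ri P * (CP P)\<^sup>2 / eta P < 1"

sublocale boussinesq_problem \<subseteq> domain "Dom P"
  using setting by unfold_locales (auto simp: boussinesq_setting_def admissible_domain_def)

context boussinesq_problem
begin

abbreviation "\<Omega> \<equiv> Dom P"

lemma params: "nu P > 0" "kappa P > 0" "Ri P > 0" "CP P > 0" "bM P > 0"
  and data: "force P \<in> Hm1 \<Omega>" "heat P \<in> Hm1 \<Omega>"
  and XhWh: "Xh P \<subseteq> H10 \<Omega>" "Wh P \<subseteq> H10 \<Omega>" "fin_dim (Xh P)" "fin_dim (Wh P)" "Qh P \<subseteq> L20 \<Omega>"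
  and poincare: "v \<in> H10 \<Omega> \<Longrightarrow> l2norm \<Omega> v \<le> CP P * grad_norm \<Omega> v"
    "w \<in> H10 \<Omega> \<Longrightarrow> l2norm \<Omega> w \<le> CP P * grad_norm \<Omega> w"
  for v :: "'d vfield" and w :: "'d sfield"
  using setting by (auto simp: boussinesq_setting_def)

lemma eta: "eta P > 0" "eta P \<le> nu P" "eta P \<le> kappa P"
  using params by (auto simp: eta_def)

text \<open>Since \<open>eta\<close> is at most \<open>kappa\<close>, the buoyancy factor is
  compensated by the \<open>1 / kappa\<close> of every temperature estimate.\<close>

lemma Ri_CP: "Ri P * (CP P)\<^sup>2 \<le> eta P"
  using buoyancy_small eta by (simp add: field_simps)

lemma subspace_Wh: "subspace (Wh P)" by (rule fin_dim_subspace[OF XhWh(4)])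

lemma Vh_H10: "Vh P \<subseteq> H10 \<Omega>" using XhWh by (auto simp: Vh_def)

lemma subspace_Vh: "subspace (Vh P)"
proof -
  have X: "subspace (Xh P)" by (rule fin_dim_subspace[OF XhWh(3)])
  have q: "q \<in> L2 \<Omega>" if "q \<in> Qh P" for q using that XhWh(5) by (auto simp: L20_def)
  note lin = divergence_pairing_linear[OF subsetD[OF XhWh(1)] subsetD[OF XhWh(1)] q]
  show ?thesis
  proof (rule subspaceI)
    show "0 \<in> Vh P" unfolding Vh_def
      using lin(2)[OF subspace_0[OF X] subspace_0[OF X], of _ 0] subspace_0[OF X] by auto
    show "x + y \<in> Vh P" if "x \<in> Vh P" "y \<in> Vh P" for x y
      using that lin(1)[of x y] subspace_add[OF X] by (auto simp: Vh_def)
    show "c *\<^sub>R x \<in> Vh P" if "x \<in> Vh P" for c x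
      using that lin(2)[of x x _ c] subspace_scale[OF X] by (auto simp: Vh_def)
  qed
qed

lemma velocity_convection_diffusion: "convection_diffusion (Vh P) h1inner (Vh P) (grad_norm \<Omega>) (skew_conv \<Omega>) (nu P) (bM P)"
  using setting params
  by (intro convection_diffusion_H10[OF card subspace_Vh Vh_H10 subspace_Vh Vh_H10])
     (auto simp: boussinesq_setting_def)

lemma temperature_convection_diffusion: "convection_diffusion (Wh P) h1inner (Vh P) (grad_norm \<Omega>) (skew_conv \<Omega>) (kappa P) (bM P)"
  using setting params
  by (intro convection_diffusion_H10[OF card subspace_Wh XhWh(2) subspace_Vh Vh_H10])
     (auto simp: boussinesq_setting_def)

interpretation vel: convection_diffusion "Vh P" h1inner "Vh P" "grad_norm \<Omega>" "skew_conv \<Omega>" "nu P" "bM P"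
  by (rule velocity_convection_diffusion)

interpretation tem: convection_diffusion "Wh P" h1inner "Vh P" "grad_norm \<Omega>" "skew_conv \<Omega>" "kappa P" "bM P"
  by (rule temperature_convection_diffusion)

definition buoy :: "'d sfield \<Rightarrow> 'd vfield \<Rightarrow> real"
  where "buoy \<theta> v = l2inner \<Omega> (\<lambda>x. axis (Max UNIV) (\<theta> x)) v"

lemma axis_L2:
  fixes \<theta> :: "'d sfield"
  assumes "\<theta> \<in> L2 \<Omega>"
  shows "(\<lambda>x. axis i (\<theta> x)) \<in> L2 \<Omega>" and "l2norm \<Omega> (\<lambda>x. axis i (\<theta> x)) = l2norm \<Omega> \<theta>"
proof -
  have eq: "axis i (\<theta> x) = \<theta> x *\<^sub>R axis i 1" for x
    by (simp add: vec_eq_iff axis_def)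
  have m: "(\<lambda>x. axis i (\<theta> x)) \<in> borel_measurable (lebesgue_on \<Omega>)" unfolding eq using assms by auto
  show "(\<lambda>x. axis i (\<theta> x)) \<in> L2 \<Omega>" by (rule L2_bound[OF assms m]) (simp add: eq)
  show "l2norm \<Omega> (\<lambda>x. axis i (\<theta> x)) = l2norm \<Omega> \<theta>" by (simp add: l2norm_def eq)
qed

lemma buoy_add:
  assumes L: "\<theta> \<in> L2 \<Omega>" "\<theta>' \<in> L2 \<Omega>" "v \<in> L2 \<Omega>"
  shows "buoy (\<theta> + \<theta>') v = buoy \<theta> v + buoy \<theta>' v"
proof -
  have eq: "(\<lambda>x. axis (Max UNIV) ((\<theta> + \<theta>') x)) = (\<lambda>x. axis (Max UNIV) (\<theta> x)) + (\<lambda>x. axis (Max UNIV) (\<theta>' x))"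
    by (simp add: fun_eq_iff vec_eq_iff axis_def)
  show ?thesis unfolding buoy_def
    by (rule trans[OF arg_cong[OF eq, of "\<lambda>h. l2inner \<Omega> h v"] L2.ip_add_left])
       (intro axis_L2 L)+
qed

lemma buoy_scale: "buoy (c *\<^sub>R \<theta>) v = c * buoy \<theta> v"
proof -
  have "axis (Max UNIV) ((c *\<^sub>R \<theta>) x) \<bullet> v x = c * (axis (Max UNIV) (\<theta> x) \<bullet> v x)" for x
    by (simp add: scaleR_fun_def inner_axis')
  then show ?thesis by (simp add: buoy_def l2inner_def)
qed

text \<open>The source terms of \<open>perturbation\<close> appear in the form on the right; read
  backwards, they collapse to the buoyancy of the temperature part of \<open>R\<close>.\<close>

lemma buoy_combination:
  assumes "q1 \<in> L2 \<Omega>" "q0 \<in> L2 \<Omega>" "v \<in> L2 \<Omega>" "finite I" "\<And>n. n \<in> I \<Longrightarrow> b n \<in> L2 \<Omega> \<and> a n \<in> L2 \<Omega>"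
  shows "buoy (q1 - q0 + (\<Sum>n\<in>I. g n *\<^sub>R (b n - a n))) v
    = buoy q1 v - buoy q0 v + (\<Sum>n\<in>I. g n * (buoy (b n) v - buoy (a n) v))"
proof -
  have diff: "buoy (x - y) v = buoy x v - buoy y v" if "x \<in> L2 \<Omega>" "y \<in> L2 \<Omega>" for x y
    using buoy_add[of "x - y" y v] that assms(3) by (simp add: L2.diff_V)
  have "buoy (\<Sum>n\<in>I. g n *\<^sub>R (b n - a n)) v = (\<Sum>n\<in>I. g n * (buoy (b n) v - buoy (a n) v))"
    using assms(4,5)
  proof (induction I rule: finite_induct)
    case empty
    have "buoy 0 v = 0" using buoy_scale[of 0 0 v] by simp
    then show ?case by (simp only: sum.empty)
  next
    case (insert n I)
    have "(\<Sum>n\<in>I. g n *\<^sub>R (b n - a n)) \<in> L2 \<Omega>" using insert.prems by (intro L2.sum_V L2.scale_V L2.diff_V) auto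
    moreover have "g n *\<^sub>R (b n - a n) \<in> L2 \<Omega>" using insert.prems by (intro L2.scale_V L2.diff_V) auto
    ultimately have "buoy (g n *\<^sub>R (b n - a n) + (\<Sum>n\<in>I. g n *\<^sub>R (b n - a n))) v
        = g n * buoy (b n - a n) v + buoy (\<Sum>n\<in>I. g n *\<^sub>R (b n - a n)) v"
      by (simp only: buoy_add[OF _ _ assms(3)] buoy_scale)
    also have "buoy (b n - a n) v = buoy (b n) v - buoy (a n) v" using insert.prems by (intro diff) auto
    also have "buoy (\<Sum>n\<in>I. g n *\<^sub>R (b n - a n)) v = (\<Sum>n\<in>I. g n * (buoy (b n) v - buoy (a n) v))"
      by (rule insert.IH) (use insert.prems in auto)
    finally show ?case by (simp only: sum.insert[OF insert.hyps])
  qed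
  moreover have "(\<Sum>n\<in>I. g n *\<^sub>R (b n - a n)) \<in> L2 \<Omega>" using assms(5) by (intro L2.sum_V L2.scale_V L2.diff_V) auto
  ultimately show ?thesis
    by (simp only: buoy_add[OF L2.diff_V[OF assms(1,2)] _ assms(3)] diff[OF assms(1,2)])
qed

lemma buoy_bound:
  assumes \<theta>: "\<theta> \<in> H10 \<Omega>" and v: "v \<in> H10 \<Omega>"
  shows "\<bar>Ri P * buoy \<theta> v\<bar> \<le> Ri P * (CP P)\<^sup>2 * grad_norm \<Omega> \<theta> * grad_norm \<Omega> v"
proof -
  have "\<bar>buoy \<theta> v\<bar> \<le> l2norm \<Omega> \<theta> * l2norm \<Omega> v"
    using L2.cauchy_schwarz[OF axis_L2(1)[OF H10_L2[OF \<theta>]] H10_L2[OF v]]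
    by (simp add: buoy_def L2_nrm axis_L2(2)[OF H10_L2[OF \<theta>]])
  also have "\<dots> \<le> (CP P * grad_norm \<Omega> \<theta>) * (CP P * grad_norm \<Omega> v)"
    using params by (intro mult_mono poincare \<theta> v) auto
  finally have "Ri P * \<bar>buoy \<theta> v\<bar> \<le> Ri P * ((CP P * grad_norm \<Omega> \<theta>) * (CP P * grad_norm \<Omega> v))"
    using params by (intro mult_left_mono) auto
  then show ?thesis using params by (simp add: abs_mult power2_eq_square ac_simps)
qed

text \<open>The step is triangular: the temperature equation does not involve the new velocity, and
  the velocity equation sees the new temperature only as data.\<close>

lemma step_sol:
  assumes "boussinesq_step P s s'" "s \<in> Vh P \<times> Wh P"
  shows "vel.sol (fst s) (fst s') (\<lambda>v. Ri P * buoy (snd s') v + force P v)"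
    and "tem.sol (fst s) (snd s') (heat P)"
  using assms
  by (auto simp: boussinesq_step_def vel.sol_def tem.sol_def h1inner_def buoy_def split: prod.splits)

text \<open>Origin of \<open>K1\<close> and \<open>K2\<close>: the equations are tested with their
  own solutions, where convection drops out. The bounds do not depend on \<open>s\<close>, hence
  hold uniformly along the iteration.\<close>

lemma step_bounds:
  assumes st: "boussinesq_step P s s'" "s \<in> Vh P \<times> Wh P"
  shows "grad_norm \<Omega> (snd s') \<le> K2 P" and "grad_norm \<Omega> (fst s') \<le> K1 P"
proof -
  note sol = step_sol[OF st]
  have H: "fst s' \<in> H10 \<Omega>" "snd s' \<in> H10 \<Omega>"
    using sol Vh_H10 XhWh(2) by (auto simp: vel.sol_def tem.sol_def)
  show 2: "grad_norm \<Omega> (snd s') \<le> K2 P"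
    unfolding K2_def heat_norm_def
    by (rule tem.sol_bound[OF sol(2), unfolded h1_nrm])
       (use dual_norm_bound[OF data(2)] H in auto)
  have "\<bar>Ri P * buoy (snd s') (fst s') + force P (fst s')\<bar>
      \<le> Ri P * (CP P)\<^sup>2 * grad_norm \<Omega> (snd s') * grad_norm \<Omega> (fst s') + force_norm P * grad_norm \<Omega> (fst s')"
    unfolding force_norm_def
    by (rule order_trans[OF abs_triangle_ineq add_mono[OF buoy_bound[OF H(2,1)] dual_norm_bound(1)[OF data(1) H(1)]]])
  also have "\<dots> \<le> (Ri P * (CP P)\<^sup>2 * K2 P + force_norm P) * grad_norm \<Omega> (fst s')"
    using params 2 by (auto simp: distrib_right intro!: mult_right_mono mult_left_mono)
  finally have "grad_norm \<Omega> (fst s') \<le> (Ri P * (CP P)\<^sup>2 * K2 P + force_norm P) / nu P"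
    using params dual_norm_bound(2)[OF data(1)] dual_norm_bound(2)[OF data(2)]
    by (intro vel.sol_bound[OF sol(1), unfolded h1_nrm]) (auto simp: K2_def heat_norm_def force_norm_def)
  also have "\<dots> = K1 P" using params by (simp add: K1_def K2_def field_simps)
  finally show "grad_norm \<Omega> (fst s') \<le> K1 P" .
qed

lemma K_nonneg: "K1 P \<ge> 0" "K2 P \<ge> 0"
  using params dual_norm_bound(2)[OF data(1)] dual_norm_bound(2)[OF data(2)]
  by (auto simp: K1_def K2_def heat_norm_def force_norm_def)

text \<open>Both problems have the same heat source, so only the difference of the transporting
  velocities contributes.\<close>

lemma tem_lipschitz:
  assumes s: "boussinesq_step P s s'" "s \<in> Vh P \<times> Wh P" and p: "boussinesq_step P p p'" "p \<in> Vh P \<times> Wh P"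
  shows "grad_norm \<Omega> (snd s' - snd p') \<le> bM P * K2 P / kappa P * grad_norm \<Omega> (fst s - fst p)"
proof -
  have "grad_norm \<Omega> (snd s' - snd p') \<le> (bM P * grad_norm \<Omega> (fst s - fst p) * grad_norm \<Omega> (snd p') + 0) / kappa P"
    by (rule tem.lipschitz[OF step_sol(2)[OF s] step_sol(2)[OF p], unfolded h1_nrm]) auto
  also have "\<dots> \<le> (bM P * grad_norm \<Omega> (fst s - fst p) * K2 P + 0) / kappa P"
    using params step_bounds(1)[OF p] by (intro divide_right_mono add_mono mult_left_mono) auto
  finally show ?thesis by (simp add: ac_simps)
qed

lemma step_H10:
  assumes "boussinesq_step P s s'" "s \<in> Vh P \<times> Wh P"
  shows "fst s' \<in> Vh P" "snd s' \<in> Wh P" "fst s' \<in> H10 \<Omega>" "snd s' \<in> H10 \<Omega>"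
  using assms Vh_H10 XhWh(2) by (auto simp: boussinesq_step_def split: prod.splits)

text \<open>The difference of transporting fields contributes \<open>K1\<close>; the buoyancy of the
  temperature difference contributes \<open>K2\<close>, with \<open>kappa\<close> cancelling by
  smallness of the buoyancy.\<close>

lemma vel_lipschitz:
  assumes s: "boussinesq_step P s s'" "s \<in> Vh P \<times> Wh P" and p: "boussinesq_step P p p'" "p \<in> Vh P \<times> Wh P"
  shows "grad_norm \<Omega> (fst s' - fst p') \<le> bM P * (K1 P + K2 P) / nu P * grad_norm \<Omega> (fst s - fst p)"
proof -
  let ?R = "fst s' - fst p'" and ?d = "grad_norm \<Omega> (fst s - fst p)"
  note H = step_H10[OF s] step_H10[OF p]
  have RV: "?R \<in> Vh P" using H by auto
  have RH: "?R \<in> H10 \<Omega>" and TH: "snd s' - snd p' \<in> H10 \<Omega>"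
    using RV Vh_H10 subspace_diff[OF subspace_H10 H(4,8)] by auto
  have "Ri P * buoy (snd s') ?R + force P ?R - (Ri P * buoy (snd p') ?R + force P ?R) = Ri P * buoy (snd s' - snd p') ?R"
    using buoy_combination[OF H10_L2[OF H(4)] H10_L2[OF H(8)] H10_L2[OF RH], of "{}"]
    by (simp add: right_diff_distrib)
  also have "\<bar>\<dots>\<bar> \<le> Ri P * (CP P)\<^sup>2 * grad_norm \<Omega> (snd s' - snd p') * grad_norm \<Omega> ?R"
    by (rule buoy_bound[OF TH RH])
  finally have "grad_norm \<Omega> ?R \<le> (bM P * ?d * grad_norm \<Omega> (fst p') + Ri P * (CP P)\<^sup>2 * grad_norm \<Omega> (snd s' - snd p')) / nu P"
    by (rule vel.lipschitz[OF step_sol(1)[OF s] step_sol(1)[OF p], unfolded h1_nrm])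
       (intro mult_nonneg_nonneg grad_norm_nonneg zero_le_power less_imp_le params)
  also have "\<dots> \<le> (bM P * ?d * K1 P + bM P * ?d * K2 P) / nu P"
  proof (intro divide_right_mono add_mono mult_left_mono step_bounds(2)[OF p])
    have "Ri P * (CP P)\<^sup>2 * grad_norm \<Omega> (snd s' - snd p') \<le> kappa P * (bM P * K2 P / kappa P * ?d)"
      using params Ri_CP eta tem_lipschitz[OF s p] by (intro mult_mono) auto
    then show "Ri P * (CP P)\<^sup>2 * grad_norm \<Omega> (snd s' - snd p') \<le> bM P * ?d * K2 P"
      using params by (simp add: ac_simps)
  qed (use params in auto)
  finally show ?thesis by (simp add: algebra_simps)
qed

lemma grad_norm_le_normB:
  "sqrt (nu P) * grad_norm \<Omega> (fst s) \<le> normB P s"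
proof -
  have "sqrt (nu P) * grad_norm \<Omega> (fst s) = sqrt (nu P * (grad_norm \<Omega> (fst s))\<^sup>2)"
    by (simp add: real_sqrt_mult)
  also have "\<dots> \<le> normB P s" unfolding normB_def using params by (intro real_sqrt_le_mono) simp
  finally show ?thesis .
qed

lemma normB_nonneg: "normB P s \<ge> 0"
  using params by (simp add: normB_def)

text \<open>The linearised problem at \<open>p1\<close> is solved by the combination of the increments \<open>q1 - q0\<close> and
  \<open>b' n - a' n\<close> with a right-hand side that is linear in \<open>s\<close> up to products of increments.\<close>

lemma step_combination:
  assumes fin: "finite I"
    and p1: "boussinesq_step P p1 q1" "p1 \<in> Vh P \<times> Wh P" and p0: "boussinesq_step P p0 q0" "p0 \<in> Vh P \<times> Wh P"
    and b: "\<And>n. n \<in> I \<Longrightarrow> boussinesq_step P (b n) (b' n)" "\<And>n. n \<in> I \<Longrightarrow> b n \<in> Vh P \<times> Wh P"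
    and a: "\<And>n. n \<in> I \<Longrightarrow> boussinesq_step P (a n) (a' n)" "\<And>n. n \<in> I \<Longrightarrow> a n \<in> Vh P \<times> Wh P"
    and s: "p1 - p0 = s - (\<Sum>n\<in>I. g n *\<^sub>R (b n - a n))"
  shows "normB P (q1 - q0 + (\<Sum>n\<in>I. g n *\<^sub>R (b' n - a' n)))
    \<le> CG P * normB P s + (\<Sum>n\<in>I. \<bar>g n\<bar> * (CG_hat P / 2 * normB P (b n - a n) *
          (normB P (p0 - a n) + normB P (p1 - b n))))"
proof -
  define R where "R = q1 - q0 + (\<Sum>n\<in>I. g n *\<^sub>R (b' n - a' n))"
  define S where "S = grad_norm \<Omega> (fst s)"
  define \<delta> where "\<delta> = (\<lambda>n. grad_norm \<Omega> (fst (b n) - fst (a n)))"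
  define d0 where "d0 = (\<lambda>n. grad_norm \<Omega> (fst p0 - fst (a n)))"
  define d1 where "d1 = (\<lambda>n. grad_norm \<Omega> (fst p1 - fst (b n)))"
  \<comment> \<open>The sum of products of velocity differences, common to the temperature and the
    velocity estimate, so that the second-order parts can be joined with one factor.\<close>
  define c where "c = (\<Sum>n\<in>I. \<bar>g n\<bar> * (\<delta> n * (d0 n + d1 n)))"
  have nn: "S \<ge> 0" "\<delta> n \<ge> 0" "d0 n \<ge> 0" "d1 n \<ge> 0" for n
    by (simp_all add: S_def \<delta>_def d0_def d1_def)
  have csum: "(\<Sum>n\<in>I. \<bar>g n\<bar> * (\<delta> n * (d0 n + d1 n)) * x) = c * x" for x
    by (simp add: c_def sum_distrib_right)
  have c0: "c \<ge> 0" unfolding c_def using nn by (intro sum_nonneg mult_nonneg_nonneg) auto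
  let ?M = "bM P" and ?\<nu> = "nu P" and ?\<kappa> = "kappa P" and ?\<eta> = "eta P" and ?K1 = "K1 P" and ?K2 = "K2 P"
  have M0: "?M \<ge> 0" using params by simp
  note K = K_nonneg
  have comps: "fst (x *\<^sub>R y) = x *\<^sub>R fst y" "snd (x *\<^sub>R y) = x *\<^sub>R snd y" for x :: real and y :: "'d state"
    by simp_all
  have fst_s: "fst p1 - fst p0 = fst s - (\<Sum>n\<in>I. g n *\<^sub>R (fst (b n) - fst (a n)))"
    using arg_cong[OF s, of fst] by (simp only: fst_diff fst_sum comps)
  have fst_R: "fst R = fst q1 - fst q0 + (\<Sum>n\<in>I. g n *\<^sub>R (fst (b' n) - fst (a' n)))"
    by (simp only: R_def fst_diff fst_add fst_sum comps)
  have snd_R: "snd R = snd q1 - snd q0 + (\<Sum>n\<in>I. g n *\<^sub>R (snd (b' n) - snd (a' n)))"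
    by (simp only: R_def snd_diff snd_add snd_sum comps)
  note Hq = step_H10[OF p1] step_H10[OF p0]
  note Hb = step_H10[OF b] and Ha = step_H10[OF a]
  have RW: "snd R \<in> Wh P" unfolding snd_R using Hq Ha Hb by (auto intro!: tem.add_V tem.sum_V)
  have RV: "fst R \<in> Vh P" unfolding fst_R using Hq Ha Hb by (auto intro!: vel.add_V vel.sum_V)
  have RH: "snd R \<in> H10 \<Omega>" "fst R \<in> H10 \<Omega>" using RW RV XhWh(2) Vh_H10 by auto
  \<comment> \<open>A Lipschitz constant \<open>k\<close> of the step turns differences of solutions
    into differences of arguments, so both products contain \<open>\<delta> n\<close>.\<close>
  have pert: "\<bar>g n\<bar> * (?M * \<delta> n * x + ?M * d1 n * z) \<le> \<bar>g n\<bar> * (\<delta> n * (d0 n + d1 n)) * (?M * k)"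
    if "x \<le> k * d0 n" "z \<le> k * \<delta> n" for n x z k
  proof -
    have "?M * \<delta> n * x + ?M * d1 n * z \<le> ?M * \<delta> n * (k * d0 n) + ?M * d1 n * (k * \<delta> n)"
      using that nn M0 by (intro add_mono mult_left_mono) auto
    also have "\<dots> = \<delta> n * (d0 n + d1 n) * (?M * k)" by (simp add: algebra_simps)
    finally show ?thesis by (simp add: mult_left_mono mult.assoc)
  qed
  have T: "grad_norm \<Omega> (snd R) \<le> ?M / ?\<kappa> * ?K2 * S + c * (?M\<^sup>2 / ?\<kappa>\<^sup>2 * ?K2)"
  proof -
    have "grad_norm \<Omega> (snd R) \<le> (?M * S * grad_norm \<Omega> (snd q0)
        + (\<Sum>n\<in>I. \<bar>g n\<bar> * (?M * \<delta> n * grad_norm \<Omega> (snd q0 - snd (a' n)) + ?M * d1 n * grad_norm \<Omega> (snd (b' n) - snd (a' n))))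
        + 0) / ?\<kappa>"
      unfolding S_def \<delta>_def d1_def
      by (rule tem.perturbation[OF fin step_sol(2)[OF p1] step_sol(2)[OF p0] step_sol(2)[OF b] step_sol(2)[OF a]
            fst_s snd_R, unfolded h1_nrm]) auto
    also have "\<dots> \<le> (?M * S * ?K2 + (\<Sum>n\<in>I. \<bar>g n\<bar> * (\<delta> n * (d0 n + d1 n)) * (?M * (?M * ?K2 / ?\<kappa>))) + 0) / ?\<kappa>"
    proof (intro divide_right_mono add_mono sum_mono pert)
      show "?M * S * grad_norm \<Omega> (snd q0) \<le> ?M * S * ?K2"
        using step_bounds(1)[OF p0] nn M0 by (intro mult_left_mono) auto
      fix n assume n: "n \<in> I"
      show "grad_norm \<Omega> (snd q0 - snd (a' n)) \<le> ?M * ?K2 / ?\<kappa> * d0 n"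
        unfolding d0_def by (rule tem_lipschitz[OF p0 a[OF n]])
      show "grad_norm \<Omega> (snd (b' n) - snd (a' n)) \<le> ?M * ?K2 / ?\<kappa> * \<delta> n"
        unfolding \<delta>_def by (rule tem_lipschitz[OF b[OF n] a[OF n]])
    qed (use params in auto)
    also have "\<dots> = ?M / ?\<kappa> * ?K2 * S + c * (?M\<^sup>2 / ?\<kappa>\<^sup>2 * ?K2)"
      unfolding csum using params by (simp add: power2_eq_square field_simps)
    finally show ?thesis .
  qed
  have U: "grad_norm \<Omega> (fst R) \<le> ?M / ?\<nu> * (?K1 + ?K2) * S + c * (?M\<^sup>2 / (?\<nu> * ?\<eta>) * (?K1 + 2 * ?K2))"
  proof -
    let ?L = "?M * (?K1 + ?K2) / ?\<nu>"
    have "Ri P * buoy (snd q1) (fst R) + force P (fst R) - (Ri P * buoy (snd q0) (fst R) + force P (fst R))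
        + (\<Sum>n\<in>I. g n * (Ri P * buoy (snd (b' n)) (fst R) + force P (fst R) - (Ri P * buoy (snd (a' n)) (fst R) + force P (fst R))))
      = Ri P * (buoy (snd q1) (fst R) - buoy (snd q0) (fst R) + (\<Sum>n\<in>I. g n * (buoy (snd (b' n)) (fst R) - buoy (snd (a' n)) (fst R))))"
      by (simp add: algebra_simps sum_distrib_left)
    \<comment> \<open>The forces cancel and the buoyancies recombine, so the velocity source is
      governed by the temperature bound \<open>T\<close> just proved.\<close>
    also have "\<dots> = Ri P * buoy (snd R) (fst R)"
      by (subst snd_R, subst buoy_combination)
         (intro conjI refl fin H10_L2 Hq(4) Hq(8) RH(2) Hb(4) Ha(4) | assumption)+
    also have "\<bar>\<dots>\<bar> \<le> Ri P * (CP P)\<^sup>2 * grad_norm \<Omega> (snd R) * grad_norm \<Omega> (fst R)" by (rule buoy_bound[OF RH])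
    finally have l: "\<bar>Ri P * buoy (snd q1) (fst R) + force P (fst R) - (Ri P * buoy (snd q0) (fst R) + force P (fst R))
        + (\<Sum>n\<in>I. g n * (Ri P * buoy (snd (b' n)) (fst R) + force P (fst R) - (Ri P * buoy (snd (a' n)) (fst R) + force P (fst R))))\<bar>
        \<le> Ri P * (CP P)\<^sup>2 * grad_norm \<Omega> (snd R) * grad_norm \<Omega> (fst R)" .
    have "grad_norm \<Omega> (fst R) \<le> (?M * S * grad_norm \<Omega> (fst q0)
        + (\<Sum>n\<in>I. \<bar>g n\<bar> * (?M * \<delta> n * grad_norm \<Omega> (fst q0 - fst (a' n)) + ?M * d1 n * grad_norm \<Omega> (fst (b' n) - fst (a' n))))
        + Ri P * (CP P)\<^sup>2 * grad_norm \<Omega> (snd R)) / ?\<nu>"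
      unfolding S_def \<delta>_def d1_def
      by (rule vel.perturbation[OF fin step_sol(1)[OF p1] step_sol(1)[OF p0] step_sol(1)[OF b] step_sol(1)[OF a]
            fst_s fst_R, unfolded h1_nrm])
         (rule l | assumption | intro mult_nonneg_nonneg grad_norm_nonneg zero_le_power less_imp_le params)+
    also have "\<dots> \<le> (?M * S * ?K1 + (\<Sum>n\<in>I. \<bar>g n\<bar> * (\<delta> n * (d0 n + d1 n)) * (?M * ?L))
        + (?M * ?K2 * S + c * (?M\<^sup>2 / ?\<eta> * ?K2))) / ?\<nu>"
    proof (intro divide_right_mono add_mono sum_mono pert)
      show "?M * S * grad_norm \<Omega> (fst q0) \<le> ?M * S * ?K1"
        using step_bounds(2)[OF p0] nn M0 by (intro mult_left_mono) auto
      show "grad_norm \<Omega> (fst q0 - fst (a' n)) \<le> ?L * d0 n" if n: "n \<in> I" for n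
        unfolding d0_def by (rule vel_lipschitz[OF p0 a[OF n]])
      show "grad_norm \<Omega> (fst (b' n) - fst (a' n)) \<le> ?L * \<delta> n" if n: "n \<in> I" for n
        unfolding \<delta>_def by (rule vel_lipschitz[OF b[OF n] a[OF n]])
      have "Ri P * (CP P)\<^sup>2 * grad_norm \<Omega> (snd R) \<le> ?\<kappa> * (?M / ?\<kappa> * ?K2 * S + c * (?M\<^sup>2 / ?\<kappa>\<^sup>2 * ?K2))"
        using params Ri_CP eta T by (intro mult_mono) auto
      also have "\<dots> = ?M * ?K2 * S + c * (?M\<^sup>2 / ?\<kappa> * ?K2)"
        using params by (simp add: power2_eq_square field_simps)
      also have "\<dots> \<le> ?M * ?K2 * S + c * (?M\<^sup>2 / ?\<eta> * ?K2)"
        using params eta K c0 by (intro add_left_mono mult_left_mono mult_right_mono divide_left_mono) auto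
      finally show "Ri P * (CP P)\<^sup>2 * grad_norm \<Omega> (snd R) \<le> \<dots>" .
    qed (use params in auto)
    also have "\<dots> = ?M / ?\<nu> * (?K1 + ?K2) * S + c * (?M\<^sup>2 / ?\<nu> * ((?K1 + ?K2) / ?\<nu> + ?K2 / ?\<eta>))"
      unfolding csum using params eta by (simp add: power2_eq_square field_simps)
    \<comment> \<open>Coarsening one \<open>1 / ?\<nu>\<close> to \<open>1 / ?\<eta>\<close> merges
      the transport and the buoyancy contribution; this is where \<open>?K1 + 2 * ?K2\<close> comes
      from.\<close>
    also have "\<dots> \<le> ?M / ?\<nu> * (?K1 + ?K2) * S + c * (?M\<^sup>2 / ?\<nu> * ((?K1 + ?K2) / ?\<eta> + ?K2 / ?\<eta>))"
      using params eta K c0 by (intro add_left_mono mult_left_mono add_right_mono divide_left_mono) auto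
    also have "\<dots> = ?M / ?\<nu> * (?K1 + ?K2) * S + c * (?M\<^sup>2 / (?\<nu> * ?\<eta>) * (?K1 + 2 * ?K2))"
      using params eta by (simp add: field_simps)
    finally show ?thesis .
  qed
  \<comment> \<open>The first root is linear in \<open>S\<close> and leads to \<open>CG\<close>; the
    second multiplies \<open>c\<close> and leads to half of \<open>CG_hat\<close>.\<close>
  have "normB P R \<le> sqrt (?\<nu> * (?M / ?\<nu> * (?K1 + ?K2) * S)\<^sup>2 + ?\<kappa> * (?M / ?\<kappa> * ?K2 * S)\<^sup>2)
      + c * sqrt (?\<nu> * (?M\<^sup>2 / (?\<nu> * ?\<eta>) * (?K1 + 2 * ?K2))\<^sup>2 + ?\<kappa> * (?M\<^sup>2 / ?\<kappa>\<^sup>2 * ?K2)\<^sup>2)"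
    unfolding normB_def using params by (intro weighted_norm_combination c0 U T) auto
  also have "?\<nu> * (?M / ?\<nu> * (?K1 + ?K2) * S)\<^sup>2 + ?\<kappa> * (?M / ?\<kappa> * ?K2 * S)\<^sup>2
      = (?\<nu> * (?M / ?\<nu> * (?K1 + ?K2))\<^sup>2 + ?\<kappa> * (?M / ?\<kappa> * ?K2)\<^sup>2) * S\<^sup>2"
  proof -
    have "a * (x * S)\<^sup>2 + b * (z * S)\<^sup>2 = (a * x\<^sup>2 + b * z\<^sup>2) * S\<^sup>2" for a b x z
      by (simp add: power_mult_distrib distrib_right)
    then show ?thesis .
  qed
  also have "sqrt \<dots> = sqrt (?\<nu> * (?M / ?\<nu> * (?K1 + ?K2))\<^sup>2 + ?\<kappa> * (?M / ?\<kappa> * ?K2)\<^sup>2) * S"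
    using nn(1) by (simp add: real_sqrt_mult)
  also have "\<dots> \<le> (CG P * sqrt ?\<nu>) * S"
    unfolding CG_def by (intro mult_right_mono lipschitz_constant_estimate eta M0 nn(1))
  also have "\<dots> \<le> CG P * normB P s"
    using grad_norm_le_normB[of s] params by (simp add: S_def mult.assoc CG_def mult_left_mono)
  also have "c * sqrt (?\<nu> * (?M\<^sup>2 / (?\<nu> * ?\<eta>) * (?K1 + 2 * ?K2))\<^sup>2 + ?\<kappa> * (?M\<^sup>2 / ?\<kappa>\<^sup>2 * ?K2)\<^sup>2)
      \<le> c * (CG_hat P / 2 * ?\<nu>)"
    using derivative_constant_estimate[OF eta, of ?M ?K1 ?K2]
    by (intro mult_left_mono c0) (simp add: CG_hat_def)
  also have "\<dots> \<le> (\<Sum>n\<in>I. \<bar>g n\<bar> * (CG_hat P / 2 * normB P (b n - a n) * (normB P (p0 - a n) + normB P (p1 - b n))))"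
    unfolding c_def sum_distrib_right
  proof (rule sum_mono)
    fix n
    have H: "CG_hat P / 2 \<ge> 0" using params by (simp add: CG_hat_def)
    \<comment> \<open>With \<open>w\<close> the root of the viscosity, each of the two factors
      becomes a velocity part of \<open>normB\<close>.\<close>
    have "\<delta> n * (d0 n + d1 n) * (w * w) = (w * \<delta> n) * (w * d0 n + w * d1 n)" for w
      by (simp add: algebra_simps)
    from this[of "sqrt ?\<nu>"]
    have "\<delta> n * (d0 n + d1 n) * ?\<nu> = (sqrt ?\<nu> * \<delta> n) * (sqrt ?\<nu> * d0 n + sqrt ?\<nu> * d1 n)"
      using params by simp
    also have "\<dots> \<le> normB P (b n - a n) * (normB P (p0 - a n) + normB P (p1 - b n))"
      using grad_norm_le_normB[of "b n - a n"] grad_norm_le_normB[of "p0 - a n"] grad_norm_le_normB[of "p1 - b n"]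
        nn params normB_nonneg
      by (intro mult_mono add_mono) (auto simp: \<delta>_def d0_def d1_def)
    finally have "\<bar>g n\<bar> * (CG_hat P / 2 * (\<delta> n * (d0 n + d1 n) * ?\<nu>))
      \<le> \<bar>g n\<bar> * (CG_hat P / 2 * (normB P (b n - a n) * (normB P (p0 - a n) + normB P (p1 - b n))))"
      using H by (intro mult_left_mono) auto
    then show "\<bar>g n\<bar> * (\<delta> n * (d0 n + d1 n)) * (CG_hat P / 2 * ?\<nu>)
      \<le> \<bar>g n\<bar> * (CG_hat P / 2 * normB P (b n - a n) * (normB P (p0 - a n) + normB P (p1 - b n)))"
      by (simp add: ac_simps)
  qed
  finally show ?thesis unfolding R_def by simp
qed

section \<open>The energy product on states and the transfer of the abstract estimate\<close>

definition ipB :: "'d state \<Rightarrow> 'd state \<Rightarrow> real"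
  where "ipB s t = nu P * h1inner (fst s) (fst t) + kappa P * h1inner (snd s) (snd t)"

lemma semi_inner_ipB: "semi_inner (Vh P \<times> Wh P) ipB"
proof
  show "subspace (Vh P \<times> Wh P)" by (intro subspace_Times subspace_Vh subspace_Wh)
  fix x y z :: "'d state" and c :: real
  assume x: "x \<in> Vh P \<times> Wh P"
  show "ipB x x \<ge> 0"
    using params x vel.ip_nonneg[of "fst x"] tem.ip_nonneg[of "snd x"] by (auto simp: ipB_def)
  assume y: "y \<in> Vh P \<times> Wh P"
  show "ipB (c *\<^sub>R x) y = c * ipB x y"
    using x y by (auto simp: ipB_def vel.ip_scale_left tem.ip_scale_left algebra_simps)
  show "ipB x y = ipB y x"
    using x y vel.ip_sym[of "fst x" "fst y"] tem.ip_sym[of "snd x" "snd y"] by (auto simp: ipB_def)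
  assume z: "z \<in> Vh P \<times> Wh P"
  show "ipB (x + y) z = ipB x z + ipB y z"
    using x y z by (auto simp: ipB_def vel.ip_add_left tem.ip_add_left algebra_simps)
qed

lemma nrm_ipB: "semi_inner.nrm ipB s = normB P s"
  by (simp add: semi_inner.nrm_def[OF semi_inner_ipB] ipB_def normB_def grad_norm_sq)

text \<open>By the Poincare inequality vanishing gradients force vanishing functions; read
  contrapositively, the residuals have non-zero norm, as the abstract estimate demands.\<close>

lemma normB_zero_is_null:
  assumes s: "s \<in> Vh P \<times> Wh P" and z: "normB P s = 0"
  shows "is_null P s"
proof -
  have H: "fst s \<in> H10 \<Omega>" "snd s \<in> H10 \<Omega>" using s Vh_H10 XhWh(2) by auto
  have "nu P * (grad_norm \<Omega> (fst s))\<^sup>2 + kappa P * (grad_norm \<Omega> (snd s))\<^sup>2 = 0"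
    using z by (simp add: normB_def)
  moreover have "nu P * (grad_norm \<Omega> (fst s))\<^sup>2 \<ge> 0" "kappa P * (grad_norm \<Omega> (snd s))\<^sup>2 \<ge> 0"
    using params by simp_all
  ultimately have "nu P * (grad_norm \<Omega> (fst s))\<^sup>2 = 0" "kappa P * (grad_norm \<Omega> (snd s))\<^sup>2 = 0" by linarith+
  then have "grad_norm \<Omega> (fst s) = 0" "grad_norm \<Omega> (snd s) = 0" using params by auto
  then have "l2norm \<Omega> (fst s) = 0" "l2norm \<Omega> (snd s) = 0"
    using poincare(1)[OF H(1)] poincare(2)[OF H(2)] l2norm_nonneg[of \<Omega> "fst s"] l2norm_nonneg[of \<Omega> "snd s"]
    by auto
  then have "AE x in lebesgue_on \<Omega>. fst s x = 0" "AE x in lebesgue_on \<Omega>. snd s x = 0"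
    using l2norm_eq_0 H10_L2 H by blast+
  then show ?thesis unfolding is_null_def by eventually_elim simp
qed

text \<open>A positive lower bound excludes \<open>normB P a = 0\<close>, because division by zero
  would make the sine zero. The denominator can then be cleared, and the infimum lies below every
  competitor.\<close>

lemma direction_sine_bound:
  assumes "c > 0" "direction_sine P a S \<ge> c" "s \<in> S"
  shows "c * normB P a \<le> normB P (a - s)"
proof -
  have "bdd_below ((\<lambda>s. normB P (a - s)) ` S)" by (rule bdd_belowI2[of _ 0]) (rule normB_nonneg)
  then have le: "(INF s\<in>S. normB P (a - s)) \<le> normB P (a - s)" by (rule cINF_lower[OF _ assms(3)])
  have "normB P a \<noteq> 0" using assms(1,2) by (auto simp: direction_sine_def)
  then have "normB P a > 0" using normB_nonneg[of a] by simp
  then have "c * normB P a \<le> (INF s\<in>S. normB P (a - s))"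
    using assms(2) by (simp add: direction_sine_def field_simps)
  with le show ?thesis by simp
qed

lemma CG_nonneg: "CG P \<ge> 0" "CG_hat P \<ge> 0"
  using params by (simp_all add: CG_def CG_hat_def)

text \<open>Complete induction, since an update uses the whole window. The solutions
  \<open>t j\<close> lie in the space by definition of a step, and the residuals up to
  \<open>j\<close> involve only iterates below \<open>j\<close>.\<close>

lemma anderson_iterates:
  assumes A: "anderson_boussinesq P m \<beta> \<alpha> y t"
  shows "y j \<in> Vh P \<times> Wh P" and "j \<ge> 1 \<Longrightarrow> t j \<in> Vh P \<times> Wh P"
proof -
  interpret B: semi_inner "Vh P \<times> Wh P" ipB by (rule semi_inner_ipB)
  have tV: "t j \<in> Vh P \<times> Wh P" if "j \<ge> 1" for j
  proof -
    have "boussinesq_step P (y (j - 1)) (t j)" using A that by (simp add: anderson_boussinesq_def)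
    then have "fst (t j) \<in> Vh P \<and> snd (t j) \<in> Wh P" by (auto simp: boussinesq_step_def split: prod.splits)
    then show ?thesis by (simp add: mem_Times_iff)
  qed
  have comb: "aa_comb m k a x \<in> Vh P \<times> Wh P" if "k \<ge> 1" "\<And>j. 1 \<le> j \<Longrightarrow> j \<le> k \<Longrightarrow> x j \<in> Vh P \<times> Wh P"
    for k a and x :: "nat \<Rightarrow> 'd state"
    unfolding aa_comb_def using that by (intro B.add_V B.scale_V B.sum_V) (auto simp: depth_def)
  show yV: "y j \<in> Vh P \<times> Wh P" for j
  proof (induction j rule: less_induct)
    case (less j)
    consider "j = 0" | "j = 1" | "j \<ge> 2" by linarith
    then show ?case
    proof cases
      case 3
      then have "y j = aa_comb m j (\<alpha> j) (\<lambda>i. y (i - 1)) + \<beta> j *\<^sub>R aa_comb m j (\<alpha> j) (residual y t)"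
        using A by (simp add: anderson_boussinesq_def)
      also have "\<dots> \<in> Vh P \<times> Wh P"
      proof (intro B.add_V B.scale_V comb)
        fix i assume i: "1 \<le> i" "i \<le> j"
        show "y (i - 1) \<in> Vh P \<times> Wh P" using i by (intro less) simp
        then show "residual y t i \<in> Vh P \<times> Wh P" unfolding residual_def by (intro B.diff_V tV i(1))
      qed (use 3 in simp_all)
      finally show ?thesis .
    qed (use A tV[of 1] in \<open>simp_all add: anderson_boussinesq_def\<close>)
  qed
  show "t j \<in> Vh P \<times> Wh P" if "j \<ge> 1" by (rule tV[OF that])
qed

lemma anderson_residual:
  fixes c_s :: real and m k :: nat
  defines "C \<equiv> real m * ((1 + 1 / c_s) ^ m / c_s / (1 - CG P))"
  assumes m: "m \<ge> 1" and cs: "c_s > 0" and cG: "CG P < 1"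
    and \<beta>: "\<beta> 1 = 1" "\<forall>k\<ge>2. 0 < \<beta> k \<and> \<beta> k \<le> 1"
    and A: "anderson_boussinesq P m \<beta> \<alpha> y t" and k: "k \<ge> 2"
    and nz: "\<forall>j\<in>{1..k}. \<not> is_null P (residual y t j)"
    and sine: "\<forall>j\<in>{1..k - 1}.
         direction_sine P (residual y t (j + 1) - residual y t j)
           (span ((\<lambda>n. residual y t (n + 1) - residual y t n)
                   ` {max 1 (j + 1 - depth m k)..j - 1})) \<ge> c_s"
  shows "let r = residual y t; \<xi> = opt_gain P m \<alpha> r; mk = depth m k in
     \<exists>h. (\<forall>j\<in>{k - mk..k}. h j \<le> C * sqrt (1 - (\<xi> j)\<^sup>2) + \<beta> j * \<xi> j) \<and>
       normB P (r (k + 1)) \<le> normB P (r k) *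
         (\<xi> k * (1 - \<beta> k + CG P * \<beta> k)
          + C * CG_hat P * sqrt (1 - (\<xi> k)\<^sup>2) / 2 *
            (normB P (r k) * h k
             + 2 * (\<Sum>j = k - mk + 1..k - 1. real (k - j) * normB P (r j) * h j)
             + real mk * normB P (r (k - mk)) * h (k - mk)))"
proof -
  interpret B: semi_inner "Vh P \<times> Wh P" ipB by (rule semi_inner_ipB)
  note V = anderson_iterates[OF A]
  have step: "boussinesq_step P (y (j - 1)) (t j)" if "j \<ge> 1" for j
    using A that by (simp add: anderson_boussinesq_def)
  have step': "boussinesq_step P (y j) (t (Suc j))" for j using step[of "Suc j"] by simp
  let ?r = "residual y t"
  \<comment> \<open>\<open>step_combination\<close> at the current and the previous iterate, with
    corrections between consecutive iterates.\<close>
  have key: "normB P (t (Suc k) - t k + (\<Sum>n\<in>I. g n *\<^sub>R (t (Suc n) - t n)))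
        \<le> CG P * normB P s + (\<Sum>n\<in>I. \<bar>g n\<bar> * (CG_hat P / 2 * normB P (y n - y (n - 1)) *
             (normB P (y (k - 1) - y (n - 1)) + normB P (y k - y n))))"
    if "k \<ge> 1" "finite I" "\<And>n. n \<in> I \<Longrightarrow> n \<ge> 1"
      "y k - y (k - 1) = s - (\<Sum>n\<in>I. g n *\<^sub>R (y n - y (n - 1)))" for k I g s
    by (rule step_combination[OF that(2) step' V(1) step[OF that(1)] V(1) step' V(1) step[OF that(3)] V(1) that(4)])
  \<comment> \<open>The case without corrections, where \<open>s\<close> is the full
    increment.\<close>
  have lip: "normB P (t (Suc n) - t n) \<le> CG P * normB P (y n - y (n - 1))" if "n \<ge> 1" for n
    using key[OF that, of "{}" "y n - y (n - 1)"] by simp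
  have rV: "?r j \<in> Vh P \<times> Wh P" if "j \<ge> 1" for j
    unfolding residual_def by (intro B.diff_V V that)
  have xi: "(if j = 1 then 1 else normB P (aa_comb m j (\<alpha> j) ?r) / normB P (?r j)) = opt_gain P m \<alpha> ?r j" for j
    by (simp add: opt_gain_def)
  have bound: "normB P (?r (k + 1)) \<le> normB P (?r k) *
      (opt_gain P m \<alpha> ?r k * (1 - \<beta> k + CG P * \<beta> k) + C * (2 * (CG_hat P / 2)) * sqrt (1 - (opt_gain P m \<alpha> ?r k)\<^sup>2) / 2 *
        (normB P (?r k) * (C * sqrt (1 - (opt_gain P m \<alpha> ?r k)\<^sup>2) + \<beta> k * opt_gain P m \<alpha> ?r k)
          + 2 * (\<Sum>j = k - depth m k + 1..k - 1. real (k - j) * normB P (?r j)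
                * (C * sqrt (1 - (opt_gain P m \<alpha> ?r j)\<^sup>2) + \<beta> j * opt_gain P m \<alpha> ?r j))
          + real (depth m k) * normB P (?r (k - depth m k))
             * (C * sqrt (1 - (opt_gain P m \<alpha> ?r (k - depth m k))\<^sup>2)
                 + \<beta> (k - depth m k) * opt_gain P m \<alpha> ?r (k - depth m k))))"
    unfolding C_def
  \<comment> \<open>\<open>L\<close> is half of \<open>CG_hat\<close>, so that \<open>2 * L\<close>
    is the constant in the claim.\<close>
  proof (rule B.anderson_residual_bound[of y t m \<alpha> \<beta> "CG P" "CG_hat P / 2" k c_s, unfolded nrm_ipB xi])
    show "normB P (?r j) \<noteq> 0" if "j \<in> {1..k}" for j
      using nz that normB_zero_is_null[OF rV[of j]] by auto
    show "c_s * normB P (?r (j + 1) - ?r j) \<le> normB P (?r (j + 1) - ?r j - s)"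
      if "j \<in> {1..k - 1}" "s \<in> span ((\<lambda>n. ?r (n + 1) - ?r n) ` {max 1 (j + 1 - depth m k)..j - 1})" for j s
      by (rule direction_sine_bound[OF cs _ that(2)]) (use sine that(1) in blast)
    show "normB P (t (Suc k) - t k + (\<Sum>n\<in>I. g n *\<^sub>R (t (Suc n) - t n)))
        \<le> CG P * normB P s + (\<Sum>n\<in>I. \<bar>g n\<bar> * (CG_hat P / 2 * normB P (y n - y (n - 1)) *
             (normB P (y (k - 1) - y (n - 1)) + normB P (y k - y n))))"
      if "k \<ge> 1" "finite I" "\<And>n. n \<in> I \<Longrightarrow> n \<ge> 1"
        "y k - y (k - 1) = s - (\<Sum>n\<in>I. g n *\<^sub>R (y n - y (n - 1)))" for k I g s
      by (rule key[OF that])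
    show "normB P (aa_comb m k (\<alpha> k) ?r) \<le> normB P (aa_comb m k a ?r)" if "k \<ge> 2" for k a
      using A that by (simp add: anderson_boussinesq_def)
    show "y k = aa_comb m k (\<alpha> k) (\<lambda>j. y (j - 1)) + \<beta> k *\<^sub>R aa_comb m k (\<alpha> k) ?r" if "k \<ge> 2" for k
      using A that by (simp add: anderson_boussinesq_def)
    show "y 1 = t 1" using A by (simp add: anderson_boussinesq_def)
  qed (use V \<beta> lip CG_nonneg cG m k cs in auto)
  \<comment> \<open>The witness for \<open>h\<close> is its own upper bound.\<close>
  show ?thesis unfolding Let_def
    by (rule exI[of _ "\<lambda>j. C * sqrt (1 - (opt_gain P m \<alpha> ?r j)\<^sup>2) + \<beta> j * opt_gain P m \<alpha> ?r j"])
       (use bound in simp)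
qed

end

theorem theorem3p1:
  fixes m :: nat and c_s c_G :: real
  assumes "CARD('d::{finite,linorder}) = 2 \<or> CARD('d) = 3"
    and "m \<ge> 1" and "c_s > 0" and "c_G < 1"
  shows "\<exists>C>0. \<forall>(P :: 'd boussinesq) \<beta> \<alpha> y t k.
    boussinesq_setting P
    \<and> bM P / (eta P)\<^sup>2 * (2 * (Ri P * (CP P)\<^sup>2 / kappa P * heat_norm P + force_norm P)
                          + bM P / (kappa P)\<^sup>2 * (heat_norm P)\<^sup>2) < 1
    \<and> Ri P * (CP P)\<^sup>2 / eta P < 1
    \<and> CG P = c_G
    \<and> \<beta> 1 = 1 \<and> (\<forall>k\<ge>2. 0 < \<beta> k \<and> \<beta> k \<le> 1)
    \<and> anderson_boussinesq P m \<beta> \<alpha> y t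
    \<and> k \<ge> 2
    \<and> (\<forall>j\<in>{1..k}. \<not> is_null P (residual y t j))
    \<and> (\<forall>j\<in>{1..k - 1}. \<not> is_null P (residual y t (j + 1) - residual y t j))
    \<and> (\<forall>j\<in>{1..k - 1}.
         direction_sine P (residual y t (j + 1) - residual y t j)
           (span ((\<lambda>n. residual y t (n + 1) - residual y t n)
                   ` {max 1 (j + 1 - depth m k)..j - 1})) \<ge> c_s)
    \<longrightarrow>
    (let r = residual y t; \<xi> = opt_gain P m \<alpha> r; mk = depth m k in
     \<exists>h. (\<forall>j\<in>{k - mk..k}. h j \<le> C * sqrt (1 - (\<xi> j)\<^sup>2) + \<beta> j * \<xi> j) \<and>
       normB P (r (k + 1)) \<le> normB P (r k) *
         (\<xi> k * (1 - \<beta> k + CG P * \<beta> k)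
          + C * CG_hat P * sqrt (1 - (\<xi> k)\<^sup>2) / 2 *
            (normB P (r k) * h k
             + 2 * (\<Sum>j = k - mk + 1..k - 1. real (k - j) * normB P (r j) * h j)
             + real mk * normB P (r (k - mk)) * h (k - mk))))"
\<comment> \<open>The witness contains only \<open>m\<close>, \<open>c_s\<close> and
  \<open>c_G\<close>; the problem is quantified afterwards, and \<open>CG P = c_G\<close> links it
  to this constant.\<close>
proof (intro exI[of _ "real m * ((1 + 1 / c_s) ^ m / c_s / (1 - c_G))"] conjI allI impI, goal_cases)
  case 1
  show ?case
    using assms(2-4) by (auto intro!: mult_pos_pos divide_pos_pos zero_less_power add_pos_pos)
next
  case (2 P \<beta> \<alpha> y t k)
  then interpret boussinesq_problem P using assms(1) by unfold_locales auto
  from 2 have c: "c_G = CG P" by simp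
  show ?case unfolding c using 2 assms(2-4) by (intro anderson_residual) auto
qed

end
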